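(* Let $K$ be an infinite field of arbitrary characteristic, $R=K[x,y,z]$, $S=K[x,y]$. Let $I=(x^a,y^b,z^c,x^\alpha y^\beta z^\gamma)\subset R$, where $0\le\alpha<a$, $0\le\beta<b$, $0\le\gamma<c$ are integers with at most one of $\alpha,\beta,\gamma$ zero, be associated to a punctured hexagon; that is, $a+b+c+\alpha+\beta+\gamma\equiv0\pmod3$ and, with $s=\frac13(a+b+c+\alpha+\beta+\gamma)-2$, $A=s+2-a$, $B=s+2-b$, $C=s+2-c$, $M=s+2-(\alpha+\beta+\gamma)$, one has $0\le M$, $0\le A\le\beta+\gamma$, $0\le B\le\alpha+\gamma$, $0\le C\le\alpha+\beta$. Let $J=(x^a,y^b,(x+y)^c,x^\alpha y^\beta(x+y)^\gamma)\subset S$. Then the following conditions are equivalent: (i) the algebra $R/I$ has the weak Lefschetz property; (ii) the regularity of $S/J$ is $s$; (iii) the determinant of $N_{a,b,c,\alpha,\beta,\gamma}$ modulo the characteristic of $K$ is non-zero; (iv) the determinant of $Z_{a,b,c,\alpha,\beta,\gamma}$ modulo the characteristic of $K$ is non-zero. Moreover, if the characteristic of $K$ is zero, then there is one further equivalent condition: (v) the generic splitting type of $\operatorname{syz}I$ is $(s+2,s+2,s+2)$.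
   Context: An artinian standard graded $K$-algebra $Q$ has the weak Lefschetz property if there is a linear form $\ell\in[Q]_1$ such that for all integers $d$ the map $\times\ell:[Q]_d\to[Q]_{d+1}$ is injective or surjective. Regularity is Castelnuovo--Mumford regularity. "Non-zero modulo the characteristic" means non-zero when the characteristic is $0$. $N_{a,b,c,\alpha,\beta,\gamma}$ is the $(C+M)\times(C+M)$ integer matrix with $(i,j)$ entry $\binom{c}{A+j-i}$ if $1\le i\le C$ and $\binom{\gamma}{A+C-\beta+j-i}$ if $C+1\le i\le C+M$, where $\binom nk=0$ if $k<0$ or $k>n$ (determinant of the empty matrix is $1$). $Z_{a,b,c,\alpha,\beta,\gamma}$ is the integer matrix with rows indexed by the monomials $m_i$ of degree $s$ not in $I$ and columns indexed by the monomials $n_j$ of degree $s+1$ not in $I$ (both in lexicographic order; the numbers of rows and columns agree), with entry $1$ if $m_i$ divides $n_j$ and $0$ otherwise. $\operatorname{syz}I$ is the kernel of $R(-\alpha-\beta-\gamma)\oplus R(-a)\oplus R(-b)\oplus R(-c)\to I$. Its generic splitting type is the (unordered) triple $(p,q,r)$ such that the restriction of the sheafification $\widetilde{\operatorname{syz}I}$ on $\mathbb P^2$ to the line $H$ given by $x+y+z=0$ is $\mathcal O_H(-p)\oplus\mathcal O_H(-q)\oplus\mathcal O_H(-r)$; equivalently $\operatorname{syz}J\cong S(-p)\oplus S(-q)\oplus S(-r)$, where $\operatorname{syz}J$ is the kernel of $S(-\alpha-\beta-\gamma)\oplus S(-a)\oplus S(-b)\oplus S(-c)\to J$ given by the listed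 generators of $J$. In characteristic zero over an algebraically closed field, the inequalities on $A,B,C,M$ are equivalent to semistability of the syzygy bundle $\widetilde{\operatorname{syz}I}$. *)

theory Defs
  imports
    "HOL-Library.Poly_Mapping"
    "HOL-Library.Numeral_Type"
    "HOL-Library.Multiset"
    "HOL-Number_Theory.Cong"
    "HOL-Algebra.QuotRing"
    "HOL-Algebra.Algebraic_Closure_Type"
    "Jordan_Normal_Form.Matrix_Kernel"
begin

section \<open>Polynomial rings and their grading\<close>

text \<open>
  Polynomials with variables indexed by \<open>'v\<close>: finitely supported functions from exponent vectors
  to coefficients. \<open>K[x,y,z]\<close> is \<open>(3, 'k) pol\<close> with \<open>x\<close>, \<open>y\<close>, \<open>z\<close> the variables
  \<open>0\<close>, \<open>1\<close>, \<open>2\<close>, and \<open>K[x,y]\<close> is \<open>(2, 'k) pol\<close> with \<open>x\<close>, \<open>y\<close> the variables \<open>0\<close>, \<open>1\<close>.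
\<close>

type_synonym ('v, 'k) pol = "('v \<Rightarrow>\<^sub>0 nat) \<Rightarrow>\<^sub>0 'k"

definition pvar :: "'v \<Rightarrow> ('v, 'k::comm_ring_1) pol" where
  "pvar v = Poly_Mapping.single (Poly_Mapping.single v 1) 1"

definition exp_degree :: "('v \<Rightarrow>\<^sub>0 nat) \<Rightarrow> nat" where
  "exp_degree m = (\<Sum>v \<in> Poly_Mapping.keys m. Poly_Mapping.lookup m v)"

definition homogeneous :: "int \<Rightarrow> ('v, 'k::comm_ring_1) pol set" where
  "homogeneous d = {f. \<forall>m \<in> Poly_Mapping.keys f. int (exp_degree m) = d}"

definition ideal_gen :: "'r::comm_ring_1 set \<Rightarrow> 'r set" where
  "ideal_gen G = genideal ring_of_type_algebra G"


section \<open>The weak Lefschetz property\<close>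

text \<open>
  \<open>Qd d\<close> is the homogeneous component of degree \<open>d\<close> of the graded algebra \<open>Q\<close>.
\<close>

definition weak_Lefschetz :: "('q, 'm) ring_scheme \<Rightarrow> (int \<Rightarrow> 'q set) \<Rightarrow> bool" where
  "weak_Lefschetz Q Qd \<longleftrightarrow>
     (\<exists>l \<in> Qd 1. \<forall>d. inj_on (\<lambda>q. l \<otimes>\<^bsub>Q\<^esub> q) (Qd d) \<or>
                     (\<lambda>q. l \<otimes>\<^bsub>Q\<^esub> q) ` Qd d = Qd (d + 1))"

definition quot_ring :: "'r::comm_ring_1 set \<Rightarrow> 'r set ring" where
  "quot_ring I = ring_of_type_algebra Quot I"

definition quot_component :: "('v, 'k::comm_ring_1) pol set \<Rightarrow> int \<Rightarrow> ('v, 'k) pol set set" where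
  "quot_component I d = (\<lambda>f. I +>\<^bsub>ring_of_type_algebra\<^esub> f) ` homogeneous d"


section \<open>Graded free modules, regularity, splitting of syzygies\<close>

text \<open>
  The component of degree \<open>d\<close> of the graded free module with generators in degrees
  \<open>es ! 0, es ! 1, \<dots>\<close>, that is, of the direct sum of the modules \<open>S(- es ! k)\<close>.
\<close>

definition free_component :: "int list \<Rightarrow> int \<Rightarrow> ('v, 'k::comm_ring_1) pol vec set" where
  "free_component es d =
     {v \<in> carrier_vec (length es). \<forall>k < length es. v $ k \<in> homogeneous (d - es ! k)}"

text \<open>
  A minimal graded free resolution
  \<open>\<dots> \<rightarrow> F 2 \<rightarrow> F 1 \<rightarrow> F 0 = S \<rightarrow> S/J \<rightarrow> 0\<close> of \<open>S/J\<close> for a proper homogeneous ideal \<open>J\<close>: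
  \<open>F i\<close> has generators in the degrees \<open>ds i\<close> (finitely many for each \<open>i\<close>), the matrix \<open>D i\<close> is the
  map \<open>F (i + 1) \<rightarrow> F i\<close>, and \<open>F 0 \<rightarrow> S/J\<close> is the canonical projection. The last condition
  (entries without constant term) says that \<open>D i\<close> maps into the multiple of \<open>F i\<close> by the
  homogeneous maximal ideal.
\<close>

definition minimal_free_resolution ::
  "('v, 'k::comm_ring_1) pol set \<Rightarrow> (nat \<Rightarrow> int list) \<Rightarrow> (nat \<Rightarrow> ('v, 'k) pol mat) \<Rightarrow> bool" where
  "minimal_free_resolution J ds D \<longleftrightarrow>
     ds 0 = [0] \<and>
     (\<forall>i. D i \<in> carrier_mat (length (ds i)) (length (ds (Suc i)))) \<and>
     (\<forall>i d. \<forall>v \<in> free_component (ds (Suc i)) d. D i *\<^sub>v v \<in> free_component (ds i) d) \<and>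
     (\<lambda>v. D 0 *\<^sub>v v) ` carrier_vec (length (ds 1)) = {w \<in> carrier_vec 1. w $ 0 \<in> J} \<and>
     (\<forall>i. (\<lambda>v. D (Suc i) *\<^sub>v v) ` carrier_vec (length (ds (Suc (Suc i)))) = mat_kernel (D i)) \<and>
     (\<forall>i. \<forall>k < length (ds i). \<forall>l < length (ds (Suc i)).
        Poly_Mapping.lookup (D i $$ (k, l)) 0 = 0)"

text \<open>
  The Castelnuovo--Mumford regularity of \<open>S/J\<close> is \<open>r\<close>: the maximum of \<open>e - i\<close> over the degrees
  \<open>e\<close> of the generators of the \<open>i\<close>-th module of a minimal graded free resolution of \<open>S/J\<close>
  (independent of the resolution, as minimal resolutions are unique up to isomorphism).
\<close>

definition quot_has_regularity :: "('v, 'k::comm_ring_1) pol set \<Rightarrow> int \<Rightarrow> bool" where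
  "quot_has_regularity J r \<longleftrightarrow>
     (\<exists>ds D. minimal_free_resolution J ds D \<and>
        (\<exists>i. \<exists>e \<in> set (ds i). e - int i = r) \<and>
        (\<forall>i. \<forall>e \<in> set (ds i). e - int i \<le> r))"

definition syz :: "'r::comm_ring_1 list \<Rightarrow> 'r vec set" where
  "syz gs = {v \<in> carrier_vec (length gs). v \<bullet> vec_of_list gs = 0}"

text \<open>
  The syzygy module of the homogeneous polynomials \<open>gs\<close> of degrees \<open>es\<close>, graded as a submodule of
  the direct sum of the \<open>S(- es ! k)\<close>, is isomorphic as a graded module to the direct sum of the
  \<open>S(-p)\<close>, where \<open>p\<close> runs through the multiset \<open>T\<close>.
\<close>

definition syz_splits_as ::
  "('v, 'k::comm_ring_1) pol list \<Rightarrow> int list \<Rightarrow> int multiset \<Rightarrow> bool" where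
  "syz_splits_as gs es T \<longleftrightarrow>
     (\<exists>ps \<phi>. mset ps = T \<and>
        bij_betw \<phi> (carrier_vec (length ps)) (syz gs) \<and>
        (\<forall>v \<in> carrier_vec (length ps). \<forall>w \<in> carrier_vec (length ps). \<phi> (v + w) = \<phi> v + \<phi> w) \<and>
        (\<forall>f. \<forall>v \<in> carrier_vec (length ps). \<phi> (f \<cdot>\<^sub>v v) = f \<cdot>\<^sub>v \<phi> v) \<and>
        (\<forall>d. \<phi> ` free_component ps d = syz gs \<inter> free_component es d))"


section \<open>The ideals\<close>

definition hexagon_gens ::
  "nat \<Rightarrow> nat \<Rightarrow> nat \<Rightarrow> nat \<Rightarrow> nat \<Rightarrow> nat \<Rightarrow> 'r::comm_ring_1 \<Rightarrow> 'r \<Rightarrow> 'r \<Rightarrow> 'r list" where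
  "hexagon_gens a b c \<alpha> \<beta> \<gamma> x y z = [x ^ \<alpha> * y ^ \<beta> * z ^ \<gamma>, x ^ a, y ^ b, z ^ c]"

definition ideal_I :: "nat \<Rightarrow> nat \<Rightarrow> nat \<Rightarrow> nat \<Rightarrow> nat \<Rightarrow> nat \<Rightarrow> (3, 'k::field) pol set" where
  "ideal_I a b c \<alpha> \<beta> \<gamma> =
     ideal_gen (set (hexagon_gens a b c \<alpha> \<beta> \<gamma> (pvar 0) (pvar 1) (pvar 2)))"

definition gens_J :: "nat \<Rightarrow> nat \<Rightarrow> nat \<Rightarrow> nat \<Rightarrow> nat \<Rightarrow> nat \<Rightarrow> (2, 'k::field) pol list" where
  "gens_J a b c \<alpha> \<beta> \<gamma> = hexagon_gens a b c \<alpha> \<beta> \<gamma> (pvar 0) (pvar 1) (pvar 0 + pvar 1)"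

definition ideal_J :: "nat \<Rightarrow> nat \<Rightarrow> nat \<Rightarrow> nat \<Rightarrow> nat \<Rightarrow> nat \<Rightarrow> (2, 'k::field) pol set" where
  "ideal_J a b c \<alpha> \<beta> \<gamma> = ideal_gen (set (gens_J a b c \<alpha> \<beta> \<gamma>))"

text \<open>
  \<open>T\<close> is the generic splitting type of \<open>syz I\<close> over \<open>K\<close> (the type of the first argument): the line
  \<open>x + y + z = 0\<close> is the projective line with coordinate ring \<open>S = K[x,y]\<close>, and the restriction of
  the syzygy bundle to it is the sheafification of the graded module \<open>syz J\<close>, whose
  decomposition into modules \<open>S(-p)\<close> is the decomposition of that restriction into line bundles
  of degrees \<open>-p\<close>.
\<close>

definition generic_splitting_type ::
  "'k::field itself \<Rightarrow> nat \<Rightarrow> nat \<Rightarrow> nat \<Rightarrow> nat \<Rightarrow> nat \<Rightarrow> nat \<Rightarrow> int multiset \<Rightarrow> bool" where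
  "generic_splitting_type _ a b c \<alpha> \<beta> \<gamma> T \<longleftrightarrow>
     syz_splits_as (gens_J a b c \<alpha> \<beta> \<gamma> :: (2, 'k) pol list)
       [int (\<alpha> + \<beta> + \<gamma>), int a, int b, int c] T"


section \<open>The matrices\<close>

definition hexagon_s :: "nat \<Rightarrow> nat \<Rightarrow> nat \<Rightarrow> nat \<Rightarrow> nat \<Rightarrow> nat \<Rightarrow> int" where
  "hexagon_s a b c \<alpha> \<beta> \<gamma> = int (a + b + c + \<alpha> + \<beta> + \<gamma>) div 3 - 2"

definition int_binom :: "nat \<Rightarrow> int \<Rightarrow> int" where
  "int_binom n k = (if k < 0 then 0 else int (n choose nat k))"

text \<open>
  Matrix indices start at 0, so the block with row numbers \<open>1, \<dots>, C\<close> consists of the rows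
  \<open>i < C\<close>; the entries only involve \<open>j - i\<close> and are not affected by the shift.
\<close>

definition N_matrix :: "nat \<Rightarrow> nat \<Rightarrow> nat \<Rightarrow> nat \<Rightarrow> nat \<Rightarrow> nat \<Rightarrow> int mat" where
  "N_matrix a b c \<alpha> \<beta> \<gamma> =
     (let s = hexagon_s a b c \<alpha> \<beta> \<gamma>;
          A = s + 2 - int a;
          C = s + 2 - int c;
          M = s + 2 - int (\<alpha> + \<beta> + \<gamma>);
          n = nat (C + M)
      in mat n n (\<lambda>(i, j).
           if int i < C then int_binom c (A + int j - int i)
           else int_binom \<gamma> (A + C - int \<beta> + int j - int i)))"

definition monomial3 :: "nat \<times> nat \<times> nat \<Rightarrow> (3, 'k::field) pol" where
  "monomial3 = (\<lambda>(i, j, k). pvar 0 ^ i * pvar 1 ^ j * pvar 2 ^ k)"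

text \<open>
  Exponents of the monomials of degree \<open>d\<close> not in \<open>I\<close>, in decreasing lexicographic order with
  \<open>x > y > z\<close>.
\<close>

definition monomials_outside :: "(3, 'k::field) pol set \<Rightarrow> nat \<Rightarrow> (nat \<times> nat \<times> nat) list" where
  "monomials_outside I d =
     filter (\<lambda>m. monomial3 m \<notin> I)
       [(i, j, d - i - j). i \<leftarrow> rev [0..<Suc d], j \<leftarrow> rev [0..<Suc (d - i)]]"

definition Z_matrix :: "'k::field itself \<Rightarrow> nat \<Rightarrow> nat \<Rightarrow> nat \<Rightarrow> nat \<Rightarrow> nat \<Rightarrow> nat \<Rightarrow> int mat" where
  "Z_matrix _ a b c \<alpha> \<beta> \<gamma> =
     (let I = ideal_I a b c \<alpha> \<beta> \<gamma> :: (3, 'k) pol set;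
          s = nat (hexagon_s a b c \<alpha> \<beta> \<gamma>);
          ms = monomials_outside I s;
          ns = monomials_outside I (s + 1)
      in mat (length ms) (length ns) (\<lambda>(i, j).
           if (monomial3 (ms ! i) :: (3, 'k) pol) dvd monomial3 (ns ! j) then 1 else 0))"

end

theory Submission
  imports Defs
begin

text \<open>
  Put \<open>t = s + 2\<close>. The numbers \<open>M\<close>, \<open>A\<close>, \<open>B\<close>, \<open>C\<close> are the differences between \<open>t\<close> and the degrees
  of the four generators of \<open>J\<close>, and they add up to \<open>t\<close>. In degree \<open>t - 1\<close> the free module on
  the four generators therefore has dimension \<open>M + A + B + C = t\<close>, which is the number of monomials
  of degree \<open>t - 1\<close> in two variables. So the map from this module to \<open>S = K[x,y]\<close> is in degree
  \<open>t - 1\<close> given by a square matrix: it is onto (\<open>J\<close> contains all forms of degree \<open>s + 1\<close>) if and only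
  if it is injective (the generators have no syzygy of degree \<open>t - 1\<close>). Each of the five conditions
  says that this map is bijective.

  \<^emph>\<open>The matrix N.\<close> The multiples of \<open>x^a\<close> and \<open>y^b\<close> contribute monomials. Deleting these rows and
  columns from the square matrix leaves the coefficients of the multiples of \<open>(x + y)^c\<close> and of the
  puncture \<open>x^\<alpha> y^\<beta> (x + y)^\<gamma>\<close> at the remaining \<open>C + M\<close> monomials, and this is N
  (\<open>N_field_entry\<close>, \<open>spanning_if_det\<close>, \<open>no_syzygies_iff_det\<close>).

  \<^emph>\<open>The matrix Z.\<close> A vector in the kernel of Z is a function on the monomials of degree \<open>s + 1\<close> in
  \<open>x\<close>, \<open>y\<close>, \<open>z\<close> which vanishes on the monomials of \<open>I\<close> and on all multiples of \<open>x + y + z\<close>. It is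
  determined by its values on the monomials without \<open>z\<close>, that is, by a functional on the binary
  forms of degree \<open>t - 1\<close>, because \<open>z\<close> acts as \<open>- (x + y)\<close>; and it vanishes on the monomials of \<open>I\<close>
  if and only if the functional vanishes on \<open>J\<close>. Hence N and Z are singular for the same reason
  (\<open>det_N_eq_0_iff\<close>, \<open>det_Z_eq_0_iff\<close>). That Z is square is the count in \<open>length_outside_eq\<close>.

  \<^emph>\<open>Regularity and splitting type.\<close> If the map is bijective in degree \<open>t - 1\<close>, then the syzygies of
  the generators have an explicit basis, consisting of elements of degree \<open>t\<close>
  (\<open>syz_mat_inj\<close>, \<open>syz_mat_surj\<close>). This gives the splitting type \<open>(t, t, t)\<close>, and, after dropping
  the generators of degree \<open>t\<close>, a minimal free resolution of \<open>S/J\<close>. Conversely, a syzygy module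
  generated in degree \<open>t\<close> has no element of degree \<open>t - 1\<close>. If the regularity is \<open>s\<close>, then the
  first syzygies are generated in degrees at most \<open>t\<close>, and as \<open>J\<close> contains all forms of large
  degree, a descending induction shows that it contains all forms of degree \<open>s + 1\<close>
  (\<open>resolution_fills_downwards\<close>).

  \<^emph>\<open>The weak Lefschetz property.\<close> Multiplication by \<open>u x + v y + w z\<close> from degree \<open>s\<close> to degree \<open>s + 1\<close>
  of \<open>R/I\<close> is the matrix Z with entries weighted by \<open>u\<close>, \<open>v\<close>, \<open>w\<close>. Rescaling the monomials removes
  the weights, so if Z is singular, multiplication by a linear form is neither injective nor
  surjective in degree \<open>s\<close> (\<open>det_weighted_Z_eq_0\<close>). If Z is nonsingular, then multiplication by
  \<open>x + y + z\<close> is bijective in degree \<open>s\<close>. Then it is injective in smaller degrees, because the socle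
  of \<open>R/I\<close> is zero in degrees below \<open>s\<close> (\<open>injective_below\<close>), and surjective in larger degrees
  (\<open>surjective_above\<close>).
\<close>

(* the dollar sign is reserved for the entries of vectors *)
no_notation fps_nth (infixl "$" 75)

abbreviation lookup where "lookup \<equiv> Poly_Mapping.lookup"
abbreviation single where "single \<equiv> Poly_Mapping.single"
abbreviation keys where "keys \<equiv> Poly_Mapping.keys"

section \<open>Coefficients and degrees of polynomials\<close>

lemma lookup_single_mult:
  fixes m n :: "'a::cancel_comm_monoid_add" and f :: "'a \<Rightarrow>\<^sub>0 'b::comm_semiring_1"
  shows "lookup (single m c * f) (m + n) = c * lookup f n"
proof -
  have "Sum_any (\<lambda>q. lookup f q when m + n = m + q) = lookup f n"
    by (simp add: eq_commute[of n])
  then have "lookup (single m c) l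
        * Sum_any (\<lambda>q. lookup f q when m + n = l + q)
      = (c * lookup f n when l = m)" for l
    by (cases "l = m") (simp_all add: lookup_single_not_eq)
  then show ?thesis
    by (simp add: lookup_mult)
qed

lemma lookup_single_mult_eq_0:
  assumes "\<And>n. k \<noteq> m + n"
  shows "lookup (single m c * f) k = 0"
proof (rule ccontr)
  assume "lookup (single m c * f) k \<noteq> 0"
  then have "k \<in> keys (single m c * f)"
    by (simp add: in_keys_iff)
  then obtain x y where "k = x + y" "x \<in> keys (single m c)"
    using Poly_Mapping.keys_mult[of "single m c" f] by auto
  then show False using assms by (auto split: if_splits)
qed

lemma pvar_power: "pvar v ^ i = single (single v i) 1"
  by (induction i) (simp_all add: pvar_def mult_single flip: single_add)

lemma lookup_const_mult:
  fixes f :: "('v, 'k::comm_ring_1) pol"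
  shows "lookup (single 0 c * f) m = c * lookup f m"
  using lookup_single_mult[of 0 c f m] by simp

lemma exp_degree_eq_sum: "exp_degree m = (\<Sum>v \<in> UNIV. lookup m v)"
  for m :: "'v::finite \<Rightarrow>\<^sub>0 nat"
  unfolding exp_degree_def by (rule sum.mono_neutral_left) (auto simp: in_keys_iff)

lemma exp_degree_add: "exp_degree (m + n) = exp_degree m + exp_degree n"
  for m :: "'v::finite \<Rightarrow>\<^sub>0 nat"
  by (simp add: exp_degree_eq_sum lookup_add sum.distrib)

lemma exp_degree_single [simp]: "exp_degree (single v i) = i"
  by (simp add: exp_degree_def)

lemma exp_degree_0 [simp]: "exp_degree 0 = 0"
  by (simp add: exp_degree_def)

lemma homogeneousI: "(\<And>m. lookup f m \<noteq> 0 \<Longrightarrow> int (exp_degree m) = d) \<Longrightarrow> f \<in> homogeneous d"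
  by (auto simp: homogeneous_def in_keys_iff)

lemma homogeneousD: "f \<in> homogeneous d \<Longrightarrow> lookup f m \<noteq> 0 \<Longrightarrow> int (exp_degree m) = d"
  by (auto simp: homogeneous_def in_keys_iff)

lemma homogeneous_0 [simp]: "0 \<in> homogeneous d"
  by (simp add: homogeneous_def)

lemma homogeneous_add [intro]: "f \<in> homogeneous d \<Longrightarrow> g \<in> homogeneous d \<Longrightarrow> f + g \<in> homogeneous d"
  by (rule homogeneousI) (metis add_cancel_right_right homogeneousD lookup_add)

lemma homogeneous_uminus [intro]: "f \<in> homogeneous d \<Longrightarrow> - f \<in> homogeneous d"
  by (rule homogeneousI) (simp add: homogeneousD)

lemma homogeneous_diff [intro]: "f \<in> homogeneous d \<Longrightarrow> g \<in> homogeneous d \<Longrightarrow> f - g \<in> homogeneous d"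
  using homogeneous_add[of f d "- g"] by (simp add: homogeneous_uminus)

lemma homogeneous_sum: "(\<And>i. i \<in> S \<Longrightarrow> f i \<in> homogeneous d) \<Longrightarrow> sum f S \<in> homogeneous d"
  by (induction S rule: infinite_finite_induct) auto

lemma homogeneous_mult:
  fixes f g :: "('v::finite, 'k::comm_ring_1) pol"
  assumes "f \<in> homogeneous d" "g \<in> homogeneous e"
  shows "f * g \<in> homogeneous (d + e)"
proof -
  have "int (exp_degree m) = d + e" if "m \<in> keys (f * g)" for m
    using that Poly_Mapping.keys_mult[of f g] assms
    by (fastforce simp: homogeneous_def exp_degree_add)
  then show ?thesis by (simp add: homogeneous_def)
qed

lemma homogeneous_single: "int (exp_degree m) = d \<Longrightarrow> single m c \<in> homogeneous d"
  by (simp add: homogeneous_def)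

lemma homogeneous_pvar_power: "int i = d \<Longrightarrow> pvar v ^ i \<in> homogeneous d"
  by (simp add: pvar_power homogeneous_single)

lemma homogeneous_pvar: "pvar v \<in> homogeneous 1"
  using homogeneous_pvar_power[of 1 1 v] by simp

lemma homogeneous_neg: "d < 0 \<Longrightarrow> f \<in> homogeneous d \<Longrightarrow> f = 0"
  by (rule poly_mapping_eqI) (metis homogeneousD lookup_zero not_less of_nat_0_le_iff)

lemma poly_eq_sum_single: "f = (\<Sum>m\<in>keys f. single m (lookup f m))"
  by (rule poly_mapping_eqI)
    (auto simp: lookup_sum lookup_single when_def in_keys_iff cong: if_cong)

text \<open>
  Every monomial of positive degree is a multiple of some variable; this property is inherited by
  sums of monomials of the same degree.
\<close>

lemma homogeneous_split:
  fixes f :: "('v::finite, 'k::comm_ring_1) pol"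
  assumes f: "f \<in> homogeneous d" and d: "1 \<le> d"
  shows "\<exists>p. (\<forall>v. p v \<in> homogeneous (d - 1)) \<and> f = (\<Sum>v\<in>UNIV. pvar v * p v)"
proof -
  let ?P = "\<lambda>f :: ('v, 'k) pol. \<exists>p. (\<forall>v. p v \<in> homogeneous (d - 1)) \<and> f = (\<Sum>v\<in>UNIV. pvar v * p v)"
  have zero: "?P 0" by (intro exI[of _ "\<lambda>_. 0"]) simp
  have add: "?P (f + g)" if P: "?P f" "?P g" for f g
  proof -
    obtain p q where "\<forall>v. p v \<in> homogeneous (d - 1)" "f = (\<Sum>v\<in>UNIV. pvar v * p v)"
      "\<forall>v. q v \<in> homogeneous (d - 1)" "g = (\<Sum>v\<in>UNIV. pvar v * q v)"
      using P by blast
    then show ?thesis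
      by (intro exI[of _ "\<lambda>v. p v + q v"]) (auto simp: distrib_left sum.distrib)
  qed
  have single: "?P (single m c)" if m: "int (exp_degree m) = d" for m c
  proof -
    have "exp_degree m \<noteq> 0" using m d by simp
    have "\<exists>v. lookup m v \<noteq> 0"
    proof (rule ccontr)
      assume "\<not> ?thesis"
      then have "exp_degree m = 0" by (simp add: exp_degree_eq_sum)
      then show False using \<open>exp_degree m \<noteq> 0\<close> by simp
    qed
    then obtain v where v: "lookup m v \<noteq> 0" ..
    define n where "n = m - single v 1"
    have mn: "m = single v 1 + n"
      using v by (intro poly_mapping_eqI) (auto simp: n_def lookup_add lookup_minus lookup_single when_def)
    have n: "int (exp_degree n) = d - 1" using m unfolding mn exp_degree_add by simp
    have "single m c = (\<Sum>u\<in>UNIV. if u = v then pvar v * single n c else 0)"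
      by (simp add: mn pvar_def mult_single)
    also have "\<dots> = (\<Sum>u\<in>UNIV. pvar u * (if u = v then single n c else 0))"
      by (rule sum.cong) auto
    finally show ?thesis
      using n by (intro exI[of _ "\<lambda>u. if u = v then single n c else 0"])
        (auto intro: homogeneous_single)
  qed
  have "?P (\<Sum>m\<in>S. single m (lookup f m))" if "S \<subseteq> keys f" for S
    using that
  proof (induction S rule: infinite_finite_induct)
    case (insert m S)
    then have "?P (single m (lookup f m))"
      using homogeneousD[OF f, of m] by (intro single) (auto simp: in_keys_iff)
    then show ?case using insert add by simp
  qed (use zero in simp_all)
  from this[OF order_refl] show ?thesis unfolding poly_eq_sum_single[of f, symmetric] .
qed

definition hpart :: "int \<Rightarrow> ('v, 'k::comm_ring_1) pol \<Rightarrow> ('v, 'k) pol" where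
  "hpart d f = Abs_poly_mapping (\<lambda>m. lookup f m when int (exp_degree m) = d)"

lemma lookup_hpart:
  "lookup (hpart d f) m = (lookup f m when int (exp_degree m) = d)"
  unfolding hpart_def
  by (subst lookup_Abs_poly_mapping)
    (auto intro: finite_subset[OF _ finite_lookup[of f]] simp: when_def)

lemma hpart_homogeneous [simp]: "hpart d f \<in> homogeneous d"
  by (rule homogeneousI) (auto simp: lookup_hpart when_def split: if_splits)

lemma hpart_eq: "f \<in> homogeneous d \<Longrightarrow> hpart d f = f"
  by (rule poly_mapping_eqI) (auto simp: lookup_hpart when_def dest: homogeneousD)

lemma hpart_neq: "f \<in> homogeneous e \<Longrightarrow> e \<noteq> d \<Longrightarrow> hpart d f = 0"
  by (rule poly_mapping_eqI) (auto simp: lookup_hpart when_def dest: homogeneousD)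

lemma hpart_0 [simp]: "hpart d 0 = 0"
  by (simp add: hpart_eq)

lemma hpart_add: "hpart d (f + g) = hpart d f + hpart d g"
  by (rule poly_mapping_eqI) (simp add: lookup_hpart lookup_add when_def)

lemma hpart_sum: "hpart d (sum f S) = (\<Sum>i\<in>S. hpart d (f i))"
  by (induction S rule: infinite_finite_induct) (simp_all add: hpart_add)

text \<open>
  A homogeneous factor shifts the components, as degrees of monomials add up: the terms of \<open>f\<close>
  outside degree \<open>d - e\<close> do not reach degree \<open>d\<close>.
\<close>

lemma hpart_mult:
  fixes f g :: "('v::finite, 'k::comm_ring_1) pol"
  assumes g: "g \<in> homogeneous e"
  shows "hpart d (g * f) = g * hpart (d - e) f"
proof -
  have "hpart d (g * (f - hpart (d - e) f)) = 0"
  proof (rule poly_mapping_eqI, rule ccontr)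
    fix m
    assume "lookup (hpart d (g * (f - hpart (d - e) f))) m \<noteq> lookup 0 m"
    then have m: "m \<in> keys (g * (f - hpart (d - e) f))" "int (exp_degree m) = d"
      by (auto simp: lookup_hpart in_keys_iff when_def split: if_splits)
    then obtain x y where xy: "m = x + y" "x \<in> keys g"
        "y \<in> keys (f - hpart (d - e) f)"
      using Poly_Mapping.keys_mult[of g "f - hpart (d - e) f"] by blast
    then have "int (exp_degree x) = e"
      using g by (auto simp: homogeneous_def)
    then have "int (exp_degree y) = d - e"
      using m xy by (simp add: exp_degree_add)
    then show False using xy(3) by (simp add: in_keys_iff lookup_minus lookup_hpart)
  qed
  moreover have "hpart d (g * hpart (d - e) f) = g * hpart (d - e) f"
    using homogeneous_mult[OF g hpart_homogeneous[of "d - e" f]] by (simp add: hpart_eq)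
  moreover have "g * f = g * hpart (d - e) f + g * (f - hpart (d - e) f)"
    by (simp add: algebra_simps)
  ultimately show ?thesis by (metis add.right_neutral hpart_add)
qed

section \<open>Polynomials in two variables\<close>

definition xy :: "nat \<Rightarrow> nat \<Rightarrow> 2 \<Rightarrow>\<^sub>0 nat" where
  "xy i j = single 0 i + single 1 j"

abbreviation Xp :: "(2, 'k::comm_ring_1) pol" where "Xp \<equiv> pvar 0"
abbreviation Yp :: "(2, 'k::comm_ring_1) pol" where "Yp \<equiv> pvar 1"

lemma UNIV_2: "(UNIV :: 2 set) = {0, 1}"
  by (rule card_subset_eq[symmetric]) simp_all

lemma lookup_xy [simp]: "lookup (xy i j) 0 = i" "lookup (xy i j) 1 = j"
  by (simp_all add: xy_def lookup_add lookup_single)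

lemma xy_eqI: "lookup m 0 = i \<Longrightarrow> lookup m 1 = j \<Longrightarrow> m = xy i j"
proof (rule poly_mapping_eqI)
  fix k :: 2
  assume "lookup m 0 = i" "lookup m 1 = j"
  moreover have "k = 0 \<or> k = 1" using UNIV_2 by blast
  ultimately show "lookup m k = lookup (xy i j) k"
    by auto
qed

lemma xy_exhaust: obtains i j where "m = xy i j"
  using xy_eqI by blast

lemma xy_eq_iff [simp]: "xy i j = xy i' j' \<longleftrightarrow> i = i' \<and> j = j'"
  by (metis lookup_xy)

lemma xy_add: "xy i j + xy i' j' = xy (i + i') (j + j')"
  by (rule xy_eqI) (simp_all add: lookup_add)

lemma xy_0_0: "xy 0 0 = 0"
  by (simp add: xy_def)

lemma exp_degree_xy [simp]: "exp_degree (xy i j) = i + j"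
  by (simp add: xy_def exp_degree_add)

lemma poly2_eqI:
  "(\<And>i j. lookup f (xy i j) = lookup g (xy i j)) \<Longrightarrow> f = g"
  by (rule poly_mapping_eqI) (metis xy_exhaust)

lemma homogeneous2I:
  "(\<And>i j. lookup f (xy i j) \<noteq> 0 \<Longrightarrow> int (i + j) = d) \<Longrightarrow> f \<in> homogeneous d"
  by (rule homogeneousI) (metis xy_exhaust exp_degree_xy)

lemma homogeneous2D:
  "f \<in> homogeneous d \<Longrightarrow> int (i + j) \<noteq> d \<Longrightarrow> lookup f (xy i j) = 0"
  by (metis exp_degree_xy homogeneousD)

lemma X_power_eq: "Xp ^ i = single (xy i 0) 1"
  by (simp add: pvar_power xy_def)

lemma Y_power_eq: "Yp ^ j = single (xy 0 j) 1"
  by (simp add: pvar_power xy_def)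

lemma X_eq: "Xp = single (xy 1 0) 1"
  by (simp add: pvar_def xy_def)

lemma Y_eq: "Yp = single (xy 0 1) 1"
  by (simp add: pvar_def xy_def)

lemma XY_single: "Xp ^ i * Yp ^ j = single (xy i j) 1"
  by (simp add: X_power_eq Y_power_eq mult_single xy_add)

lemma lookup_single_xy_mult:
  fixes f :: "(2, 'k::comm_ring_1) pol"
  shows "lookup (single (xy p q) c * f) (xy i j)
    = (if p \<le> i \<and> q \<le> j then c * lookup f (xy (i - p) (j - q)) else 0)"
proof (cases "p \<le> i \<and> q \<le> j")
  case True
  then show ?thesis
    using lookup_single_mult[of "xy p q" c f "xy (i - p) (j - q)"] by (simp add: xy_add)
next
  case False
  have "xy i j \<noteq> xy p q + n" for n
    using False by (cases n rule: xy_exhaust) (auto simp: xy_add)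
  then have "lookup (single (xy p q) c * f) (xy i j) = 0"
    by (rule lookup_single_mult_eq_0)
  then show ?thesis
    using False by auto
qed

lemma lookup_X_mult [simp]:
  "lookup (Xp * f) (xy 0 j) = 0"
  "lookup (Xp * f) (xy (Suc i) j) = lookup f (xy i j)"
  by (simp_all add: X_eq lookup_single_xy_mult)

lemma lookup_Y_mult [simp]:
  "lookup (Yp * f) (xy i 0) = 0"
  "lookup (Yp * f) (xy i (Suc j)) = lookup f (xy i j)"
  by (simp_all add: Y_eq lookup_single_xy_mult)

lemma lookup_X_power_mult:
  "lookup (Xp ^ n * f) (xy i j) = (if n \<le> i then lookup f (xy (i - n) j) else 0)"
  by (simp add: X_power_eq lookup_single_xy_mult)

lemma lookup_Y_power_mult:
  "lookup (Yp ^ n * f) (xy i j) = (if n \<le> j then lookup f (xy i (j - n)) else 0)"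
  by (simp add: Y_power_eq lookup_single_xy_mult)

lemma X_power_mult_cancel: "Xp ^ n * f = Xp ^ n * g \<longleftrightarrow> f = g"
proof
  assume eq: "Xp ^ n * f = Xp ^ n * g"
  show "f = g"
  proof (rule poly2_eqI)
    fix i j
    show "lookup f (xy i j) = lookup g (xy i j)"
      using arg_cong[OF eq, of "\<lambda>h. lookup h (xy (i + n) j)"]
      by (simp add: lookup_X_power_mult)
  qed
qed simp

lemma X_mult_cancel: "Xp * f = Xp * g \<longleftrightarrow> f = g"
  using X_power_mult_cancel[of 1] by simp

lemma Y_mult_cancel: "Yp * f = Yp * g \<longleftrightarrow> f = g"
proof
  assume eq: "Yp * f = Yp * g"
  show "f = g"
  proof (rule poly2_eqI)
    fix i j
    show "lookup f (xy i j) = lookup g (xy i j)"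
      using arg_cong[OF eq, of "\<lambda>h. lookup h (xy i (Suc j))"] by simp
  qed
qed simp

lemma X_dvdI:
  assumes "\<And>j. lookup f (xy 0 j) = 0"
  shows "Xp dvd f"
proof
  have inj: "inj ((+) (xy 1 0))" by (simp add: inj_def)
  show "f = Xp * Poly_Mapping.map_key ((+) (xy 1 0)) f"
  proof (rule poly2_eqI)
    fix i j
    show "lookup f (xy i j) = lookup (Xp * Poly_Mapping.map_key ((+) (xy 1 0)) f) (xy i j)"
      using assms by (cases i) (simp_all add: map_key.rep_eq[OF inj, unfolded One_nat_def] xy_add)
  qed
qed

lemma Y_dvdI:
  assumes "\<And>i. lookup f (xy i 0) = 0"
  shows "Yp dvd f"
proof
  have inj: "inj ((+) (xy 0 1))" by (simp add: inj_def)
  show "f = Yp * Poly_Mapping.map_key ((+) (xy 0 1)) f"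
  proof (rule poly2_eqI)
    fix i j
    show "lookup f (xy i j) = lookup (Yp * Poly_Mapping.map_key ((+) (xy 0 1)) f) (xy i j)"
      using assms by (cases j) (simp_all add: map_key.rep_eq[OF inj, unfolded One_nat_def] xy_add)
  qed
qed

lemma homogeneous_Y_cancel:
  assumes "Yp * f \<in> homogeneous d"
  shows "f \<in> homogeneous (d - 1)"
proof (rule homogeneous2I)
  fix i j
  assume "lookup f (xy i j) \<noteq> 0"
  then have "lookup (Yp * f) (xy i (Suc j)) \<noteq> 0" by simp
  then show "int (i + j) = d - 1"
    using homogeneous2D[OF assms, of i "Suc j"] by force
qed

text \<open>
  The only monomial of degree \<open>d\<close> that is not a multiple of \<open>y\<close> is \<open>x^d\<close>.
\<close>

lemma homogeneous_Y_divide: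
  assumes f: "f \<in> homogeneous d" and 0: "\<And>i. int i = d \<Longrightarrow> lookup f (xy i 0) = 0"
  obtains g where "f = Yp * g" "g \<in> homogeneous (d - 1)"
proof -
  have "Yp dvd f"
    using homogeneous2D[OF f, of _ 0] 0 by (intro Y_dvdI) (metis add.right_neutral)
  then obtain g where g: "f = Yp * g" by (rule dvdE)
  show ?thesis
    using that[OF g] homogeneous_Y_cancel f g by blast
qed

lemma homogeneous_split2:
  fixes f :: "(2, 'k::comm_ring_1) pol"
  assumes "f \<in> homogeneous d" "1 \<le> d"
  obtains p q where "f = Xp * p + Yp * q" "p \<in> homogeneous (d - 1)" "q \<in> homogeneous (d - 1)"
proof -
  obtain p where "\<forall>v. p v \<in> homogeneous (d - 1)" "f = (\<Sum>v\<in>UNIV. pvar v * p v)"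
    using homogeneous_split[OF assms] by blast
  then show ?thesis using that[of "p 0" "p 1"] by (simp add: UNIV_2)
qed

text \<open>
  \<open>x\<close>, \<open>y\<close> is a regular sequence.
\<close>

lemma X_dvd_of_Y_mult_eq:
  assumes "Yp * f = Xp * g"
  shows "Xp dvd f"
proof (rule X_dvdI)
  fix j
  show "lookup f (xy 0 j) = 0"
    using arg_cong[OF assms, of "\<lambda>h. lookup h (xy 0 (Suc j))"] by simp
qed

text \<open>
  Reduction modulo \<open>y\<close> is multiplicative; a form of degree \<open>p\<close> reduces to the multiple of \<open>x^p\<close>
  given by its coefficient at \<open>xy p 0\<close>.
\<close>

lemma lookup_mult_homogeneous_top:
  fixes f g :: "(2, 'k::comm_ring_1) pol"
  assumes f: "f \<in> homogeneous (int p)"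
  shows "lookup (f * g) (xy (p + q) 0)
    = lookup f (xy p 0) * lookup g (xy q 0)"
proof -
  define c where "c = lookup f (xy p 0)"
  let ?m = "single (xy p 0) c"
  have "f - ?m \<in> homogeneous (int p)"
    using f by (intro homogeneous_diff homogeneous_single) simp_all
  moreover have "lookup (f - ?m) (xy i 0) = 0" if "int i = int p" for i
    using that by (simp add: lookup_minus c_def)
  ultimately obtain h where "f - ?m = Yp * h"
    using homogeneous_Y_divide by blast
  then have "f * g = ?m * g + Yp * (h * g)"
    by (metis add_diff_cancel_left' diff_add_cancel add.commute distrib_right mult.assoc)
  then show ?thesis
    by (simp add: lookup_add lookup_single_xy_mult c_def)
qed

section \<open>Ideals and their generators\<close>

lemma ideal_ring_of_type_algebraI:
  fixes I :: "'r::comm_ring_1 set"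
  assumes "0 \<in> I" "\<And>f g. f \<in> I \<Longrightarrow> g \<in> I \<Longrightarrow> f + g \<in> I" "\<And>h f. f \<in> I \<Longrightarrow> h * f \<in> I"
  shows "ideal I (ring_of_type_algebra :: 'r ring)"
proof (rule idealI)
  show "ring (ring_of_type_algebra :: 'r ring)" by (rule ring_from_type_algebra)
  interpret ring "ring_of_type_algebra :: 'r ring" by (rule ring_from_type_algebra)
  show "subgroup I (add_monoid (ring_of_type_algebra :: 'r ring))"
  proof (rule add.subgroupI)
    show "I \<noteq> {}" using assms by auto
    fix f assume f: "f \<in> I"
    have "f \<oplus>\<^bsub>ring_of_type_algebra\<^esub> ((- 1) * f) = \<zero>\<^bsub>ring_of_type_algebra\<^esub>"
      by (simp add: ring_of_type_algebra_def)
    then have "\<ominus>\<^bsub>ring_of_type_algebra\<^esub> f = (- 1) * f"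
      by (intro minus_equality) (simp_all add: ring_of_type_algebra_def)
    then show "\<ominus>\<^bsub>ring_of_type_algebra\<^esub> f \<in> I" using assms(3)[OF f, of "- 1"] by simp
  qed (use assms in \<open>auto simp: ring_of_type_algebra_def\<close>)
qed (use assms(3) in \<open>auto simp: ring_of_type_algebra_def mult.commute\<close>)

lemma ideal_ideal_gen: "ideal (ideal_gen G) ring_of_type_algebra"
proof -
  interpret ring "ring_of_type_algebra :: 'a ring" by (rule ring_from_type_algebra)
  show ?thesis
    unfolding ideal_gen_def by (rule genideal_ideal) (simp add: ring_of_type_algebra_def)
qed

lemma ideal_gen_superset: "G \<subseteq> ideal_gen G"
  by (auto simp: ideal_gen_def genideal_def)

lemma ideal_gen_minimal:
  assumes "0 \<in> I" "\<And>f g. f \<in> I \<Longrightarrow> g \<in> I \<Longrightarrow> f + g \<in> I" "\<And>h f. f \<in> I \<Longrightarrow> h * f \<in> I" "G \<subseteq> I"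
  shows "ideal_gen G \<subseteq> I"
  using ideal_ring_of_type_algebraI[of I] assms by (auto simp: ideal_gen_def genideal_def)

lemma ideal_gen_0 [simp]: "0 \<in> ideal_gen G"
  and ideal_gen_add: "f \<in> ideal_gen G \<Longrightarrow> g \<in> ideal_gen G \<Longrightarrow> f + g \<in> ideal_gen G"
  and ideal_gen_mult: "f \<in> ideal_gen G \<Longrightarrow> h * f \<in> ideal_gen G"
proof -
  interpret ideal "ideal_gen G" "ring_of_type_algebra :: 'a ring" by (rule ideal_ideal_gen)
  show "0 \<in> ideal_gen G" using additive_subgroup.zero_closed[OF additive_subgroup_axioms] by (simp add: ring_of_type_algebra_def)
  show "f \<in> ideal_gen G \<Longrightarrow> g \<in> ideal_gen G \<Longrightarrow> f + g \<in> ideal_gen G"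
    using additive_subgroup.a_closed[OF additive_subgroup_axioms] by (simp add: ring_of_type_algebra_def)
  show "f \<in> ideal_gen G \<Longrightarrow> h * f \<in> ideal_gen G"
    using I_l_closed by (simp add: ring_of_type_algebra_def)
qed

lemma ideal_gen_sum: "(\<And>i. i \<in> S \<Longrightarrow> f i \<in> ideal_gen G) \<Longrightarrow> sum f S \<in> ideal_gen G"
  by (induction S rule: infinite_finite_induct) (auto simp: ideal_gen_add)

text \<open>
  The row matrix of generators, that is, the first map of a free resolution.
\<close>

definition gen_row :: "'r::comm_ring_1 list \<Rightarrow> 'r mat" where
  "gen_row gs = mat 1 (length gs) (\<lambda>(_, k). gs ! k)"

lemma mult_mat_vec_index:
  "D \<in> carrier_mat m n \<Longrightarrow> v \<in> carrier_vec n \<Longrightarrow> k < m \<Longrightarrow> (D *\<^sub>v v) $ k = (\<Sum>j<n. D $$ (k, j) * v $ j)"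
  by (auto simp: scalar_prod_def lessThan_atLeast0 intro!: sum.cong)

lemma mult_mat_vec_smult:
  fixes D :: "'r::comm_ring_1 mat"
  assumes "D \<in> carrier_mat m n" "v \<in> carrier_vec n"
  shows "D *\<^sub>v (c \<cdot>\<^sub>v v) = c \<cdot>\<^sub>v (D *\<^sub>v v)"
  using assms by (intro eq_vecI) (auto simp: scalar_prod_def sum_distrib_left ac_simps)

lemma gen_row_carrier [simp]: "gen_row gs \<in> carrier_mat 1 (length gs)"
  by (simp add: gen_row_def)

lemma gen_row_mult:
  "v \<in> carrier_vec (length gs) \<Longrightarrow> (gen_row gs *\<^sub>v v) $ 0 = (\<Sum>k<length gs. v $ k * gs ! k)"
  by (subst mult_mat_vec_index[of _ 1 "length gs"]) (simp_all add: gen_row_def mult.commute)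

text \<open>
  The linear combinations of the generators form an ideal.
\<close>

lemma mem_ideal_gen_iff:
  "f \<in> ideal_gen (set gs) \<longleftrightarrow> (\<exists>v \<in> carrier_vec (length gs). (gen_row gs *\<^sub>v v) $ 0 = f)"
proof
  assume f: "f \<in> ideal_gen (set gs)"
  let ?I = "{f. \<exists>v \<in> carrier_vec (length gs). (gen_row gs *\<^sub>v v) $ 0 = f}"
  have "ideal_gen (set gs) \<subseteq> ?I"
  proof (rule ideal_gen_minimal)
    show "0 \<in> ?I"
      by (auto simp: gen_row_mult intro!: bexI[of _ "0\<^sub>v (length gs)"])
    show "f + g \<in> ?I" if fg: "f \<in> ?I" "g \<in> ?I" for f g
    proof -
      obtain v w where "v \<in> carrier_vec (length gs)" "w \<in> carrier_vec (length gs)"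
        "(gen_row gs *\<^sub>v v) $ 0 = f" "(gen_row gs *\<^sub>v w) $ 0 = g"
        using fg unfolding mem_Collect_eq by metis
      then show ?thesis
        by (auto simp: gen_row_mult sum.distrib algebra_simps intro!: bexI[of _ "v + w"])
    qed
    show "h * f \<in> ?I" if fg: "f \<in> ?I" for h f
    proof -
      obtain v where "v \<in> carrier_vec (length gs)"
        "(gen_row gs *\<^sub>v v) $ 0 = f"
        using fg unfolding mem_Collect_eq by metis
      then show ?thesis
        by (auto simp: gen_row_mult sum_distrib_left mult.assoc intro!: bexI[of _ "h \<cdot>\<^sub>v v"])
    qed
    show "set gs \<subseteq> ?I"
    proof
      fix g assume "g \<in> set gs"
      then obtain k where k: "k < length gs" "g = gs ! k" by (auto simp: in_set_conv_nth)
      have "(\<Sum>l<length gs. unit_vec (length gs) k $ l * gs ! l)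
          = (\<Sum>l<length gs. if l = k then gs ! k else 0)"
        using k by (intro sum.cong) (auto simp: unit_vec_def)
      then show "g \<in> ?I"
        using k by (auto simp: gen_row_mult intro!: bexI[of _ "unit_vec (length gs) k"])
    qed
  qed
  then show "\<exists>v \<in> carrier_vec (length gs). (gen_row gs *\<^sub>v v) $ 0 = f" using f by blast
next
  assume "\<exists>v \<in> carrier_vec (length gs). (gen_row gs *\<^sub>v v) $ 0 = f"
  then show "f \<in> ideal_gen (set gs)"
    using ideal_gen_superset[of "set gs"]
    by (auto simp: gen_row_mult intro!: ideal_gen_sum ideal_gen_mult)
qed

lemma syz_iff:
  "v \<in> syz gs \<longleftrightarrow> v \<in> carrier_vec (length gs) \<and> gen_row gs *\<^sub>v v = 0\<^sub>v 1"
proof -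
  have "v \<bullet> vec_of_list gs = (gen_row gs *\<^sub>v v) $ 0" if "v \<in> carrier_vec (length gs)"
    using that
    by (simp add: gen_row_mult scalar_prod_def lessThan_atLeast0 vec_of_list_index)
  moreover have "gen_row gs *\<^sub>v v = 0\<^sub>v 1 \<longleftrightarrow> (gen_row gs *\<^sub>v v) $ 0 = 0"
    by (auto simp: gen_row_def vec_eq_iff)
  ultimately show ?thesis by (auto simp: syz_def)
qed

lemma syz_iff_index:
  "v \<in> syz gs \<longleftrightarrow> v \<in> carrier_vec (length gs) \<and> (gen_row gs *\<^sub>v v) $ 0 = 0"
proof -
  have "gen_row gs *\<^sub>v v = 0\<^sub>v 1 \<longleftrightarrow> (gen_row gs *\<^sub>v v) $ 0 = 0"
    by (auto simp: gen_row_def vec_eq_iff)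
  then show ?thesis by (simp only: syz_iff)
qed

lemma syz_eq_mat_kernel: "syz gs = mat_kernel (gen_row gs)"
  by (auto simp: syz_iff mat_kernel_def gen_row_def)

section \<open>Graded matrices\<close>

text \<open>
  Matrices of graded homomorphisms from the free module with generator degrees \<open>fs\<close> to the one with
  generator degrees \<open>es\<close>.
\<close>

definition graded_mat :: "int list \<Rightarrow> int list \<Rightarrow> ('v, 'k::comm_ring_1) pol mat \<Rightarrow> bool" where
  "graded_mat es fs D \<longleftrightarrow> D \<in> carrier_mat (length es) (length fs) \<and>
     (\<forall>k < length es. \<forall>l < length fs. D $$ (k, l) \<in> homogeneous (fs ! l - es ! k))"

definition hpart_vec :: "int list \<Rightarrow> int \<Rightarrow> ('v, 'k::comm_ring_1) pol vec \<Rightarrow> ('v, 'k) pol vec" where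
  "hpart_vec es d v = vec (length es) (\<lambda>k. hpart (d - es ! k) (v $ k))"

lemma free_componentI:
  "v \<in> carrier_vec (length es) \<Longrightarrow> (\<And>k. k < length es \<Longrightarrow> v $ k \<in> homogeneous (d - es ! k))
    \<Longrightarrow> v \<in> free_component es d"
  by (simp add: free_component_def)

lemma free_componentD:
  assumes "v \<in> free_component es d"
  shows "v \<in> carrier_vec (length es)" "k < length es \<Longrightarrow> v $ k \<in> homogeneous (d - es ! k)"
  using assms by (auto simp: free_component_def)

lemma hpart_vec_free_component [simp]: "hpart_vec es d v \<in> free_component es d"
  by (simp add: hpart_vec_def free_component_def)

lemma hpart_vec_carrier [simp]: "hpart_vec es d v \<in> carrier_vec (length es)"
  by (simp add: hpart_vec_def)

lemma hpart_vec_eq: "v \<in> free_component es d \<Longrightarrow> hpart_vec es d v = v"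
  by (rule eq_vecI) (auto simp: hpart_vec_def free_component_def hpart_eq)

lemma graded_mat_free_component:
  fixes D :: "('v::finite, 'k::comm_ring_1) pol mat"
  assumes D: "graded_mat es fs D" and w: "w \<in> free_component fs d"
  shows "D *\<^sub>v w \<in> free_component es d"
proof (rule free_componentI)
  show "D *\<^sub>v w \<in> carrier_vec (length es)" using D w by (auto simp: graded_mat_def free_component_def)
  fix k assume k: "k < length es"
  have "D $$ (k, l) * w $ l \<in> homogeneous (d - es ! k)" if "l < length fs" for l
    using homogeneous_mult[of "D $$ (k, l)" "fs ! l - es ! k" "w $ l" "d - fs ! l"] D w k that
    by (simp add: graded_mat_def free_component_def)
  then show "(D *\<^sub>v w) $ k \<in> homogeneous (d - es ! k)"
    using D w k
    by (subst mult_mat_vec_index[of _ "length es" "length fs"])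
      (auto simp: graded_mat_def free_component_def intro!: homogeneous_sum)
qed

text \<open>
  The entries are the coordinates of the images of the basis vectors, and these are homogeneous.
\<close>

lemma graded_matI:
  fixes D :: "('v::finite, 'k::comm_ring_1) pol mat"
  assumes D: "D \<in> carrier_mat (length es) (length fs)"
    and fc: "\<And>d v. v \<in> free_component fs d \<Longrightarrow> D *\<^sub>v v \<in> free_component es d"
  shows "graded_mat es fs D"
  unfolding graded_mat_def
proof (intro conjI allI impI)
  show "D \<in> carrier_mat (length es) (length fs)" by fact
  fix k l assume k: "k < length es" and l: "l < length fs"
  have "1 \<in> (homogeneous 0 :: ('v, 'k) pol set)" by (simp add: homogeneous_def)
  then have "(unit_vec (length fs) l :: ('v, 'k) pol vec) \<in> free_component fs (fs ! l)"
    using l by (intro free_componentI) (auto simp: unit_vec_def)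
  then have "D *\<^sub>v unit_vec (length fs) l \<in> free_component es (fs ! l)" by (rule fc)
  moreover have "(D *\<^sub>v unit_vec (length fs) l) $ k = D $$ (k, l)"
    using D k l by simp
  ultimately show "D $$ (k, l) \<in> homogeneous (fs ! l - es ! k)"
    using k free_componentD(2) by metis
qed

text \<open>
  Graded homomorphisms commute with taking homogeneous components. This turns an arbitrary preimage
  of a homogeneous element into a homogeneous preimage.
\<close>

lemma hpart_vec_mult:
  fixes D :: "('v::finite, 'k::comm_ring_1) pol mat"
  assumes D: "graded_mat es fs D" and w: "w \<in> carrier_vec (length fs)"
  shows "hpart_vec es d (D *\<^sub>v w) = D *\<^sub>v hpart_vec fs d w"
proof (rule eq_vecI)
  have Dc: "D \<in> carrier_mat (length es) (length fs)" using D by (simp add: graded_mat_def)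
  then show dim: "dim_vec (hpart_vec es d (D *\<^sub>v w)) = dim_vec (D *\<^sub>v hpart_vec fs d w)"
    by (simp add: hpart_vec_def)
  fix k assume "k < dim_vec (D *\<^sub>v hpart_vec fs d w)"
  then have k: "k < length es" using Dc by simp
  have "hpart (d - es ! k) (D $$ (k, l) * w $ l) = D $$ (k, l) * hpart (d - fs ! l) (w $ l)"
    if "l < length fs" for l
    using hpart_mult[of "D $$ (k, l)" "fs ! l - es ! k" "d - es ! k" "w $ l"] D k that
    by (simp add: graded_mat_def algebra_simps)
  then show "hpart_vec es d (D *\<^sub>v w) $ k = (D *\<^sub>v hpart_vec fs d w) $ k"
    using k w Dc
    by (simp add: mult_mat_vec_index[of _ "length es" "length fs"] hpart_sum hpart_vec_def
        del: index_mult_mat_vec)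
qed

lemma graded_mat_lift:
  fixes D :: "('v::finite, 'k::comm_ring_1) pol mat"
  assumes "graded_mat es fs D" "w \<in> carrier_vec (length fs)" "D *\<^sub>v w \<in> free_component es d"
  shows "D *\<^sub>v hpart_vec fs d w = D *\<^sub>v w"
  using hpart_vec_mult[OF assms(1,2), of d] hpart_vec_eq[OF assms(3)] by simp

lemma graded_gen_row:
  assumes "length es = length gs" "\<And>k. k < length gs \<Longrightarrow> gs ! k \<in> homogeneous (es ! k)"
  shows "graded_mat [0] es (gen_row gs)"
  using assms by (simp add: graded_mat_def gen_row_def)

lemma homogeneous_multI:
  fixes f g :: "('v::finite, 'k::comm_ring_1) pol"
  assumes "f \<in> homogeneous d" "g \<in> homogeneous e" "c = d + e"
  shows "f * g \<in> homogeneous c"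
  using homogeneous_mult[OF assms(1,2)] assms(3) by simp

lemma Y_smult_eq_0:
  assumes u: "u \<in> carrier_vec m" and 0: "Yp \<cdot>\<^sub>v u = 0\<^sub>v m"
  shows "u = 0\<^sub>v m"
proof (rule eq_vecI)
  fix k assume "k < dim_vec (0\<^sub>v m :: (2, 'a) pol vec)"
  then have "Yp * u $ k = Yp * 0" using arg_cong[OF 0, of "\<lambda>v. v $ k"] u by simp
  then show "u $ k = 0\<^sub>v m $ k" using \<open>k < _\<close> by (simp only: Y_mult_cancel) simp
qed (use u in simp)

lemma lookup_mult_top:
  fixes f g :: "(2, 'k::comm_ring_1) pol"
  assumes f: "f \<in> homogeneous d" and e: "0 \<le> e" "int N = d + e"
  shows "lookup (f * g) (xy N 0)
    = lookup f (xy (nat d) 0) * lookup g (xy (nat e) 0)"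
proof (cases "d < 0")
  case True
  then show ?thesis using homogeneous_neg[OF _ f] by simp
next
  case False
  then have "N = nat d + nat e" using e by linarith
  then show ?thesis using lookup_mult_homogeneous_top[of f "nat d" g "nat e"] f False by simp
qed

section \<open>Syzygies of generators that fill one degree\<close>

text \<open>
  The increasing enumeration of the natural numbers other than \<open>i\<close>.
\<close>

definition skip :: "nat \<Rightarrow> nat \<Rightarrow> nat" where
  "skip i j = (if j < i then j else Suc j)"

lemma skip_neq: "skip i j \<noteq> i"
  and skip_eq_iff: "skip i j = skip i j' \<longleftrightarrow> j = j'"
  by (auto simp: skip_def)

lemma skip_less: "i < n \<Longrightarrow> j < n - 1 \<Longrightarrow> skip i j < n"
  by (auto simp: skip_def)

lemma skip_cases:
  assumes "k < n" "i < n" "k \<noteq> i"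
  obtains j where "j < n - 1" "k = skip i j"
proof (cases "k < i")
  case True
  then show ?thesis using assms that[of k] by (auto simp: skip_def)
next
  case False
  then show ?thesis using assms that[of "k - 1"] by (auto simp: skip_def)
qed

text \<open>
  Generators for which the map from the free module to \<open>S\<close> is bijective in degree \<open>t - 1\<close>. The
  degrees may reach \<open>t\<close>, and then the corresponding summand is zero in degree \<open>t - 1\<close>.
\<close>

locale filling_generators =
  fixes gs :: "(2, 'k::field) pol list" and es :: "int list" and t :: nat
  assumes length_es: "length es = length gs"
    and gens_homogeneous: "k < length gs \<Longrightarrow> gs ! k \<in> homogeneous (es ! k)"
    and degree_nonneg: "k < length gs \<Longrightarrow> 0 \<le> es ! k"
    and degree_le: "k < length gs \<Longrightarrow> es ! k \<le> int t"
    and t_pos: "0 < t"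
    and spanning: "g \<in> homogeneous (int t - 1) \<Longrightarrow>
        \<exists>v \<in> free_component es (int t - 1). (gen_row gs *\<^sub>v v) $ 0 = g"
    and no_syzygies: "v \<in> syz gs \<Longrightarrow> v \<in> free_component es (int t - 1) \<Longrightarrow> v = 0\<^sub>v (length gs)"
begin

abbreviation n where "n \<equiv> length gs"

text \<open>
  The generator modulo \<open>y\<close> is this multiple of a power of \<open>x\<close>.
\<close>

definition pure_coeff :: "nat \<Rightarrow> 'k" where
  "pure_coeff k = lookup (gs ! k) (xy (nat (es ! k)) 0)"

lemma lookup_top_gen_mult:
  assumes k: "k < n" and f: "f \<in> homogeneous (d - es ! k)" and N: "int N = d"
  shows "lookup (f * gs ! k) (xy N 0) = lookup f (xy (nat (d - es ! k)) 0) * pure_coeff k"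
  unfolding pure_coeff_def using lookup_mult_top[OF f, of "es ! k" N "gs ! k"] degree_nonneg[OF k] N by simp

text \<open>
  Otherwise all generators are multiples of \<open>y\<close> and do not produce \<open>x^(t - 1)\<close>.
\<close>

lemma ex_pure_coeff_nonzero: "\<exists>i<n. pure_coeff i \<noteq> 0"
proof (rule ccontr)
  assume contr: "\<not> (\<exists>i<n. pure_coeff i \<noteq> 0)"
  have "Xp ^ (t - 1) \<in> (homogeneous (int t - 1) :: (2, 'k) pol set)"
    using t_pos by (intro homogeneous_pvar_power) simp
  then obtain v where v: "v \<in> free_component es (int t - 1)" "(gen_row gs *\<^sub>v v) $ 0 = Xp ^ (t - 1)"
    using spanning by blast
  have vc: "v \<in> carrier_vec n" using free_componentD(1)[OF v(1)] length_es by simp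
  have "lookup (v $ k * gs ! k) (xy (t - 1) 0) = 0" if k: "k < n" for k
    using lookup_top_gen_mult[OF k, of "v $ k" "int t - 1" "t - 1"] free_componentD(2)[OF v(1)] k
      contr t_pos by (simp add: length_es)
  then have "lookup ((gen_row gs *\<^sub>v v) $ 0) (xy (t - 1) 0) = 0"
    using vc by (simp add: gen_row_mult lookup_sum del: index_mult_mat_vec)
  then show False unfolding v(2) by (simp add: X_power_eq)
qed

definition i0 where "i0 = (SOME i. i < n \<and> pure_coeff i \<noteq> 0)"

lemma i0: "i0 < n" "pure_coeff i0 \<noteq> 0"
  using someI_ex[OF ex_pure_coeff_nonzero] by (simp_all add: i0_def)

text \<open>
  Modulo \<open>y\<close> the generators are multiples \<open>pure_coeff k\<close> of powers of \<open>x\<close>, and the generator \<open>i0\<close>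
  eliminates any other one. The vector \<open>leading_syz j\<close> is the resulting syzygy modulo \<open>y\<close>, of degree
  \<open>t\<close>, between the generators \<open>skip i0 j\<close> and \<open>i0\<close>.
\<close>

definition leading_syz :: "nat \<Rightarrow> (2, 'k) pol vec" where
  "leading_syz j = vec n (\<lambda>k. if k = skip i0 j then Xp ^ nat (int t - es ! k)
     else if k = i0 then - (single 0 (pure_coeff (skip i0 j) / pure_coeff i0) * Xp ^ nat (int t - es ! k))
     else 0)"

lemma leading_syz_free_component: "j < n - 1 \<Longrightarrow> leading_syz j \<in> free_component es (int t)"
proof (rule free_componentI)
  fix k assume j: "j < n - 1" and "k < length es"
  then have k: "k < n" by (simp add: length_es)
  have X: "Xp ^ nat (int t - es ! k) \<in> (homogeneous (int t - es ! k) :: (2, 'k) pol set)"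
    using degree_le[OF k] by (intro homogeneous_pvar_power) simp
  have "single 0 c * Xp ^ nat (int t - es ! k) \<in> homogeneous (int t - es ! k)" for c :: 'k
    using homogeneous_mult[OF homogeneous_single[of 0 0 c] X] by simp
  then show "leading_syz j $ k \<in> homogeneous (int t - es ! k)"
    using X k by (auto simp: leading_syz_def intro!: homogeneous_uminus)
qed (simp add: leading_syz_def length_es)

lemma gen_row_graded: "graded_mat [0] es (gen_row gs)"
  by (rule graded_gen_row[OF length_es gens_homogeneous])

lemma gen_row_homogeneous:
  assumes "v \<in> free_component es d"
  shows "(gen_row gs *\<^sub>v v) $ 0 \<in> homogeneous d"
  using free_componentD(2)[OF graded_mat_free_component[OF gen_row_graded assms], of 0]
  by (simp del: index_mult_mat_vec)

lemma lookup_top_gen_row: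
  assumes v: "v \<in> free_component es d" and d: "int N = d"
  shows "lookup ((gen_row gs *\<^sub>v v) $ 0) (xy N 0)
    = (\<Sum>k<n. lookup (v $ k) (xy (nat (d - es ! k)) 0) * pure_coeff k)"
  using free_componentD[OF v] lookup_top_gen_mult[OF _ _ d]
  by (simp add: length_es gen_row_mult lookup_sum del: index_mult_mat_vec)

lemma sum_skip:
  assumes j: "j < n - 1" and 0: "\<And>k. k < n \<Longrightarrow> k \<noteq> i0 \<Longrightarrow> k \<noteq> skip i0 j \<Longrightarrow> F k = 0"
  shows "(\<Sum>k<n. F k) = F (skip i0 j) + (F i0 :: 'b::comm_monoid_add)"
proof -
  have "(\<Sum>k<n. F k) = (\<Sum>k \<in> {skip i0 j, i0}. F k)"
    using i0 skip_less[OF i0(1) j] 0 by (intro sum.mono_neutral_right) auto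
  then show ?thesis by (simp add: skip_neq)
qed

text \<open>
  The combination has no \<open>x^t\<close>-coefficient, hence is \<open>y\<close> times a form of degree \<open>t - 1\<close>, and all
  such forms are combinations of the generators.
\<close>

lemma leading_syz_divisible:
  assumes j: "j < n - 1"
  shows "\<exists>h \<in> free_component es (int t - 1). (gen_row gs *\<^sub>v leading_syz j) $ 0 = Yp * (gen_row gs *\<^sub>v h) $ 0"
proof -
  have "lookup ((gen_row gs *\<^sub>v leading_syz j) $ 0) (xy N 0) = 0" if N: "int N = int t" for N
    using i0 skip_less[OF i0(1) j]
    by (subst lookup_top_gen_row[OF leading_syz_free_component[OF j] N], subst sum_skip[OF j])
      (auto simp: leading_syz_def skip_neq skip_neq[symmetric] X_power_eq lookup_const_mult)
  then obtain g where g: "(gen_row gs *\<^sub>v leading_syz j) $ 0 = Yp * g" "g \<in> homogeneous (int t - 1)"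
    using homogeneous_Y_divide[OF gen_row_homogeneous[OF leading_syz_free_component[OF j]]] by blast
  obtain h where "h \<in> free_component es (int t - 1)" "(gen_row gs *\<^sub>v h) $ 0 = g"
    using spanning[OF g(2)] by blast
  then show ?thesis using g by auto
qed

definition correction :: "nat \<Rightarrow> (2, 'k) pol vec" where
  "correction j = (SOME h. h \<in> free_component es (int t - 1) \<and>
     (gen_row gs *\<^sub>v leading_syz j) $ 0 = Yp * (gen_row gs *\<^sub>v h) $ 0)"

lemma correction:
  assumes "j < n - 1"
  shows "correction j \<in> free_component es (int t - 1)"
    "(gen_row gs *\<^sub>v leading_syz j) $ 0 = Yp * (gen_row gs *\<^sub>v correction j) $ 0"
  using someI_ex[OF leading_syz_divisible[OF assms, unfolded Bex_def]] by (simp_all add: correction_def)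

text \<open>
  Its columns lift the syzygies modulo \<open>y\<close> to syzygies. They are going to be a basis of the syzygy
  module.
\<close>

definition syz_mat :: "(2, 'k) pol mat" where
  "syz_mat = mat n (n - 1) (\<lambda>(k, j). leading_syz j $ k - Yp * correction j $ k)"

abbreviation fs :: "int list" where "fs \<equiv> replicate (n - 1) (int t)"

lemma syz_mat_carrier [simp]: "syz_mat \<in> carrier_mat n (n - 1)"
  by (simp add: syz_mat_def)

lemmas syz_mat_mult_carrier = mult_mat_vec_carrier[OF syz_mat_carrier]

lemma graded_syz_mat: "graded_mat es fs syz_mat"
proof -
  have "leading_syz j $ k - Yp * correction j $ k \<in> homogeneous (int t - es ! k)" if "k < n" "j < n - 1" for k j
  proof (rule homogeneous_diff)
    show "leading_syz j $ k \<in> homogeneous (int t - es ! k)"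
      using free_componentD(2)[OF leading_syz_free_component] that by (simp add: length_es)
    show "Yp * correction j $ k \<in> homogeneous (int t - es ! k)"
      using homogeneous_mult[OF homogeneous_pvar free_componentD(2)[OF correction(1)]] that
      by (simp add: length_es add.commute algebra_simps)
  qed
  then show ?thesis by (simp add: graded_mat_def syz_mat_def length_es)
qed

lemma col_syz_mat: "j < n - 1 \<Longrightarrow> (\<Sum>k<n. syz_mat $$ (k, j) * gs ! k) = 0"
  using correction[of j] free_componentD(1)[OF correction(1), of j] free_componentD(1)[OF leading_syz_free_component, of j]
  by (simp add: syz_mat_def left_diff_distrib sum_subtractf gen_row_mult length_es
      sum_distrib_left mult.assoc del: index_mult_mat_vec)

lemma syz_mat_syz:
  assumes w: "w \<in> carrier_vec (n - 1)"
  shows "syz_mat *\<^sub>v w \<in> syz gs"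
proof -
  have c: "syz_mat *\<^sub>v w \<in> carrier_vec n" by (rule syz_mat_mult_carrier[OF w])
  have "(gen_row gs *\<^sub>v (syz_mat *\<^sub>v w)) $ 0 = (\<Sum>k<n. (\<Sum>j<n - 1. syz_mat $$ (k, j) * w $ j) * gs ! k)"
    using c w by (simp add: gen_row_mult mult_mat_vec_index[OF syz_mat_carrier w] del: index_mult_mat_vec)
  also have "\<dots> = (\<Sum>j<n - 1. w $ j * (\<Sum>k<n. syz_mat $$ (k, j) * gs ! k))"
    unfolding sum_distrib_right sum_distrib_left by (subst sum.swap) (simp add: ac_simps)
  also have "\<dots> = 0" by (simp add: col_syz_mat)
  finally show ?thesis using c by (auto simp: syz_iff gen_row_def vec_eq_iff)
qed

text \<open>
  Modulo \<open>y\<close> the rows other than \<open>i0\<close> form a diagonal matrix of powers of \<open>x\<close>.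
\<close>

lemma syz_mat_row:
  assumes w: "w \<in> carrier_vec (n - 1)" and j: "j < n - 1"
  shows "\<exists>h. (syz_mat *\<^sub>v w) $ skip i0 j = Xp ^ nat (int t - es ! skip i0 j) * w $ j + Yp * h"
proof -
  let ?k = "skip i0 j"
  have k: "?k < n" by (rule skip_less[OF i0(1) j])
  have "syz_mat $$ (?k, j') * w $ j' = (if j' = j then Xp ^ nat (int t - es ! ?k) * w $ j else 0)
      + Yp * (- (correction j' $ ?k) * w $ j')" if "j' < n - 1" for j'
    using k that by (auto simp: syz_mat_def leading_syz_def skip_neq skip_eq_iff algebra_simps)
  then have "(syz_mat *\<^sub>v w) $ ?k
      = (\<Sum>j'<n - 1. (if j' = j then Xp ^ nat (int t - es ! ?k) * w $ j else 0) + Yp * (- (correction j' $ ?k) * w $ j'))"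
    by (simp add: mult_mat_vec_index[OF syz_mat_carrier w k] del: index_mult_mat_vec)
  then show ?thesis
    using j by (auto simp only: sum.distrib sum_distrib_left[symmetric] sum.delta finite_lessThan lessThan_iff if_True)
qed

text \<open>
  By \<open>syz_mat_row\<close> the entries of an element of the kernel are multiples of \<open>y\<close>. Dividing by \<open>y\<close>
  gives an element of the kernel again, so that the entries are divisible by all powers of \<open>y\<close>.
\<close>

lemma syz_mat_inj:
  assumes w: "w \<in> carrier_vec (n - 1)" and 0: "syz_mat *\<^sub>v w = 0\<^sub>v n"
  shows "w = 0\<^sub>v (n - 1)"
proof -
  have div: "\<exists>w' \<in> carrier_vec (n - 1). w = Yp \<cdot>\<^sub>v w' \<and> syz_mat *\<^sub>v w' = 0\<^sub>v n"
    if w: "w \<in> carrier_vec (n - 1)" and 0: "syz_mat *\<^sub>v w = 0\<^sub>v n" for w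
  proof -
    have "\<exists>g. w $ j = Yp * g" if j: "j < n - 1" for j
    proof -
      let ?k = "skip i0 j"
      obtain h where "(syz_mat *\<^sub>v w) $ ?k = Xp ^ nat (int t - es ! ?k) * w $ j + Yp * h"
        using syz_mat_row[OF w j] by blast
      then have *: "Xp ^ nat (int t - es ! ?k) * w $ j + Yp * h = 0"
        using 0 skip_less[OF i0(1) j] by simp
      have "lookup (w $ j) (xy i 0) = 0" for i
        using arg_cong[OF *, of "\<lambda>f. lookup f (xy (i + nat (int t - es ! ?k)) 0)"]
        by (simp add: lookup_add lookup_X_power_mult)
      then show ?thesis using Y_dvdI by (metis dvdE)
    qed
    then obtain g where g: "\<And>j. j < n - 1 \<Longrightarrow> w $ j = Yp * g j" by metis
    let ?w = "vec (n - 1) g"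
    have eq: "w = Yp \<cdot>\<^sub>v ?w" using w g by (intro eq_vecI) auto
    have "Yp \<cdot>\<^sub>v (syz_mat *\<^sub>v ?w) = syz_mat *\<^sub>v w"
      unfolding eq by (rule mult_mat_vec_smult[OF syz_mat_carrier, symmetric]) simp
    then have "syz_mat *\<^sub>v ?w = 0\<^sub>v n"
      by (intro Y_smult_eq_0[OF syz_mat_mult_carrier]) (simp_all only: 0 vec_carrier)
    then show ?thesis using eq by (intro bexI[of _ ?w]) auto
  qed
  have vanish: "lookup (w $ j) (xy i m) = 0"
    if "w \<in> carrier_vec (n - 1)" "syz_mat *\<^sub>v w = 0\<^sub>v n" "j < n - 1" for w i j m
    using that
  proof (induction m arbitrary: w)
    case 0
    then show ?case using div[of w] by auto
  next
    case (Suc m)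
    then show ?case using div[of w] by auto
  qed
  show ?thesis
    using vanish[OF w 0] w by (intro eq_vecI) (auto intro!: poly2_eqI)
qed

text \<open>
  A multiple by a power of \<open>x\<close> lies in degree \<open>t - 1\<close>.
\<close>

lemma syz_low_degree:
  assumes v: "v \<in> syz gs" "v \<in> free_component es d" and d: "d < int t"
  shows "v = 0\<^sub>v n"
proof -
  let ?m = "nat (int t - 1 - d)"
  have vc: "v \<in> carrier_vec n" using v by (simp add: syz_iff)
  have "Xp ^ ?m \<cdot>\<^sub>v v \<in> syz gs"
    using v by (auto simp: syz_iff mult_mat_vec_smult[OF gen_row_carrier])
  moreover have "Xp ^ ?m \<cdot>\<^sub>v v \<in> free_component es (int t - 1)"
  proof (rule free_componentI)
    fix k assume k: "k < length es"
    have "Xp ^ ?m \<in> (homogeneous (int t - 1 - d) :: (2, 'k) pol set)"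
      using d by (intro homogeneous_pvar_power) simp
    from homogeneous_multI[OF this free_componentD(2)[OF v(2) k], of "int t - 1 - es ! k"]
    show "(Xp ^ ?m \<cdot>\<^sub>v v) $ k \<in> homogeneous (int t - 1 - es ! k)"
      using vc k by (simp add: length_es)
  qed (use vc in \<open>simp add: length_es\<close>)
  ultimately have 0: "Xp ^ ?m \<cdot>\<^sub>v v = 0\<^sub>v n" by (rule no_syzygies)
  show ?thesis
  proof (rule eq_vecI)
    fix k assume "k < dim_vec (0\<^sub>v n)"
    then have "Xp ^ ?m * v $ k = Xp ^ ?m * 0" using arg_cong[OF 0, of "\<lambda>v. v $ k"] vc by simp
    then show "v $ k = 0\<^sub>v n $ k" using \<open>k < dim_vec (0\<^sub>v n)\<close> by (simp only: X_power_mult_cancel) simp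
  qed (use vc in simp)
qed

text \<open>
  Subtracting a combination of the columns makes the pure \<open>x\<close>-coefficients of \<open>v\<close> vanish in all rows
  other than \<open>i0\<close>, and in the row \<open>i0\<close> as well because \<open>v\<close> is a syzygy modulo \<open>y\<close>. The rest
  is \<open>y\<close> times a syzygy of smaller degree.
\<close>

lemma syz_mat_surj_step:
  assumes v: "v \<in> syz gs" "v \<in> free_component es d" and d: "int t \<le> d"
  shows "\<exists>w \<in> free_component fs d. \<exists>u \<in> free_component es (d - 1). u \<in> syz gs \<and> v = syz_mat *\<^sub>v w + Yp \<cdot>\<^sub>v u"
proof -
  have vc: "v \<in> carrier_vec n" using v by (simp add: syz_iff)
  let ?c = "\<lambda>v k. lookup (v $ k) (xy (nat (d - es ! k)) 0)"
  define w where "w = vec (n - 1) (\<lambda>j. single (xy (nat (d - int t)) 0) (?c v (skip i0 j)))"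
  have w: "w \<in> free_component fs d"
    using d by (intro free_componentI) (auto simp: w_def intro!: homogeneous_single)
  have wc: "w \<in> carrier_vec (n - 1)" by (simp add: w_def)
  define r where "r = v - syz_mat *\<^sub>v w"
  have Dc: "syz_mat *\<^sub>v w \<in> carrier_vec n" by (rule syz_mat_mult_carrier[OF wc])
  have Dh: "syz_mat *\<^sub>v w \<in> free_component es d" by (rule graded_mat_free_component[OF graded_syz_mat w])
  have rc: "r \<in> carrier_vec n" using vc Dc by (simp add: r_def)
  have r: "r \<in> free_component es d"
    using free_componentD(2)[OF v(2)] free_componentD(2)[OF Dh] rc Dc
    by (intro free_componentI) (auto simp: r_def length_es carrier_vecD[OF Dc] simp del: index_mult_mat_vec dim_mult_mat_vec)
  have rs: "r \<in> syz gs"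
    using v(1) syz_mat_syz[OF wc] rc vc Dc mult_minus_distrib_mat_vec[OF gen_row_carrier, of v gs "syz_mat *\<^sub>v w"]
    by (auto simp: syz_iff r_def)
  have c_skip: "?c r (skip i0 j) = 0" if j: "j < n - 1" for j
  proof -
    let ?k = "skip i0 j"
    have k: "?k < n" by (rule skip_less[OF i0(1) j])
    obtain h where h: "(syz_mat *\<^sub>v w) $ ?k = Xp ^ nat (int t - es ! ?k) * w $ j + Yp * h"
      using syz_mat_row[OF wc j] by blast
    have "nat (d - es ! ?k) = nat (int t - es ! ?k) + nat (d - int t)"
      using d degree_le[OF k] by simp
    then have "?c (syz_mat *\<^sub>v w) ?k = ?c v ?k"
      unfolding h using j by (simp add: lookup_add lookup_X_power_mult w_def)
    then show ?thesis using k by (simp add: r_def lookup_minus carrier_vecD[OF Dc] del: index_mult_mat_vec dim_mult_mat_vec)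
  qed
  have "(\<Sum>k<n. ?c r k * pure_coeff k) = 0"
    using lookup_top_gen_row[OF r, of "nat d"] rs d by (simp add: syz_iff del: index_mult_mat_vec)
  moreover have "(\<Sum>k<n. ?c r k * pure_coeff k) = ?c r i0 * pure_coeff i0 + (\<Sum>k \<in> {..<n} - {i0}. ?c r k * pure_coeff k)"
    using i0 by (intro sum.remove) auto
  moreover have "(\<Sum>k \<in> {..<n} - {i0}. ?c r k * pure_coeff k) = 0"
    using c_skip skip_cases[OF _ i0(1)] by (intro sum.neutral) (metis Diff_iff lessThan_iff mult_zero_left singletonI)
  ultimately have "?c r i0 = 0" using i0 by simp
  then have c0: "?c r k = 0" if "k < n" for k
    using c_skip skip_cases[OF that i0(1)] by metis
  have "\<exists>g. r $ k = Yp * g \<and> g \<in> homogeneous (d - 1 - es ! k)" if k: "k < n" for k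
  proof -
    have "r $ k \<in> homogeneous (d - es ! k)" using free_componentD(2)[OF r] k by (simp add: length_es)
    then obtain g where "r $ k = Yp * g" "g \<in> homogeneous (d - es ! k - 1)"
      using homogeneous_Y_divide[of "r $ k" "d - es ! k"] c0[OF k] by (metis nat_int)
    then show ?thesis by (auto simp: algebra_simps)
  qed
  then obtain g where g: "\<And>k. k < n \<Longrightarrow> r $ k = Yp * g k \<and> g k \<in> homogeneous (d - 1 - es ! k)" by metis
  let ?u = "vec n g"
  have u: "?u \<in> free_component es (d - 1)" using g by (intro free_componentI) (auto simp: length_es)
  have ru: "r = Yp \<cdot>\<^sub>v ?u" using rc g by (intro eq_vecI) auto
  have "Yp \<cdot>\<^sub>v (gen_row gs *\<^sub>v ?u) = gen_row gs *\<^sub>v r"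
    unfolding ru by (rule mult_mat_vec_smult[OF gen_row_carrier, symmetric]) simp
  also have "\<dots> = 0\<^sub>v 1" using rs by (simp add: syz_iff)
  finally have "gen_row gs *\<^sub>v ?u = 0\<^sub>v 1"
    by (rule Y_smult_eq_0[OF mult_mat_vec_carrier[OF gen_row_carrier vec_carrier]])
  then have "?u \<in> syz gs" by (simp add: syz_iff)
  moreover have "v = syz_mat *\<^sub>v w + Yp \<cdot>\<^sub>v ?u"
    unfolding ru[symmetric] r_def using vc
    by (intro eq_vecI) (auto simp: carrier_vecD[OF Dc] simp del: dim_mult_mat_vec index_mult_mat_vec)
  ultimately show ?thesis using w u by blast
qed

lemma syz_mat_surj_homogeneous:
  assumes "v \<in> syz gs" "v \<in> free_component es d"
  shows "\<exists>w \<in> free_component fs d. syz_mat *\<^sub>v w = v"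
  using assms
proof (induction "nat (d - int t + 1)" arbitrary: d v rule: less_induct)
  case less
  show ?case
  proof (cases "d < int t")
    case True
    then have "v = 0\<^sub>v n" using syz_low_degree less.prems by blast
    moreover have "0\<^sub>v (n - 1) \<in> free_component fs d" by (rule free_componentI) auto
    ultimately show ?thesis by (intro bexI[of _ "0\<^sub>v (n - 1)"]) (auto simp: syz_mat_def scalar_prod_def)
  next
    case False
    then obtain w u where w: "w \<in> free_component fs d" and u: "u \<in> free_component es (d - 1)" "u \<in> syz gs"
      and v: "v = syz_mat *\<^sub>v w + Yp \<cdot>\<^sub>v u"
      using syz_mat_surj_step less.prems by (meson not_less)
    obtain w' where w': "w' \<in> free_component fs (d - 1)" "syz_mat *\<^sub>v w' = u"
      using less.hyps[of "d - 1", OF _ u(2,1)] False by auto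
    have c: "w \<in> carrier_vec (n - 1)" "w' \<in> carrier_vec (n - 1)"
      using free_componentD(1)[OF w] free_componentD(1)[OF w'(1)] by auto
    have "w + Yp \<cdot>\<^sub>v w' \<in> free_component fs d"
    proof (rule free_componentI)
      fix k assume k: "k < length fs"
      have "Yp * w' $ k \<in> homogeneous (1 + (d - 1 - fs ! k))"
        using free_componentD(2)[OF w'(1) k] by (intro homogeneous_mult homogeneous_pvar)
      then show "(w + Yp \<cdot>\<^sub>v w') $ k \<in> homogeneous (d - fs ! k)"
        using free_componentD(2)[OF w k] c k by (auto simp: algebra_simps)
    qed (use c in simp)
    moreover have "syz_mat *\<^sub>v (w + Yp \<cdot>\<^sub>v w') = v"
      using c by (simp add: v mult_add_distrib_mat_vec[OF syz_mat_carrier] mult_mat_vec_smult[OF syz_mat_carrier] w'(2))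
    ultimately show ?thesis by blast
  qed
qed

text \<open>
  Split off the homogeneous components one by one, starting with the one of highest degree.
\<close>

lemma syz_mat_surj:
  assumes v: "v \<in> syz gs"
  shows "\<exists>w \<in> carrier_vec (n - 1). syz_mat *\<^sub>v w = v"
proof -
  have bounded: "\<exists>w \<in> carrier_vec (n - 1). syz_mat *\<^sub>v w = v"
    if "v \<in> syz gs" "\<And>k d. k < n \<Longrightarrow> int N \<le> d \<Longrightarrow> hpart (d - es ! k) (v $ k) = 0" for N v
    using that
  proof (induction N arbitrary: v)
    case 0
    have "v $ k = 0" if k: "k < n" for k
    proof (rule poly_mapping_eqI)
      fix m :: "2 \<Rightarrow>\<^sub>0 nat"
      have "hpart (int (exp_degree m)) (v $ k) = 0"
        using 0(2)[OF k, of "int (exp_degree m) + es ! k"] degree_nonneg[OF k] by simp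
      from arg_cong[OF this, of "\<lambda>f. lookup f m"]
      show "lookup (v $ k) m = lookup 0 m"
        by (simp add: lookup_hpart)
    qed
    then have "v = 0\<^sub>v n" using 0(1) by (intro eq_vecI) (auto simp: syz_iff)
    then show ?case
      by (intro bexI[of _ "0\<^sub>v (n - 1)"]) (auto simp: syz_mat_def scalar_prod_def)
  next
    case (Suc N)
    have vc: "v \<in> carrier_vec n" using Suc.prems(1) by (simp add: syz_iff)
    let ?h = "hpart_vec es (int N) v"
    have hc: "?h \<in> carrier_vec n" by (simp add: hpart_vec_def length_es)
    have "gen_row gs *\<^sub>v ?h = hpart_vec [0] (int N) (gen_row gs *\<^sub>v v)"
      using hpart_vec_mult[OF gen_row_graded, of v] vc by (simp add: length_es)
    also have "\<dots> = 0\<^sub>v 1"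
      using Suc.prems(1) by (auto simp: syz_iff hpart_vec_def vec_eq_iff simp del: index_mult_mat_vec)
    finally have h: "?h \<in> syz gs" using hc by (simp add: syz_iff)
    then obtain w where w: "w \<in> free_component fs (int N)" "syz_mat *\<^sub>v w = ?h"
      using syz_mat_surj_homogeneous hpart_vec_free_component by blast
    have "v - ?h \<in> syz gs"
      using Suc.prems(1) h vc hc mult_minus_distrib_mat_vec[OF gen_row_carrier vc hc]
      by (auto simp: syz_iff)
    moreover have "hpart (d - es ! k) ((v - ?h) $ k) = 0" if k: "k < n" and d: "int N \<le> d" for k d
    proof (cases "d = int N")
      case True
      then show ?thesis using k vc hc
        by (auto simp: hpart_vec_def length_es lookup_hpart lookup_minus when_def intro!: poly_mapping_eqI)
    next
      case False
      then have *: "hpart (d - es ! k) (v $ k) = 0" using Suc.prems(2)[OF k] d by simp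
      have **: "hpart (d - es ! k) (hpart (int N - es ! k) (v $ k)) = 0"
        using False by (intro hpart_neq[OF hpart_homogeneous]) simp
      have sum: "(v - ?h) $ k + hpart (int N - es ! k) (v $ k) = v $ k"
        using k by (simp add: hpart_vec_def length_es)
      have "hpart (d - es ! k) ((v - ?h) $ k) + hpart (d - es ! k) (hpart (int N - es ! k) (v $ k)) = 0"
        unfolding hpart_add[symmetric] sum by (rule *)
      then show ?thesis unfolding ** by simp
    qed
    ultimately obtain w' where w': "w' \<in> carrier_vec (n - 1)" "syz_mat *\<^sub>v w' = v - ?h"
      using Suc.IH by blast
    have wc: "w \<in> carrier_vec (n - 1)" using free_componentD(1)[OF w(1)] by simp
    have "syz_mat *\<^sub>v (w + w') = ?h + (v - ?h)"
      using mult_add_distrib_mat_vec[OF syz_mat_carrier wc w'(1)] w w' by simp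
    also have "\<dots> = v" using vc hc by (intro eq_vecI) auto
    finally show ?case using wc w'(1) by (intro bexI[of _ "w + w'"]) auto
  qed
  \<comment> \<open>the total degrees of the terms of \<open>v\<close>\<close>
  define S where "S = (\<Union>k<n. (\<lambda>m. int (exp_degree m) + es ! k) ` keys (v $ k))"
  have "finite S" by (simp add: S_def)
  then obtain B where B: "\<And>x. x \<in> S \<Longrightarrow> x \<le> B" by (meson finite_has_maximal2 Max_ge)
  show ?thesis
  proof (rule bounded[OF v])
    fix k d assume k: "k < n" and d: "int (nat (B + 1)) \<le> d"
    show "hpart (d - es ! k) (v $ k) = 0"
    proof (rule poly_mapping_eqI)
      fix m :: "2 \<Rightarrow>\<^sub>0 nat"
      have "int (exp_degree m) + es ! k \<le> B" if "lookup (v $ k) m \<noteq> 0"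
        using that k by (intro B) (auto simp: S_def in_keys_iff intro!: bexI[of _ k])
      then show "lookup (hpart (d - es ! k) (v $ k)) m = lookup 0 m"
        using d by (force simp: lookup_hpart when_def split: if_splits)
    qed
  qed
qed

lemma syz_splits: "syz_splits_as gs es (replicate_mset (n - 1) (int t))"
  unfolding syz_splits_as_def
proof (intro exI[of _ fs] exI[of _ "\<lambda>w. syz_mat *\<^sub>v w"] conjI allI ballI)
  show "mset fs = replicate_mset (n - 1) (int t)" by simp
  show "bij_betw (\<lambda>w. syz_mat *\<^sub>v w) (carrier_vec (length fs)) (syz gs)"
    unfolding bij_betw_def
  proof
    show "inj_on (\<lambda>w. syz_mat *\<^sub>v w) (carrier_vec (length fs))"
    proof (rule inj_onI)
      fix v w assume "v \<in> carrier_vec (length fs)" "w \<in> carrier_vec (length fs)" and eq: "syz_mat *\<^sub>v v = syz_mat *\<^sub>v w"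
      then have c: "v \<in> carrier_vec (n - 1)" "w \<in> carrier_vec (n - 1)" by simp_all
      have "syz_mat *\<^sub>v (v - w) = 0\<^sub>v n"
        using mult_minus_distrib_mat_vec[OF syz_mat_carrier c] eq syz_mat_mult_carrier[OF c(2)] by simp
      then have "v - w = 0\<^sub>v (n - 1)" using c by (intro syz_mat_inj) auto
      then show "v = w" using c by (auto simp: vec_eq_iff)
    qed
    show "(\<lambda>w. syz_mat *\<^sub>v w) ` carrier_vec (length fs) = syz gs"
      using syz_mat_syz syz_mat_surj by (auto simp: image_iff simp del: One_nat_def)
  qed
  fix d
  show "(\<lambda>w. syz_mat *\<^sub>v w) ` free_component fs d = syz gs \<inter> free_component es d"
  proof (intro equalityI subsetI)
    fix v assume "v \<in> (\<lambda>w. syz_mat *\<^sub>v w) ` free_component fs d"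
    then obtain w where w: "w \<in> free_component fs d" "v = syz_mat *\<^sub>v w" by blast
    have "w \<in> carrier_vec (n - 1)" using free_componentD(1)[OF w(1)] by simp
    then show "v \<in> syz gs \<inter> free_component es d"
      using syz_mat_syz graded_mat_free_component[OF graded_syz_mat w(1)] w(2) by blast
  next
    fix v assume "v \<in> syz gs \<inter> free_component es d"
    then show "v \<in> (\<lambda>w. syz_mat *\<^sub>v w) ` free_component fs d"
      using syz_mat_surj_homogeneous[of v d] by blast
  qed
qed (simp_all add: mult_add_distrib_mat_vec[OF syz_mat_carrier] mult_mat_vec_smult[OF syz_mat_carrier] del: One_nat_def)

end

text \<open>
  The module is generated in degrees above \<open>d\<close>.
\<close>

lemma splits_imp_no_syzygies:
  assumes splits: "syz_splits_as gs es T" and T: "\<And>p. p \<in># T \<Longrightarrow> d < p"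
    and v: "v \<in> syz gs" "v \<in> free_component es d"
  shows "v = 0\<^sub>v (length gs)"
proof -
  obtain ps \<phi> where ps: "mset ps = T"
    and smult: "\<forall>f. \<forall>v \<in> carrier_vec (length ps). \<phi> (f \<cdot>\<^sub>v v) = f \<cdot>\<^sub>v \<phi> v"
    and im: "\<forall>d. \<phi> ` free_component ps d = syz gs \<inter> free_component es d"
    using splits unfolding syz_splits_as_def by blast
  obtain w where w: "w \<in> free_component ps d" "v = \<phi> w" using im v by blast
  have "w $ k = 0" if k: "k < length ps" for k
    using free_componentD(2)[OF w(1) k] T[of "ps ! k"] ps k by (intro homogeneous_neg[of "d - ps ! k"]) auto
  then have "w = 0 \<cdot>\<^sub>v w" using free_componentD(1)[OF w(1)] by (intro eq_vecI) auto
  then have "v = 0 \<cdot>\<^sub>v \<phi> w" using smult free_componentD(1)[OF w(1)] w(2) by metis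
  then show ?thesis using v w by (auto simp: syz_def vec_eq_iff)
qed

section \<open>Regularity\<close>

lemma mult_mat_vec_image_no_columns:
  fixes D :: "'r::comm_ring_1 mat"
  assumes D: "D \<in> carrier_mat m 0"
  shows "(\<lambda>v. D *\<^sub>v v) ` carrier_vec 0 = {0\<^sub>v m}"
proof -
  have "D *\<^sub>v v = 0\<^sub>v m" if "v \<in> carrier_vec 0" for v
    using that D by (intro eq_vecI) (auto simp: scalar_prod_def)
  moreover have "(0\<^sub>v 0 :: 'r vec) \<in> carrier_vec 0" by simp
  ultimately show ?thesis using image_constant[of "0\<^sub>v 0 :: 'r vec" "carrier_vec 0" "0\<^sub>v m :: 'r vec"]
    by (simp cong: image_cong)
qed

context filling_generators
begin

lemma homogeneous_in_ideal: "homogeneous (int t - 1) \<subseteq> ideal_gen (set gs)"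
proof
  fix g :: "(2, 'k) pol" assume "g \<in> homogeneous (int t - 1)"
  then obtain v where "v \<in> free_component es (int t - 1)" "(gen_row gs *\<^sub>v v) $ 0 = g"
    using spanning by blast
  then show "g \<in> ideal_gen (set gs)"
    unfolding mem_ideal_gen_iff using free_componentD(1)[of v es] length_es by metis
qed

text \<open>
  The generators and \<open>syz_mat\<close> form a resolution of length two, as \<open>syz_mat\<close> is injective. It is
  minimal because the degrees of the generators lie strictly between \<open>0\<close> and \<open>t\<close>, and all
  generators of the last module have degree \<open>t\<close>.
\<close>

lemma has_regularity:
  assumes two: "2 \<le> n" and deg: "\<And>k. k < n \<Longrightarrow> 1 \<le> es ! k \<and> es ! k < int t"
  shows "quot_has_regularity (ideal_gen (set gs)) (int t - 2)"
proof -
  define ds where "ds = (\<lambda>i::nat. if i = 0 then [0] else if i = 1 then es else if i = 2 then fs else [])"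
  define D where "D = (\<lambda>i::nat. if i = 0 then gen_row gs else if i = 1 then syz_mat
    else 0\<^sub>m (length (ds i)) (length (ds (Suc i))))"
  have graded: "graded_mat (ds i) (ds (Suc i)) (D i)" for i
    using gen_row_graded graded_syz_mat by (auto simp: D_def ds_def graded_mat_def)
  have carrier: "D i \<in> carrier_mat (length (ds i)) (length (ds (Suc i)))" for i
    using graded by (simp add: graded_mat_def)
  have row0: "(\<lambda>v. D 0 *\<^sub>v v) ` carrier_vec (length (ds 1)) = {w \<in> carrier_vec 1. w $ 0 \<in> ideal_gen (set gs)}"
  proof (intro equalityI subsetI)
    fix w assume "w \<in> (\<lambda>v. D 0 *\<^sub>v v) ` carrier_vec (length (ds 1))"
    then obtain v where "v \<in> carrier_vec n" "w = gen_row gs *\<^sub>v v"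
      by (auto simp: D_def ds_def length_es)
    then show "w \<in> {w \<in> carrier_vec 1. w $ 0 \<in> ideal_gen (set gs)}"
      using mult_mat_vec_carrier[OF gen_row_carrier] mem_ideal_gen_iff by blast
  next
    fix w assume w: "w \<in> {w \<in> carrier_vec 1. w $ 0 \<in> ideal_gen (set gs)}"
    then obtain v where v: "v \<in> carrier_vec n" "(gen_row gs *\<^sub>v v) $ 0 = w $ 0"
      using mem_ideal_gen_iff by blast
    then have "w = gen_row gs *\<^sub>v v"
      using w by (intro eq_vecI) (auto simp: gen_row_def)
    then show "w \<in> (\<lambda>v. D 0 *\<^sub>v v) ` carrier_vec (length (ds 1))"
      using v by (auto simp: D_def ds_def length_es)
  qed
  have zero_image: "(\<lambda>v. D (Suc i) *\<^sub>v v) ` carrier_vec (length (ds (Suc (Suc i)))) = {0\<^sub>v (length (ds (Suc i)))}"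
    if "1 \<le> i" for i
    using that carrier[of "Suc i"] mult_mat_vec_image_no_columns[of "D (Suc i)" "length (ds (Suc i))"]
    by (simp add: ds_def)
  have exact: "(\<lambda>v. D (Suc i) *\<^sub>v v) ` carrier_vec (length (ds (Suc (Suc i)))) = mat_kernel (D i)" for i
  proof -
    consider "i = 0" | "i = 1" | "2 \<le> i" by linarith
    then show ?thesis
    proof cases
      case 1
      have "(\<lambda>w. syz_mat *\<^sub>v w) ` carrier_vec (n - 1) = syz gs"
        using syz_mat_syz syz_mat_surj by (auto simp: image_iff simp del: One_nat_def)
      then show ?thesis using 1 by (simp add: D_def ds_def syz_eq_mat_kernel)
    next
      case 2
      have "mat_kernel syz_mat = {0\<^sub>v (n - 1)}"
        using syz_mat_inj by (auto simp: mat_kernel_def syz_mat_def scalar_prod_def simp del: One_nat_def intro!: eq_vecI)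
      then show ?thesis using zero_image[of i] 2 by (simp add: D_def ds_def)
    next
      case 3
      have "mat_kernel (D i) = {0\<^sub>v 0}"
        using 3 by (auto simp: D_def ds_def mat_kernel_def intro!: eq_vecI)
      then show ?thesis using zero_image[of i] 3 by (simp add: ds_def)
    qed
  qed
  have minimal: "lookup (D i $$ (k, l)) 0 = 0"
    if k: "k < length (ds i)" and l: "l < length (ds (Suc i))" for i k l
  proof -
    have "ds i ! k \<noteq> ds (Suc i) ! l"
      using k l deg length_es by (fastforce simp: ds_def split: if_splits)
    moreover have "D i $$ (k, l) \<in> homogeneous (ds (Suc i) ! l - ds i ! k)"
      using graded k l by (simp add: graded_mat_def)
    ultimately show ?thesis by (metis diff_eq_diff_eq diff_self exp_degree_0 homogeneousD of_nat_0)
  qed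
  have res: "minimal_free_resolution (ideal_gen (set gs)) ds D"
    unfolding minimal_free_resolution_def
    using carrier row0 exact minimal graded_mat_free_component[OF graded] by (auto simp: ds_def)
  have top: "\<exists>i. \<exists>e \<in> set (ds i). e - int i = int t - 2"
    using two by (intro exI[of _ 2]) (auto simp: ds_def)
  have "e - int i \<le> int t - 2" if "e \<in> set (ds i)" for i e
  proof -
    consider "i = 0" | "i = 1" | "i = 2" | "2 < i" by linarith
    then show ?thesis
    proof cases
      case 1
      have "0 < n" using two by linarith
      then have "2 \<le> t" using deg[of 0] by linarith
      then show ?thesis using 1 that by (simp add: ds_def)
    next
      case 2
      then have "e \<in> set es" using that by (simp add: ds_def)
      then obtain k where "k < n" "e = es ! k" by (metis in_set_conv_nth length_es)
      then show ?thesis using 2 deg[of k] by auto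
    qed (use that in \<open>auto simp: ds_def split: if_splits\<close>)
  qed
  then show ?thesis unfolding quot_has_regularity_def using res top by blast
qed

end

text \<open>
  Let \<open>g\<close> have degree \<open>d\<close>, and let \<open>u\<close> and \<open>w\<close> be combinations of the generators that produce
  \<open>x g\<close> and \<open>y g\<close>. Then \<open>y u - x w\<close> is a syzygy of degree \<open>d + 2\<close>. As the syzygies are
  generated in smaller degrees, it is \<open>x p + y q\<close> with syzygies \<open>p\<close> and \<open>q\<close>. From
  \<open>y (u - q) = x (w + p)\<close> it follows that \<open>u - q\<close> is divisible by \<open>x\<close>, and the quotient
  produces \<open>g\<close>.
\<close>

lemma resolution_fills_downwards:
  fixes J :: "(2, 'k::field) pol set"
  assumes res: "minimal_free_resolution J ds D"
    and deg: "\<And>e. e \<in> set (ds 2) \<Longrightarrow> e - 2 \<le> r"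
    and filled: "homogeneous (d + 1) \<subseteq> J" and d: "r < d"
  shows "homogeneous d \<subseteq> J"
proof
  let ?p = "length (ds 1)" and ?q = "length (ds 2)"
  note res_conjuncts = res[unfolded minimal_free_resolution_def]
  note ds0 = res_conjuncts[THEN conjunct1]
    and carrier = res_conjuncts[THEN conjunct2, THEN conjunct1, rule_format]
    and fc = res_conjuncts[THEN conjunct2, THEN conjunct2, THEN conjunct1, rule_format]
    and im0 = res_conjuncts[THEN conjunct2, THEN conjunct2, THEN conjunct2, THEN conjunct1]
    and exact = res_conjuncts[THEN conjunct2, THEN conjunct2, THEN conjunct2, THEN conjunct2, THEN conjunct1, rule_format]
  have graded: "graded_mat (ds i) (ds (Suc i)) (D i)" for i
    by (rule graded_matI[OF carrier fc])
  have G0: "graded_mat [0] (ds 1) (D 0)" and G1: "graded_mat (ds 1) (ds 2) (D 1)"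
    using graded[of 0] graded[of 1] ds0 by (simp_all add: numeral_2_eq_2)
  have C0: "D 0 \<in> carrier_mat 1 ?p" and C1: "D 1 \<in> carrier_mat ?p ?q"
    using G0 G1 by (simp_all add: graded_mat_def)
  have ker: "(\<lambda>v. D 1 *\<^sub>v v) ` carrier_vec ?q = mat_kernel (D 0)"
    using exact[of 0] by (simp add: numeral_2_eq_2)
  have lift: "\<exists>u \<in> carrier_vec ?p. D 0 *\<^sub>v u = vec 1 (\<lambda>_. f) \<and> u \<in> free_component (ds 1) (d + 1)"
    if f: "f \<in> homogeneous (d + 1)" for f
  proof -
    have "vec 1 (\<lambda>_. f) \<in> {w \<in> carrier_vec 1. w $ 0 \<in> J}" using f filled by auto
    then obtain u where u: "u \<in> carrier_vec ?p" "D 0 *\<^sub>v u = vec 1 (\<lambda>_. f)" unfolding im0[symmetric] by auto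
    have "D 0 *\<^sub>v u \<in> free_component [0] (d + 1)" unfolding u(2) using f by (intro free_componentI) auto
    then show ?thesis using graded_mat_lift[OF G0 u(1)] u(2)
      by (intro bexI[of _ "hpart_vec (ds 1) (d + 1) u"]) auto
  qed
  fix g :: "(2, 'k) pol" assume g: "g \<in> homogeneous d"
  have "Xp * g \<in> homogeneous (d + 1)" "Yp * g \<in> homogeneous (d + 1)"
    using g by (auto intro: homogeneous_multI[OF homogeneous_pvar])
  then obtain u w where u: "u \<in> carrier_vec ?p" "D 0 *\<^sub>v u = vec 1 (\<lambda>_. Xp * g)" "u \<in> free_component (ds 1) (d + 1)"
    and w: "w \<in> carrier_vec ?p" "D 0 *\<^sub>v w = vec 1 (\<lambda>_. Yp * g)" "w \<in> free_component (ds 1) (d + 1)"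
    using lift by meson
  \<comment> \<open>the Koszul relation between \<open>x g\<close> and \<open>y g\<close>\<close>
  define k where "k = Yp \<cdot>\<^sub>v u - Xp \<cdot>\<^sub>v w"
  have kc: "k \<in> carrier_vec ?p" using u w by (simp add: k_def)
  have "D 0 *\<^sub>v k = Yp \<cdot>\<^sub>v (D 0 *\<^sub>v u) - Xp \<cdot>\<^sub>v (D 0 *\<^sub>v w)"
    unfolding k_def using u(1) w(1)
    by (simp add: mult_minus_distrib_mat_vec[OF C0] mult_mat_vec_smult[OF C0])
  also have "\<dots> = 0\<^sub>v 1" unfolding u(2) w(2) by (intro eq_vecI) (auto simp: ac_simps)
  finally have "k \<in> mat_kernel (D 0)" using kc C0 by (auto simp: mat_kernel_def)
  then obtain z0 where z0: "z0 \<in> carrier_vec ?q" "D 1 *\<^sub>v z0 = k" unfolding ker[symmetric] by auto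
  have "k \<in> free_component (ds 1) (d + 2)"
  proof (rule free_componentI)
    fix l assume l: "l < ?p"
    have "Yp * u $ l \<in> homogeneous (d + 2 - ds 1 ! l)" "Xp * w $ l \<in> homogeneous (d + 2 - ds 1 ! l)"
      using free_componentD(2)[OF u(3) l] free_componentD(2)[OF w(3) l]
      by (auto intro: homogeneous_multI[OF homogeneous_pvar])
    then show "k $ l \<in> homogeneous (d + 2 - ds 1 ! l)"
      using u(1) w(1) l by (auto simp: k_def)
  qed (fact kc)
  then have lift_k: "D 1 *\<^sub>v hpart_vec (ds 2) (d + 2) z0 = k"
    using graded_mat_lift[OF G1 z0(1)] z0(2) by simp
  define z where "z = hpart_vec (ds 2) (d + 2) z0"
  have "\<exists>f h. z $ l = Xp * f + Yp * h" if l: "l < ?q" for l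
  proof -
    have "z $ l \<in> homogeneous (d + 2 - ds 2 ! l)"
      unfolding z_def using free_componentD(2)[OF hpart_vec_free_component l] .
    moreover have "1 \<le> d + 2 - ds 2 ! l" using deg[of "ds 2 ! l"] l d by simp
    ultimately show ?thesis using homogeneous_split2 by metis
  qed
  then obtain f h where fh: "\<And>l. l < ?q \<Longrightarrow> z $ l = Xp * f l + Yp * h l" by metis
  let ?f = "vec ?q f" and ?h = "vec ?q h"
  have "z = Xp \<cdot>\<^sub>v ?f + Yp \<cdot>\<^sub>v ?h"
    using fh by (intro eq_vecI) (auto simp: z_def hpart_vec_def)
  then have k: "k = Xp \<cdot>\<^sub>v (D 1 *\<^sub>v ?f) + Yp \<cdot>\<^sub>v (D 1 *\<^sub>v ?h)"
    using lift_k unfolding z_def[symmetric]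
    by (simp add: mult_add_distrib_mat_vec[OF C1] mult_mat_vec_smult[OF C1] del: One_nat_def)
  have kernel0: "D 0 *\<^sub>v (D 1 *\<^sub>v ?h) = 0\<^sub>v 1"
  proof -
    have "D 1 *\<^sub>v ?h \<in> mat_kernel (D 0)" unfolding ker[symmetric] by simp
    then show ?thesis using C0 by (simp add: mat_kernel_def)
  qed
  have Dc: "D 1 *\<^sub>v ?f \<in> carrier_vec ?p" "D 1 *\<^sub>v ?h \<in> carrier_vec ?p"
    using mult_mat_vec_carrier[OF C1] by simp_all
  have "\<exists>x. (u - D 1 *\<^sub>v ?h) $ l = Xp * x" if l: "l < ?p" for l
  proof -
    have "Yp * u $ l - Xp * w $ l = Xp * (D 1 *\<^sub>v ?f) $ l + Yp * (D 1 *\<^sub>v ?h) $ l"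
      using arg_cong[OF k, of "\<lambda>v. v $ l"] l u(1) w(1) Dc
      by (simp add: k_def carrier_vecD[OF Dc(1)] carrier_vecD[OF Dc(2)]
          del: index_mult_mat_vec dim_mult_mat_vec One_nat_def)
    then have "Yp * (u - D 1 *\<^sub>v ?h) $ l = Xp * (w $ l + (D 1 *\<^sub>v ?f) $ l)"
      using l by (simp add: carrier_vecD[OF Dc(2)] algebra_simps del: index_mult_mat_vec dim_mult_mat_vec One_nat_def)
    then have "Xp dvd (u - D 1 *\<^sub>v ?h) $ l" by (rule X_dvd_of_Y_mult_eq)
    then show ?thesis by (simp add: dvd_def)
  qed
  then obtain x where x: "\<And>l. l < ?p \<Longrightarrow> (u - D 1 *\<^sub>v ?h) $ l = Xp * x l" by metis
  have eq: "u - D 1 *\<^sub>v ?h = Xp \<cdot>\<^sub>v vec ?p x"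
    using x u(1) by (intro eq_vecI)
      (auto simp: carrier_vecD[OF Dc(2)] simp del: dim_mult_mat_vec index_mult_mat_vec index_minus_vec(1) One_nat_def)
  have "vec 1 (\<lambda>_. Xp * g) = D 0 *\<^sub>v u - D 0 *\<^sub>v (D 1 *\<^sub>v ?h)"
    unfolding kernel0 u(2) by (intro eq_vecI) auto
  also have "\<dots> = D 0 *\<^sub>v (u - D 1 *\<^sub>v ?h)"
    by (rule mult_minus_distrib_mat_vec[OF C0 u(1) Dc(2), symmetric])
  also have "\<dots> = Xp \<cdot>\<^sub>v (D 0 *\<^sub>v vec ?p x)"
    unfolding eq by (rule mult_mat_vec_smult[OF C0]) simp
  finally have "vec 1 (\<lambda>_. Xp * g) = Xp \<cdot>\<^sub>v (D 0 *\<^sub>v vec ?p x)" .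
  from arg_cong[OF this, of "\<lambda>v. v $ 0"] have "Xp * g = Xp * (D 0 *\<^sub>v vec ?p x) $ 0"
    using C0 by simp
  then have "g = (D 0 *\<^sub>v vec ?p x) $ 0" by (simp only: X_mult_cancel)
  moreover have "D 0 *\<^sub>v vec ?p x \<in> {w \<in> carrier_vec 1. w $ 0 \<in> J}"
    unfolding im0[symmetric] by simp
  ultimately show "g \<in> J" by simp
qed

lemma regularity_imp_filled:
  fixes J :: "(2, 'k::field) pol set"
  assumes reg: "quot_has_regularity J r" and filled: "\<And>d. N \<le> d \<Longrightarrow> homogeneous d \<subseteq> J" and d: "r < d"
  shows "homogeneous d \<subseteq> J"
proof -
  obtain ds D where res: "minimal_free_resolution J ds D"
    and deg: "\<forall>i. \<forall>e \<in> set (ds i). e - int i \<le> r"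
    using reg unfolding quot_has_regularity_def by blast
  have deg2: "e - 2 \<le> r" if "e \<in> set (ds 2)" for e using deg[rule_format, OF that] by simp
  show ?thesis
    using d
  proof (induction "nat (N - d)" arbitrary: d)
    case 0
    then show ?case using filled by simp
  next
    case (Suc m)
    show ?case
      by (rule resolution_fills_downwards[OF res deg2 Suc.hyps(1)]) (use Suc in auto)
  qed
qed

lemma homogeneous_subset_ideal_gen:
  assumes "\<And>i j. int (i + j) = d \<Longrightarrow> Xp ^ i * Yp ^ j \<in> ideal_gen G"
  shows "homogeneous d \<subseteq> ideal_gen G"
proof
  fix f :: "(2, 'a) pol" assume f: "f \<in> homogeneous d"
  have "single m (lookup f m) \<in> ideal_gen G" if m: "m \<in> keys f" for m
  proof -
    obtain i j where mij: "m = xy i j" by (rule xy_exhaust)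
    have "int (i + j) = d" using homogeneousD[OF f, of m] m unfolding mij by (simp add: in_keys_iff)
    then have "single 0 (lookup f m) * (Xp ^ i * Yp ^ j) \<in> ideal_gen G"
      by (intro ideal_gen_mult assms)
    then show ?thesis by (simp add: XY_single mult_single mij)
  qed
  then have "(\<Sum>m\<in>keys f. single m (lookup f m)) \<in> ideal_gen G"
    by (rule ideal_gen_sum)
  then show "f \<in> ideal_gen G" unfolding poly_eq_sum_single[of f, symmetric] .
qed

lemma homogeneous_subset_of_powers:
  fixes G :: "(2, 'k::comm_ring_1) pol set"
  assumes "Xp ^ a \<in> ideal_gen G" "Yp ^ b \<in> ideal_gen G" "int (a + b) \<le> d + 1"
  shows "homogeneous d \<subseteq> ideal_gen G"
proof (rule homogeneous_subset_ideal_gen)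
  fix i j assume "int (i + j) = d"
  then have "a \<le> i \<or> b \<le> j" using assms(3) by linarith
  then show "Xp ^ i * Yp ^ j \<in> ideal_gen G"
  proof
    assume "a \<le> i"
    then have "Xp ^ i * Yp ^ j = (Xp ^ (i - a) * Yp ^ j) * (Xp ^ a :: (2, 'k) pol)"
      by (simp add: ac_simps flip: power_add)
    then show ?thesis using ideal_gen_mult[OF assms(1)] by simp
  next
    assume "b \<le> j"
    then have "Xp ^ i * Yp ^ j = (Xp ^ i * Yp ^ (j - b)) * (Yp ^ b :: (2, 'k) pol)"
      by (simp add: mult.assoc flip: power_add)
    then show ?thesis using ideal_gen_mult[OF assms(2)] by simp
  qed
qed

context filling_generators
begin

text \<open>
  A generator of degree \<open>t\<close> is superfluous, since the other ones already generate all forms of degree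
  \<open>t - 1\<close>. The remaining generators satisfy the same assumptions, and their resolution is minimal.
\<close>

definition low where "low = filter (\<lambda>k. es ! k < int t) [0..<n]"

lemma low_nth: "l < length low \<Longrightarrow> low ! l < n \<and> es ! (low ! l) < int t"
  using nth_mem[of l low] by (auto simp: low_def)

lemma set_low: "set low = {k. k < n \<and> es ! k < int t}"
  by (auto simp: low_def)

lemma bij_low: "bij_betw ((!) low) {..<length low} (set low)"
  by (rule bij_betw_nth) (simp_all add: low_def)

lemma not_low: "v \<in> free_component es (int t - 1) \<Longrightarrow> k < n \<Longrightarrow> k \<notin> set low \<Longrightarrow> v $ k = 0"
  using free_componentD(2)[of v es "int t - 1" k]
  by (intro homogeneous_neg[of "int t - 1 - es ! k"]) (auto simp: set_low length_es)

lemma sum_low: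
  assumes "v \<in> free_component es (int t - 1)"
  shows "(\<Sum>l<length low. v $ (low ! l) * gs ! (low ! l)) = (\<Sum>k<n. v $ k * gs ! k)"
proof -
  have "(\<Sum>l<length low. v $ (low ! l) * gs ! (low ! l)) = (\<Sum>k\<in>set low. v $ k * gs ! k)"
    by (rule sum.reindex_bij_betw[OF bij_low])
  also have "\<dots> = (\<Sum>k<n. v $ k * gs ! k)"
    using not_low[OF assms] by (intro sum.mono_neutral_left) (auto simp: set_low)
  finally show ?thesis .
qed

lemma filling_low: "filling_generators (map ((!) gs) low) (map ((!) es) low) t"
proof
  fix g :: "(2, 'k) pol" assume "g \<in> homogeneous (int t - 1)"
  then obtain v where v: "v \<in> free_component es (int t - 1)" "(gen_row gs *\<^sub>v v) $ 0 = g"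
    using spanning by blast
  have vc: "v \<in> carrier_vec n" using free_componentD(1)[OF v(1)] length_es by simp
  let ?v = "vec (length low) (\<lambda>l. v $ (low ! l))"
  have "(gen_row (map ((!) gs) low) *\<^sub>v ?v) $ 0 = g"
    using v(2) vc sum_low[OF v(1)] by (simp add: gen_row_mult del: index_mult_mat_vec)
  moreover have "?v \<in> free_component (map ((!) es) low) (int t - 1)"
    using free_componentD(2)[OF v(1)] low_nth by (intro free_componentI) (auto simp: length_es)
  ultimately show "\<exists>v \<in> free_component (map ((!) es) low) (int t - 1). (gen_row (map ((!) gs) low) *\<^sub>v v) $ 0 = g"
    by blast
next
  fix v assume v: "v \<in> syz (map ((!) gs) low)" "v \<in> free_component (map ((!) es) low) (int t - 1)"
  have vc: "v \<in> carrier_vec (length low)" using v by (simp add: syz_iff)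
  let ?i = "the_inv_into {..<length low} ((!) low)"
  let ?v = "vec n (\<lambda>k. if k \<in> set low then v $ ?i k else 0)"
  have inv: "?i (low ! l) = l" if "l < length low" for l
    using that bij_low by (intro the_inv_into_f_f) (auto simp: bij_betw_def)
  have nth: "?v $ (low ! l) = v $ l" if "l < length low" for l
    using that inv low_nth[OF that] by simp
  have "?v \<in> free_component es (int t - 1)"
  proof (rule free_componentI)
    fix k assume k: "k < length es"
    show "?v $ k \<in> homogeneous (int t - 1 - es ! k)"
    proof (cases "k \<in> set low")
      case True
      then obtain l where "l < length low" "k = low ! l" by (auto simp: in_set_conv_nth)
      then show ?thesis using nth free_componentD(2)[OF v(2), of l] by simp
    next
      case False
      then show ?thesis using k by (simp add: length_es)
    qed
  qed (simp add: length_es)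
  moreover from this have "?v \<in> syz gs"
  proof -
    have "(\<Sum>k<n. ?v $ k * gs ! k) = (\<Sum>l<length low. v $ l * gs ! (low ! l))"
      using sum_low[OF \<open>?v \<in> free_component es (int t - 1)\<close>] nth by simp
    also have "\<dots> = (gen_row (map ((!) gs) low) *\<^sub>v v) $ 0"
      using vc by (simp add: gen_row_mult del: index_mult_mat_vec)
    also have "\<dots> = 0" using v(1) by (simp add: syz_iff del: index_mult_mat_vec)
    finally have "(gen_row gs *\<^sub>v ?v) $ 0 = 0" by (simp add: gen_row_mult del: index_mult_mat_vec)
    then show ?thesis by (auto simp: syz_iff vec_eq_iff gen_row_def)
  qed
  ultimately have 0: "?v = 0\<^sub>v n" using no_syzygies by blast
  show "v = 0\<^sub>v (length (map ((!) gs) low))"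
    using vc nth low_nth unfolding 0 by (intro eq_vecI) auto
qed (use low_nth gens_homogeneous degree_nonneg degree_le t_pos in auto)

lemma ideal_low: "ideal_gen (set (map ((!) gs) low)) = ideal_gen (set gs)"
proof
  show "ideal_gen (set (map ((!) gs) low)) \<subseteq> ideal_gen (set gs)"
    using ideal_gen_superset[of "set gs"]
    by (intro ideal_gen_minimal) (auto simp: ideal_gen_add ideal_gen_mult set_low)
  interpret low: filling_generators "map ((!) gs) low" "map ((!) es) low" t by (rule filling_low)
  have "gs ! k \<in> ideal_gen (set (map ((!) gs) low))" if k: "k < n" for k
  proof (cases "es ! k < int t")
    case True
    then have "gs ! k \<in> set (map ((!) gs) low)" using k by (auto simp: set_low)
    then show ?thesis using ideal_gen_superset by blast
  next
    case False
    then have "gs ! k \<in> homogeneous (int t)"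
      using gens_homogeneous[OF k] degree_le[OF k] by (metis nle_le not_less)
    then obtain p q where "gs ! k = Xp * p + Yp * q" "p \<in> homogeneous (int t - 1)" "q \<in> homogeneous (int t - 1)"
      using homogeneous_split2[of "gs ! k" "int t"] t_pos by auto
    then show ?thesis
      using low.homogeneous_in_ideal by (auto intro!: ideal_gen_add ideal_gen_mult)
  qed
  then show "ideal_gen (set gs) \<subseteq> ideal_gen (set (map ((!) gs) low))"
    by (intro ideal_gen_minimal) (auto simp: ideal_gen_add ideal_gen_mult in_set_conv_nth)
qed

lemma has_regularity_if_two_low:
  assumes two: "2 \<le> card {k. k < n \<and> es ! k < int t}" and pos: "\<And>k. k < n \<Longrightarrow> 1 \<le> es ! k"
  shows "quot_has_regularity (ideal_gen (set gs)) (int t - 2)"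
proof -
  interpret low: filling_generators "map ((!) gs) low" "map ((!) es) low" t by (rule filling_low)
  have "card (set low) = length low" by (rule distinct_card) (simp add: low_def)
  then have "2 \<le> length low" using two by (simp add: set_low)
  then show ?thesis
    using low.has_regularity pos low_nth unfolding ideal_low by simp
qed

end

section \<open>The matrix N\<close>

lemma lookup_XY_sum_power:
  "lookup ((Xp + Yp :: (2, 'k::comm_ring_1) pol) ^ k) (xy p q)
    = (if p + q = k then of_nat (k choose p) else 0)"
proof (induction k arbitrary: p q)
  case 0
  show ?case using xy_eq_iff[of p q 0 0] by (simp add: lookup_one when_def xy_0_0)
next
  case (Suc k)
  show ?case
    by (cases p; cases q) (auto simp: distrib_right lookup_add Suc)
qed

lemma lookup_XY_product:
  "lookup (Xp ^ i * Yp ^ j * (Xp + Yp :: (2, 'k::comm_ring_1) pol) ^ k) (xy p q)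
    = (if p + q = i + j + k \<and> i \<le> p then of_nat (k choose (p - i)) else 0)"
  by (auto simp: mult.assoc lookup_X_power_mult lookup_Y_power_mult lookup_XY_sum_power binomial_eq_0)

lemma homogeneous_XY_product:
  "int (i + j + k) = d \<Longrightarrow> Xp ^ i * Yp ^ j * (Xp + Yp :: (2, 'k::comm_ring_1) pol) ^ k \<in> homogeneous d"
  by (rule homogeneous2I) (auto simp: lookup_XY_product split: if_splits)

text \<open>
  Reflection of the lower index. N is written with the column order opposite to the powers of \<open>x\<close>.
\<close>

lemma int_binom_symmetric:
  "int_binom n (int n - x) = (if 0 \<le> x then int (n choose nat x) else 0)"
proof (cases "0 \<le> x \<and> x \<le> int n")
  case True
  then have "nat (int n - x) = n - nat x" "nat x \<le> n" by auto
  then show ?thesis using True binomial_symmetric[of "nat x" n] by (simp add: int_binom_def)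
next
  case False
  then show ?thesis by (auto simp: int_binom_def intro!: binomial_eq_0)
qed

lemma homogeneous_expand_XY:
  fixes f :: "(2, 'k::comm_ring_1) pol"
  assumes f: "f \<in> homogeneous (int n - 1)"
  shows "f = (\<Sum>i<n. single 0 (lookup f (xy (n - 1 - i) i)) * (Xp ^ (n - 1 - i) * Yp ^ i))"
proof (rule poly2_eqI)
  fix p q
  have "(\<Sum>i<n. lookup (single 0 (lookup f (xy (n - 1 - i) i)) * (Xp ^ (n - 1 - i) * Yp ^ i)) (xy p q))
      = (\<Sum>i<n. if i = q then (if p = n - 1 - q then lookup f (xy p q) else 0) else 0)"
    by (rule sum.cong) (auto simp: lookup_const_mult XY_single lookup_single when_def)
  then show "lookup f (xy p q) = lookup (\<Sum>i<n. single 0 (lookup f (xy (n - 1 - i) i)) * (Xp ^ (n - 1 - i) * Yp ^ i)) (xy p q)"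
    using homogeneous2D[OF f, of p q] by (auto simp: lookup_sum)
qed

lemma homogeneous_const_XY:
  "int (i + j) = d \<Longrightarrow> single 0 (x::'k::comm_ring_1) * (Xp ^ i * Yp ^ j) \<in> homogeneous d"
  by (simp add: XY_single mult_single homogeneous_single)

lemma all_less_4: "(\<forall>k<4. P k) \<longleftrightarrow> P 0 \<and> P 1 \<and> P 2 \<and> P (3::nat)"
  by (auto simp: eval_nat_numeral less_Suc_eq)

lemma sum_less_4: "(\<Sum>k<4. F k) = F 0 + F 1 + F 2 + (F (3::nat) :: 'a::comm_monoid_add)"
  by (simp add: eval_nat_numeral)

text \<open>
  The hypotheses in terms of natural numbers, with \<open>t = s + 2\<close>. The last equation for \<open>t\<close> expresses
  that the six exponents add up to \<open>3 t\<close>.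
\<close>

locale punctured_hexagon =
  fixes a b c \<alpha> \<beta> \<gamma> A B C M t :: nat
  assumes t_eq: "t = a + A" "t = b + B" "t = c + C" "t = \<alpha> + \<beta> + \<gamma> + M" "t = A + B + C + M"
    and exponents_less: "\<alpha> < a" "\<beta> < b" "\<gamma> < c"
    and at_most_one_zero: "\<not> (\<alpha> = 0 \<and> \<beta> = 0)" "\<not> (\<alpha> = 0 \<and> \<gamma> = 0)" "\<not> (\<beta> = 0 \<and> \<gamma> = 0)"
    and side_le: "A \<le> \<beta> + \<gamma>" "B \<le> \<alpha> + \<gamma>" "C \<le> \<alpha> + \<beta>"
begin

lemma t_ge_3: "3 \<le> t"
  using t_eq exponents_less at_most_one_zero by linarith

lemma hexagon_s_eq: "hexagon_s a b c \<alpha> \<beta> \<gamma> = int t - 2"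
proof -
  have "a + b + c + \<alpha> + \<beta> + \<gamma> = 3 * t" using t_eq by linarith
  then show ?thesis by (simp add: hexagon_s_def)
qed

abbreviation es where "es \<equiv> [int (\<alpha> + \<beta> + \<gamma>), int a, int b, int c]"

text \<open>
  The multiples of degree \<open>t - 1\<close> of \<open>(x + y)^c\<close> by monomials, followed by those of the puncture.
\<close>

definition row_poly :: "nat \<Rightarrow> (2, 'k::comm_ring_1) pol" where
  "row_poly i = (if i < C then Xp ^ (C - 1 - i) * Yp ^ i * (Xp + Yp) ^ c
     else Xp ^ (\<alpha> + (M - 1 - (i - C))) * Yp ^ (\<beta> + (i - C)) * (Xp + Yp) ^ \<gamma>)"

abbreviation N_field :: "'k::field mat" where
  "N_field \<equiv> map_mat of_int (N_matrix a b c \<alpha> \<beta> \<gamma>)"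

lemma N_matrix_eq: "N_matrix a b c \<alpha> \<beta> \<gamma> = mat (C + M) (C + M) (\<lambda>(i, j).
    if i < C then int_binom c (int A + int j - int i)
    else int_binom \<gamma> (int A + int C - int \<beta> + int j - int i))"
proof -
  have eqs: "int t - 2 + 2 - int a = int A" "int t - 2 + 2 - int c = int C"
      "int t - 2 + 2 - int (\<alpha> + \<beta> + \<gamma>) = int M" "nat (int C + int M) = C + M"
    using t_eq by linarith+
  show ?thesis unfolding N_matrix_def Let_def hexagon_s_eq eqs by simp
qed

lemma N_field_carrier [simp]: "N_field \<in> carrier_mat (C + M) (C + M)"
  by (simp add: N_matrix_eq)

text \<open>
  The columns of N belong to the monomials of degree \<open>t - 1\<close> divisible neither by \<open>x^a\<close> nor by \<open>y^b\<close>: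
  the exponent of \<open>x\<close> decreases from \<open>a - 1\<close> to \<open>B\<close>.
\<close>

lemma N_field_entry:
  assumes i: "i < C + M" and j: "j < C + M"
  shows "(N_field :: 'k::field mat) $$ (i, j) = lookup (row_poly i) (xy (a - 1 - j) (A + j))"
proof -
  define p where "p = a - 1 - j"
  have p: "p + j + 1 = a" using j t_eq unfolding p_def by linarith
  have binom: "(if q \<le> p then of_nat (k choose (p - q)) else 0) = (of_int (int_binom k x) :: 'k)"
    if "int k - x = int p - int q" for q k x
  proof -
    have "x = int k - (int p - int q)" using that by linarith
    then show ?thesis
      unfolding \<open>x = _\<close> int_binom_symmetric by (auto simp flip: of_nat_diff)
  qed
  have entry: "N_field $$ (i, j) = (of_int (N_matrix a b c \<alpha> \<beta> \<gamma> $$ (i, j)) :: 'k)"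
    using i j by (simp add: N_matrix_eq)
  show ?thesis
  proof (cases "i < C")
    case True
    define q where "q = C - 1 - i"
    have q: "q + i + 1 = C" using True unfolding q_def by linarith
    have "p + (A + j) = q + i + c" using p q t_eq by linarith
    then have "lookup (row_poly i :: (2, 'k) pol) (xy p (A + j))
        = (if q \<le> p then of_nat (c choose (p - q)) else 0)"
      unfolding row_poly_def q_def[symmetric] using True by (simp add: lookup_XY_product)
    also have "\<dots> = of_int (int_binom c (int A + int j - int i))"
      by (rule binom) (use p q t_eq in linarith)
    also have "\<dots> = N_field $$ (i, j)"
      unfolding entry using i j True by (simp add: N_matrix_eq)
    finally show ?thesis unfolding p_def by simp
  next
    case False
    define q where "q = \<alpha> + (M - 1 - (i - C))"
    have q: "q + i + 1 = \<alpha> + M + C" using False i unfolding q_def by linarith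
    have "p + (A + j) = q + (\<beta> + (i - C)) + \<gamma>" using p q t_eq False by linarith
    then have "lookup (row_poly i :: (2, 'k) pol) (xy p (A + j))
        = (if q \<le> p then of_nat (\<gamma> choose (p - q)) else 0)"
      unfolding row_poly_def q_def[symmetric] using False by (simp add: lookup_XY_product)
    also have "\<dots> = of_int (int_binom \<gamma> (int A + int C - int \<beta> + int j - int i))"
      by (rule binom) (use p q t_eq in linarith)
    also have "\<dots> = N_field $$ (i, j)"
      unfolding entry using i j False by (simp add: N_matrix_eq)
    finally show ?thesis unfolding p_def by simp
  qed
qed

text \<open>
  A vector \<open>w\<close> of length \<open>C + M\<close> encodes the cofactors of \<open>(x + y)^c\<close> and of the puncture in a
  combination of degree \<open>t - 1\<close>.
\<close>

definition power_cofactor :: "(nat \<Rightarrow> 'k) \<Rightarrow> (2, 'k::field) pol" where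
  "power_cofactor w = (\<Sum>i<C. single 0 (w i) * (Xp ^ (C - 1 - i) * Yp ^ i))"

definition puncture_cofactor :: "(nat \<Rightarrow> 'k) \<Rightarrow> (2, 'k::field) pol" where
  "puncture_cofactor w = (\<Sum>i<M. single 0 (w (C + i)) * (Xp ^ (M - 1 - i) * Yp ^ i))"

abbreviation puncture :: "(2, 'k::comm_ring_1) pol" where
  "puncture \<equiv> Xp ^ \<alpha> * Yp ^ \<beta> * (Xp + Yp) ^ \<gamma>"

lemma sum_split: "(\<Sum>i<C + M. F i) = (\<Sum>i<C. F i) + (\<Sum>i<M. F (C + i) :: 'b::comm_monoid_add)"
proof -
  have "(\<Sum>i<C + M. F i) = (\<Sum>i\<in>{0..<C}. F i) + (\<Sum>i\<in>{0 + C..<M + C}. F i)"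
    by (simp add: lessThan_atLeast0 sum.atLeastLessThan_concat add.commute)
  then show ?thesis by (simp only: sum.shift_bounds_nat_ivl lessThan_atLeast0) (simp add: add.commute)
qed

lemma row_poly_top: "i < C \<Longrightarrow> row_poly i = Xp ^ (C - 1 - i) * Yp ^ i * (Xp + Yp) ^ c"
  by (simp add: row_poly_def)

lemma row_poly_bottom: "row_poly (C + i) = Xp ^ (M - 1 - i) * Yp ^ i * puncture"
  unfolding row_poly_def power_add by (simp add: ac_simps)

lemma cofactors_eq_row_polys:
  "puncture_cofactor w * puncture + power_cofactor w * (Xp + Yp) ^ c
    = (\<Sum>i<C + M. single 0 (w i) * row_poly i)"
  unfolding sum_split power_cofactor_def puncture_cofactor_def sum_distrib_right row_poly_bottom
  by (simp add: row_poly_top mult.assoc add.commute)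

lemma power_cofactor_homogeneous: "power_cofactor w \<in> homogeneous (int C - 1)"
  unfolding power_cofactor_def by (intro homogeneous_sum homogeneous_const_XY) auto

lemma puncture_cofactor_homogeneous: "puncture_cofactor w \<in> homogeneous (int M - 1)"
  unfolding puncture_cofactor_def by (intro homogeneous_sum homogeneous_const_XY) auto

lemma cofactors_surj:
  assumes f: "f \<in> homogeneous (int M - 1)" and g: "g \<in> homogeneous (int C - 1)"
  obtains w where "f = puncture_cofactor w" "g = power_cofactor w"
proof
  let ?w = "\<lambda>i. if i < C then lookup g (xy (C - 1 - i) i)
    else lookup f (xy (M - 1 - (i - C)) (i - C))"
  show "f = puncture_cofactor ?w"
    using homogeneous_expand_XY[OF f] by (simp add: puncture_cofactor_def)
  show "g = power_cofactor ?w"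
    using homogeneous_expand_XY[OF g] by (simp add: power_cofactor_def)
qed

lemma lookup_power_cofactor: "i < C \<Longrightarrow> lookup (power_cofactor w) (xy (C - 1 - i) i) = w i"
proof -
  assume i: "i < C"
  have "lookup (power_cofactor w) (xy (C - 1 - i) i) = (\<Sum>k<C. if k = i then w i else 0)"
    unfolding power_cofactor_def lookup_sum
    by (rule sum.cong) (use i in \<open>auto simp: lookup_const_mult XY_single lookup_single when_def\<close>)
  then show ?thesis using i by simp
qed

lemma lookup_puncture_cofactor: "i < M \<Longrightarrow> lookup (puncture_cofactor w) (xy (M - 1 - i) i) = w (C + i)"
proof -
  assume i: "i < M"
  have "lookup (puncture_cofactor w) (xy (M - 1 - i) i) = (\<Sum>k<M. if k = i then w (C + i) else 0)"
    unfolding puncture_cofactor_def lookup_sum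
    by (rule sum.cong) (use i in \<open>auto simp: lookup_const_mult XY_single lookup_single when_def\<close>)
  then show ?thesis using i by simp
qed

lemma cofactors_eq_0:
  assumes "puncture_cofactor w = 0" "power_cofactor w = 0" "i < C + M"
  shows "w i = 0"
  using lookup_power_cofactor[of i w] lookup_puncture_cofactor[of "i - C" w] assms by (cases "i < C") auto

text \<open>
  The multiples of \<open>x^a\<close> and \<open>y^b\<close> do not contain the monomials that belong to the columns of N.
\<close>

lemma middle_coefficient:
  assumes j: "j < C + M"
  shows "lookup (puncture_cofactor w * puncture + f1 * Xp ^ a + f2 * Yp ^ b + power_cofactor w * (Xp + Yp) ^ c)
      (xy (a - 1 - j) (A + j)) = (transpose_mat N_field *\<^sub>v vec (C + M) w) $ j"
proof -
  have 1: "lookup (f1 * Xp ^ a) (xy (a - 1 - j) (A + j)) = 0"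
    using j t_eq by (subst mult.commute) (simp add: lookup_X_power_mult)
  have 2: "lookup (f2 * Yp ^ b) (xy (a - 1 - j) (A + j)) = 0"
    using j t_eq by (subst mult.commute) (simp add: lookup_Y_power_mult)
  have "puncture_cofactor w * puncture + f1 * Xp ^ a + f2 * Yp ^ b + power_cofactor w * (Xp + Yp) ^ c
      = (\<Sum>i<C + M. single 0 (w i) * row_poly i) + f1 * Xp ^ a + f2 * Yp ^ b"
    unfolding cofactors_eq_row_polys[symmetric] by (simp add: ac_simps)
  note eq = this
  have "lookup (puncture_cofactor w * puncture + f1 * Xp ^ a + f2 * Yp ^ b + power_cofactor w * (Xp + Yp) ^ c)
      (xy (a - 1 - j) (A + j)) = (\<Sum>i<C + M. w i * N_field $$ (i, j))"
    unfolding eq lookup_add lookup_sum 1 2 add_0_right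
    by (intro sum.cong) (simp_all only: lookup_const_mult N_field_entry[OF _ j] lessThan_iff)
  also have "\<dots> = (transpose_mat N_field *\<^sub>v vec (C + M) w) $ j"
    using j N_field_carrier by (subst mult_mat_vec_index[of _ "C + M" "C + M"]) (auto intro!: sum.cong)
  finally show ?thesis .
qed

text \<open>
  A monomial of degree \<open>t - 1\<close> is a multiple of \<open>x^a\<close>, or a multiple of \<open>y^b\<close>, or belongs to a column
  of N; these cases exclude each other as \<open>a + b \<ge> t\<close>.
\<close>

lemma middle_zero_decomposition:
  fixes g :: "(2, 'k::field) pol"
  assumes g: "g \<in> homogeneous (int t - 1)"
    and 0: "\<And>j. j < C + M \<Longrightarrow> lookup g (xy (a - 1 - j) (A + j)) = 0"
  obtains f1 f2 where "g = f1 * Xp ^ a + f2 * Yp ^ b" "f1 \<in> homogeneous (int A - 1)" "f2 \<in> homogeneous (int B - 1)"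
proof
  \<comment> \<open>collect the terms of \<open>g\<close> divisible by \<open>x^a\<close>, and those divisible by \<open>y^b\<close>\<close>
  have inj: "inj ((+) (xy a 0))" "inj ((+) (xy 0 b))" by (simp_all add: inj_def)
  let ?f1 = "Poly_Mapping.map_key ((+) (xy a 0)) g" and ?f2 = "Poly_Mapping.map_key ((+) (xy 0 b)) g"
  show "?f1 \<in> homogeneous (int A - 1)"
  proof (rule homogeneous2I)
    fix i j assume "lookup ?f1 (xy i j) \<noteq> 0"
    then have "int (a + i + j) = int t - 1"
      using homogeneous2D[OF g, of "a + i" j] by (auto simp: map_key.rep_eq[OF inj(1)] xy_add)
    then show "int (i + j) = int A - 1" using t_eq by simp
  qed
  show "?f2 \<in> homogeneous (int B - 1)"
  proof (rule homogeneous2I)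
    fix i j assume "lookup ?f2 (xy i j) \<noteq> 0"
    then have "int (i + (b + j)) = int t - 1"
      using homogeneous2D[OF g, of i "b + j"] by (auto simp: map_key.rep_eq[OF inj(2)] xy_add)
    then show "int (i + j) = int B - 1" using t_eq by simp
  qed
  show "g = ?f1 * Xp ^ a + ?f2 * Yp ^ b"
  proof (rule poly2_eqI)
    fix i j
    have rhs: "lookup (?f1 * Xp ^ a + ?f2 * Yp ^ b) (xy i j)
        = (if a \<le> i then lookup g (xy i j) else 0) + (if b \<le> j then lookup g (xy i j) else 0)"
      by (simp add: mult.commute[of _ "_ ^ _"] lookup_add lookup_X_power_mult lookup_Y_power_mult
          map_key.rep_eq[OF inj(1)] map_key.rep_eq[OF inj(2)] xy_add)
    show "lookup g (xy i j) = lookup (?f1 * Xp ^ a + ?f2 * Yp ^ b) (xy i j)"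
    proof (cases "int (i + j) = int t - 1")
      case False
      then show ?thesis unfolding rhs using homogeneous2D[OF g False] by simp
    next
      case True
      show ?thesis
      proof (cases "a \<le> i \<or> b \<le> j")
        case True
        moreover have "\<not> (a \<le> i \<and> b \<le> j)" using \<open>int (i + j) = int t - 1\<close> t_eq by linarith
        ultimately show ?thesis unfolding rhs by auto
      next
        case False
        have "i = a - 1 - (a - 1 - i)" "j = A + (a - 1 - i)" "a - 1 - i < C + M"
          using False True t_eq by linarith+
        then have "lookup g (xy i j) = 0" using 0[of "a - 1 - i"] by simp
        then show ?thesis unfolding rhs by simp
      qed
    qed
  qed
qed

lemma pure_powers_independent:
  fixes f1 f2 :: "(2, 'k::field) pol"
  assumes f1: "f1 \<in> homogeneous (int A - 1)" and f2: "f2 \<in> homogeneous (int B - 1)"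
    and eq: "f1 * Xp ^ a + f2 * Yp ^ b = 0"
  shows "f1 = 0" "f2 = 0"
proof -
  have coeff: "(if a \<le> i then lookup f1 (xy (i - a) j) else 0)
      + (if b \<le> j then lookup f2 (xy i (j - b)) else 0) = 0" for i j
    using arg_cong[OF eq, of "\<lambda>f. lookup f (xy i j)"]
    by (simp add: mult.commute[of _ "_ ^ _"] lookup_add lookup_X_power_mult lookup_Y_power_mult)
  show "f1 = 0"
  proof (rule poly2_eqI)
    fix i j
    show "lookup f1 (xy i j) = lookup 0 (xy i j)"
    proof (cases "int (i + j) = int A - 1")
      case True
      then have "\<not> b \<le> j" using t_eq by linarith
      then show ?thesis using coeff[of "i + a" j] by simp
    qed (simp add: homogeneous2D[OF f1])
  qed
  show "f2 = 0"
  proof (rule poly2_eqI)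
    fix i j
    show "lookup f2 (xy i j) = lookup 0 (xy i j)"
    proof (cases "int (i + j) = int B - 1")
      case True
      then have "\<not> a \<le> i" using t_eq by linarith
      then show ?thesis using coeff[of i "j + b"] by simp
    qed (simp add: homogeneous2D[OF f2])
  qed
qed

abbreviation gens :: "(2, 'k::field) pol list" where
  "gens \<equiv> gens_J a b c \<alpha> \<beta> \<gamma>"

lemma gens_eq: "gens = [puncture, Xp ^ a, Yp ^ b, (Xp + Yp) ^ c]"
  by (simp add: gens_J_def hexagon_gens_def)

lemma length_gens: "length gens = 4"
  by (simp add: gens_eq)

lemma nth_gens: "gens ! 0 = puncture" "gens ! 1 = Xp ^ a" "gens ! 2 = Yp ^ b" "gens ! 3 = (Xp + Yp) ^ c"
  by (simp_all add: gens_eq)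

lemma gen_row_gens:
  assumes "v \<in> carrier_vec 4"
  shows "(gen_row gens *\<^sub>v v) $ 0 = v $ 0 * puncture + v $ 1 * Xp ^ a + v $ 2 * Yp ^ b + v $ 3 * (Xp + Yp) ^ c"
  using gen_row_mult[of v gens, unfolded length_gens, OF assms] unfolding sum_less_4 nth_gens .

lemma length_es4: "length es = 4"
  by simp

lemma nth_es: "es ! 0 = int (\<alpha> + \<beta> + \<gamma>)" "es ! 1 = int a" "es ! 2 = int b" "es ! 3 = int c"
  by simp_all

lemma free_component_es:
  "v \<in> free_component es (int t - 1) \<longleftrightarrow> v \<in> carrier_vec 4 \<and> v $ 0 \<in> homogeneous (int M - 1) \<and>
     v $ 1 \<in> homogeneous (int A - 1) \<and> v $ 2 \<in> homogeneous (int B - 1) \<and> v $ 3 \<in> homogeneous (int C - 1)"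
proof -
  have "int t - 1 - int (\<alpha> + \<beta> + \<gamma>) = int M - 1" "int t - 1 - int a = int A - 1"
    "int t - 1 - int b = int B - 1" "int t - 1 - int c = int C - 1" using t_eq by simp_all
  then show ?thesis
    unfolding free_component_def mem_Collect_eq length_es4 all_less_4 nth_es by (simp only:)
qed

lemma vec4: "vec_of_list [f0, f1, f2, f3] \<in> carrier_vec 4"
  "vec_of_list [f0, f1, f2, f3] $ 0 = f0" "vec_of_list [f0, f1, f2, f3] $ 1 = f1"
  "vec_of_list [f0, f1, f2, f3] $ 2 = f2" "vec_of_list [f0, f1, f2, f3] $ 3 = f3"
proof -
  show "vec_of_list [f0, f1, f2, f3] \<in> carrier_vec 4" by (rule carrier_vecI, unfold dim_vec_of_list, simp)
qed (unfold vec_of_list_index, simp_all)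

lemma vec4_free_component:
  assumes "f0 \<in> homogeneous (int M - 1)" "f1 \<in> homogeneous (int A - 1)" "f2 \<in> homogeneous (int B - 1)"
    "f3 \<in> homogeneous (int C - 1)"
  shows "vec_of_list [f0, f1, f2, f3] \<in> free_component es (int t - 1)"
  unfolding free_component_es vec4 by (intro conjI assms vec4(1))

lemma combination_homogeneous:
  fixes f1 f2 :: "(2, 'k::field) pol"
  assumes "f1 \<in> homogeneous (int A - 1)" "f2 \<in> homogeneous (int B - 1)"
  shows "puncture_cofactor w * puncture + f1 * Xp ^ a + f2 * Yp ^ b + power_cofactor w * (Xp + Yp) ^ c \<in> homogeneous (int t - 1)"
proof -
  have pows: "puncture \<in> (homogeneous (int (\<alpha> + \<beta> + \<gamma>)) :: (2, 'k) pol set)"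
    "(Xp + Yp) ^ c \<in> (homogeneous (int c) :: (2, 'k) pol set)"
    "Xp ^ a \<in> (homogeneous (int a) :: (2, 'k) pol set)" "Yp ^ b \<in> (homogeneous (int b) :: (2, 'k) pol set)"
    using homogeneous_XY_product[of \<alpha> \<beta> \<gamma> "int (\<alpha> + \<beta> + \<gamma>)", where 'k='k]
      homogeneous_XY_product[of 0 0 c "int c", where 'k='k] by (simp_all add: homogeneous_pvar_power)
  have deg: "int t - 1 = int M - 1 + int (\<alpha> + \<beta> + \<gamma>)" "int t - 1 = int A - 1 + int a"
    "int t - 1 = int B - 1 + int b" "int t - 1 = int C - 1 + int c" using t_eq by linarith+
  show ?thesis
    by (intro homogeneous_add)
      (rule homogeneous_multI[OF puncture_cofactor_homogeneous pows(1) deg(1)]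
        homogeneous_multI[OF assms(1) pows(3) deg(2)] homogeneous_multI[OF assms(2) pows(4) deg(3)]
        homogeneous_multI[OF power_cofactor_homogeneous pows(2) deg(4)])+
qed

text \<open>
  Solve for the coefficients at the columns of N first; multiples of \<open>x^a\<close> and \<open>y^b\<close> then correct
  the other coefficients.
\<close>

lemma spanning_if_det:
  assumes det: "det (N_field :: 'k::field mat) \<noteq> 0" and g: "g \<in> homogeneous (int t - 1)"
  shows "\<exists>v \<in> free_component es (int t - 1). (gen_row gens *\<^sub>v v) $ 0 = (g :: (2, 'k) pol)"
proof -
  let ?N = "transpose_mat (N_field :: 'k mat)"
  have Nc: "?N \<in> carrier_mat (C + M) (C + M)" by (simp add: N_matrix_eq)
  have "det ?N \<noteq> 0" unfolding det_transpose[OF N_field_carrier] by (rule det)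
  from det_non_zero_imp_unit[OF Nc this, of "()"]
  obtain N' where N': "N' \<in> carrier_mat (C + M) (C + M)" "?N * N' = 1\<^sub>m (C + M)"
    unfolding Units_def ring_mat_def by auto
  let ?r = "vec (C + M) (\<lambda>j. lookup g (xy (a - 1 - j) (A + j)))"
  define w where "w = (\<lambda>i. (N' *\<^sub>v ?r) $ i)"
  have w: "vec (C + M) w = N' *\<^sub>v ?r" using N'(1) by (intro eq_vecI) (auto simp: w_def)
  have Nw: "?N *\<^sub>v vec (C + M) w = ?r"
    unfolding w using assoc_mult_mat_vec[OF Nc N'(1), of ?r] N'(2) by simp
  let ?h = "puncture_cofactor w * puncture + 0 * Xp ^ a + 0 * Yp ^ b + power_cofactor w * (Xp + Yp) ^ c"
  have "g - ?h \<in> homogeneous (int t - 1)"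
    by (intro homogeneous_diff g combination_homogeneous homogeneous_0)
  moreover have "lookup (g - ?h) (xy (a - 1 - j) (A + j)) = 0" if "j < C + M" for j
    unfolding lookup_minus middle_coefficient[OF that] Nw using that by simp
  ultimately obtain f1 f2 where f: "g - ?h = f1 * Xp ^ a + f2 * Yp ^ b" "f1 \<in> homogeneous (int A - 1)"
      "f2 \<in> homogeneous (int B - 1)"
    by (rule middle_zero_decomposition)
  let ?v = "vec_of_list [puncture_cofactor w, f1, f2, power_cofactor w]"
  have "?v \<in> free_component es (int t - 1)"
    by (intro vec4_free_component f power_cofactor_homogeneous puncture_cofactor_homogeneous)
  moreover have "(gen_row gens *\<^sub>v ?v) $ 0 = g"
    unfolding gen_row_gens[OF vec4(1)] vec4 using f(1) by (simp add: algebra_simps)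
  ultimately show ?thesis by blast
qed

text \<open>
  Syzygies of degree \<open>t - 1\<close> correspond to the kernel of the transpose of N: the cofactors of \<open>x^a\<close>
  and \<open>y^b\<close> are determined by the two other ones.
\<close>

lemma no_syzygies_iff_det:
  "(\<forall>v \<in> free_component es (int t - 1). v \<in> syz (gens :: (2, 'k) pol list) \<longrightarrow> v = 0\<^sub>v 4) \<longleftrightarrow> det (N_field :: 'k::field mat) \<noteq> 0"
  (is "?no_syz \<longleftrightarrow> _")
proof -
  let ?N = "transpose_mat (N_field :: 'k mat)"
  have Nc: "?N \<in> carrier_mat (C + M) (C + M)" by (simp add: N_matrix_eq)
  have det: "det ?N = det (N_field :: 'k mat)" by (rule det_transpose[OF N_field_carrier])
  show ?thesis
  proof
    assume no_syz: ?no_syz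
    show "det (N_field :: 'k mat) \<noteq> 0"
    proof
      assume "det (N_field :: 'k mat) = 0"
      then obtain v where v: "v \<in> carrier_vec (C + M)" "v \<noteq> 0\<^sub>v (C + M)" "?N *\<^sub>v v = 0\<^sub>v (C + M)"
        using det_0_iff_vec_prod_zero_field[OF Nc] det by auto
      define w where "w = (\<lambda>i. v $ i)"
      have w: "vec (C + M) w = v" using v(1) by (intro eq_vecI) (auto simp: w_def)
      let ?h = "puncture_cofactor w * puncture + 0 * Xp ^ a + 0 * Yp ^ b + power_cofactor w * (Xp + Yp) ^ c"
      have "?h \<in> homogeneous (int t - 1)"
        by (intro combination_homogeneous homogeneous_0)
      moreover have "lookup ?h (xy (a - 1 - j) (A + j)) = 0" if "j < C + M" for j
        unfolding middle_coefficient[OF that] w v(3) using that by simp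
      ultimately obtain f1 f2 where f: "?h = f1 * Xp ^ a + f2 * Yp ^ b" "f1 \<in> homogeneous (int A - 1)"
          "f2 \<in> homogeneous (int B - 1)"
        by (rule middle_zero_decomposition)
      let ?v = "vec_of_list [puncture_cofactor w, - f1, - f2, power_cofactor w]"
      have "?v \<in> free_component es (int t - 1)"
        by (intro vec4_free_component homogeneous_uminus f power_cofactor_homogeneous puncture_cofactor_homogeneous)
      moreover have h0: "(gen_row gens *\<^sub>v ?v) $ 0 = 0"
        unfolding gen_row_gens[OF vec4(1)] vec4
        using f(1) by (simp add: algebra_simps del: vec_of_list_Cons)
      have "?v \<in> syz gens"
        unfolding syz_iff_index length_gens by (intro conjI vec4(1) h0)
      ultimately have "?v = 0\<^sub>v 4" by (rule no_syz[rule_format])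
      then have "puncture_cofactor w = 0" "power_cofactor w = 0"
        using vec4(2)[of "puncture_cofactor w" "- f1" "- f2" "power_cofactor w"]
          vec4(5)[of "puncture_cofactor w" "- f1" "- f2" "power_cofactor w"] by simp_all
      then have "v = 0\<^sub>v (C + M)" using cofactors_eq_0[of w] v(1) by (intro eq_vecI) (auto simp: w_def)
      then show False using v(2) by simp
    qed
  next
    assume "det (N_field :: 'k mat) \<noteq> 0"
    show ?no_syz
    proof (intro ballI impI)
      fix v :: "(2, 'k) pol vec" assume v: "v \<in> free_component es (int t - 1)" "v \<in> syz gens"
      note v_parts = v(1)[unfolded free_component_es]
      then have vc: "v \<in> carrier_vec 4" by blast
      obtain w where w: "v $ 0 = puncture_cofactor w" "v $ 3 = power_cofactor w"
        using cofactors_surj[of "v $ 0" "v $ 3"] v_parts by blast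
      have "(gen_row gens *\<^sub>v v) $ 0 = 0" using v(2) unfolding syz_iff_index by blast
      then have eq: "puncture_cofactor w * puncture + v $ 1 * Xp ^ a + v $ 2 * Yp ^ b + power_cofactor w * (Xp + Yp) ^ c = 0"
        unfolding gen_row_gens[OF vc] w .
      have "?N *\<^sub>v vec (C + M) w = 0\<^sub>v (C + M)"
      proof (rule eq_vecI)
        fix j assume j: "j < dim_vec (0\<^sub>v (C + M) :: 'k vec)"
        then have "j < C + M" by simp
        from middle_coefficient[OF this, of w "v $ 1" "v $ 2"] j
        show "(?N *\<^sub>v vec (C + M) w) $ j = 0\<^sub>v (C + M) $ j" unfolding eq by simp
      qed (use Nc in simp)
      then have "vec (C + M) w = 0\<^sub>v (C + M)"
        using det_0_iff_vec_prod_zero_field[OF Nc] det \<open>det N_field \<noteq> 0\<close> by (metis vec_carrier)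
      then have "w i = 0" if "i < C + M" for i
        using that by (metis index_vec index_zero_vec(1))
      then have "v $ 0 = 0" "v $ 3 = 0" unfolding w by (simp_all add: puncture_cofactor_def power_cofactor_def)
      moreover from this have "v $ 1 = 0" "v $ 2 = 0"
        using pure_powers_independent[of "v $ 1" "v $ 2"] v_parts eq unfolding w by simp_all
      ultimately show "v = 0\<^sub>v 4"
        using vc by (intro eq_vecI) (auto simp: eval_nat_numeral less_Suc_eq)
    qed
  qed
qed

end

section \<open>Monomials and monomial ideals in three variables\<close>

definition xyz :: "nat \<times> nat \<times> nat \<Rightarrow> 3 \<Rightarrow>\<^sub>0 nat" where
  "xyz = (\<lambda>(i, j, k). single 0 i + single 1 j + single 2 k)"

lemma UNIV_3: "(UNIV :: 3 set) = {0, 1, 2}"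
  by (rule card_subset_eq[symmetric]) simp_all

lemma sum_UNIV_3: "(\<Sum>x\<in>UNIV. F x) = F 0 + F 1 + F (2 :: 3)"
  for F :: "3 \<Rightarrow> 'a::comm_monoid_add"
  unfolding UNIV_3 by (simp add: add.assoc)

lemma lookup_xyz [simp]: "lookup (xyz (i, j, k)) 0 = i"
  "lookup (xyz (i, j, k)) 1 = j" "lookup (xyz (i, j, k)) 2 = k"
  by (simp_all add: xyz_def lookup_add lookup_single)

lemma xyz_eqI: "lookup m 0 = i \<Longrightarrow> lookup m 1 = j \<Longrightarrow> lookup m 2 = k
    \<Longrightarrow> m = xyz (i, j, k)"
proof (rule poly_mapping_eqI)
  fix v :: 3
  assume "lookup m 0 = i" "lookup m 1 = j" "lookup m 2 = k"
  moreover have "v = 0 \<or> v = 1 \<or> v = 2" using UNIV_3 by blast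
  ultimately show "lookup m v = lookup (xyz (i, j, k)) v" by auto
qed

lemma xyz_exhaust: obtains i j k where "m = xyz (i, j, k)"
  using xyz_eqI by blast

lemma xyz_eq_iff [simp]: "xyz x = xyz y \<longleftrightarrow> x = y"
  by (cases x; cases y) (metis lookup_xyz)

lemma xyz_add: "xyz (i, j, k) + xyz (i', j', k') = xyz (i + i', j + j', k + k')"
  by (rule xyz_eqI) (simp_all add: lookup_add)

lemma exp_degree_xyz [simp]: "exp_degree (xyz (i, j, k)) = i + j + k"
  by (simp add: xyz_def exp_degree_add)

lemma monomial3_eq: "monomial3 m = single (xyz m) 1"
  by (cases m) (simp add: monomial3_def pvar_power mult_single xyz_def)

lemma single_dvd_single_iff:
  fixes m n :: "'a::cancel_comm_monoid_add"
  shows "single m 1 dvd single n (1::'k::comm_ring_1) \<longleftrightarrow> (\<exists>q. n = m + q)"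
proof
  assume "single m 1 dvd single n (1::'k)"
  then obtain h where h: "single n (1::'k) = single m 1 * h" by (rule dvdE)
  show "\<exists>q. n = m + q"
  proof (rule ccontr)
    assume "\<not> (\<exists>q. n = m + q)"
    then have "lookup (single m 1 * h) n = 0"
      by (intro lookup_single_mult_eq_0) blast
    then show False unfolding h[symmetric] by simp
  qed
next
  assume "\<exists>q. n = m + q"
  then obtain q where "n = m + q" by blast
  then have "single n (1::'k) = single m 1 * single q 1"
    by (simp add: mult_single)
  then show "single m 1 dvd single n (1::'k)" by (rule dvdI)
qed

lemma monomial3_dvd_iff:
  "(monomial3 (i, j, k) :: (3, 'k::field) pol) dvd monomial3 (i', j', k') \<longleftrightarrow> i \<le> i' \<and> j \<le> j' \<and> k \<le> k'"
proof
  assume "(monomial3 (i, j, k) :: (3, 'k) pol) dvd monomial3 (i', j', k')"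
  then obtain q where q: "xyz (i', j', k') = xyz (i, j, k) + q"
    unfolding monomial3_eq single_dvd_single_iff by blast
  show "i \<le> i' \<and> j \<le> j' \<and> k \<le> k'"
    using arg_cong[OF q, of "\<lambda>m. lookup m 0"] arg_cong[OF q, of "\<lambda>m. lookup m 1"]
      arg_cong[OF q, of "\<lambda>m. lookup m 2"] by (simp add: lookup_add)
next
  assume "i \<le> i' \<and> j \<le> j' \<and> k \<le> k'"
  then have "xyz (i', j', k') = xyz (i, j, k) + xyz (i' - i, j' - j, k' - k)" by (simp add: xyz_add)
  then show "(monomial3 (i, j, k) :: (3, 'k) pol) dvd monomial3 (i', j', k')"
    unfolding monomial3_eq single_dvd_single_iff by blast
qed

text \<open>
  The polynomials all of whose terms are multiples of the generating monomials form an ideal.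
\<close>

lemma mem_monomial_ideal_iff:
  fixes E :: "'a::cancel_comm_monoid_add set" and f :: "'a \<Rightarrow>\<^sub>0 'k::comm_ring_1"
  shows "f \<in> ideal_gen ((\<lambda>e. single e 1) ` E)
    \<longleftrightarrow> (\<forall>m. lookup f m \<noteq> 0 \<longrightarrow> (\<exists>e\<in>E. \<exists>q. m = e + q))"
proof
  let ?I = "{f :: 'a \<Rightarrow>\<^sub>0 'k. \<forall>m \<in> keys f. \<exists>e\<in>E. \<exists>q. m = e + q}"
  assume f: "f \<in> ideal_gen ((\<lambda>e. single e 1) ` E)"
  have "ideal_gen ((\<lambda>e. single e 1) ` E) \<subseteq> ?I"
  proof (rule ideal_gen_minimal)
    show "f + g \<in> ?I" if "f \<in> ?I" "g \<in> ?I" for f g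
      using that Poly_Mapping.keys_add[of f g] by blast
    show "h * f \<in> ?I" if f: "f \<in> ?I" for h f
    proof -
      have "\<exists>e\<in>E. \<exists>q. m = e + q" if m: "m \<in> keys (h * f)" for m
      proof -
        obtain x y where xy: "m = x + y" "y \<in> keys f"
          using m Poly_Mapping.keys_mult[of h f] by blast
        then obtain e q where "e \<in> E" "y = e + q" using f by blast
        then have "m = e + (x + q)" using xy by (simp add: ac_simps)
        then show ?thesis using \<open>e \<in> E\<close> by blast
      qed
      then show ?thesis by blast
    qed
    show "(\<lambda>e. single e 1) ` E \<subseteq> ?I"
      by (auto intro!: exI[of _ 0] split: if_splits)
  qed auto
  then show "\<forall>m. lookup f m \<noteq> 0 \<longrightarrow> (\<exists>e\<in>E. \<exists>q. m = e + q)"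
    using f by (auto simp: in_keys_iff)
next
  let ?J = "ideal_gen ((\<lambda>e. single e (1::'k)) ` E)"
  assume f: "\<forall>m. lookup f m \<noteq> 0 \<longrightarrow> (\<exists>e\<in>E. \<exists>q. m = e + q)"
  have "single m (lookup f m) \<in> ?J" if "m \<in> keys f" for m
  proof -
    obtain e q where e: "e \<in> E" "m = e + q" using f \<open>m \<in> _\<close> by (auto simp: in_keys_iff)
    have "single e 1 \<in> ?J"
      using ideal_gen_superset[of "(\<lambda>e. single e (1::'k)) ` E"] e(1) by auto
    then have "single q (lookup f m) * single e 1 \<in> ?J"
      by (rule ideal_gen_mult)
    then show ?thesis by (simp add: mult_single e(2) add.commute)
  qed
  then have "(\<Sum>m\<in>keys f. single m (lookup f m)) \<in> ?J"
    by (rule ideal_gen_sum)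
  then show "f \<in> ?J" unfolding poly_eq_sum_single[of f, symmetric] .
qed

context punctured_hexagon
begin

section \<open>The monomials outside I\<close>

text \<open>
  Exponents of the monomials in \<open>I\<close>, see \<open>mem_ideal_I_iff\<close>.
\<close>

definition in_I :: "nat \<times> nat \<times> nat \<Rightarrow> bool" where
  "in_I = (\<lambda>(i, j, k). a \<le> i \<or> b \<le> j \<or> c \<le> k \<or> (\<alpha> \<le> i \<and> \<beta> \<le> j \<and> \<gamma> \<le> k))"

lemma in_I_mono: "in_I (i, j, k) \<Longrightarrow> i \<le> i' \<Longrightarrow> j \<le> j' \<Longrightarrow> k \<le> k' \<Longrightarrow> in_I (i', j', k')"
  by (auto simp: in_I_def)

lemma mem_ideal_I_iff:
  "f \<in> ideal_I a b c \<alpha> \<beta> \<gamma> \<longleftrightarrow> (\<forall>m. lookup f (xyz m) \<noteq> 0 \<longrightarrow> in_I m)"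
proof -
  let ?E = "{xyz (\<alpha>, \<beta>, \<gamma>), xyz (a, 0, 0), xyz (0, b, 0), xyz (0, 0, c)}"
  have gens: "set (hexagon_gens a b c \<alpha> \<beta> \<gamma> (pvar 0) (pvar 1) (pvar 2)) = (\<lambda>e. single e 1) ` ?E"
    by (simp add: hexagon_gens_def pvar_power mult_single xyz_def)
  have in_I: "(\<exists>e\<in>?E. \<exists>q. xyz m = e + q) \<longleftrightarrow> in_I m" for m
  proof -
    obtain i j k where m: "m = (i, j, k)" by (cases m)
    have "(\<exists>q. xyz m = xyz (i', j', k') + q) \<longleftrightarrow> i' \<le> i \<and> j' \<le> j \<and> k' \<le> k" for i' j' k'
      using monomial3_dvd_iff[of i' j' k' i j k, where 'k='a] unfolding m monomial3_eq single_dvd_single_iff .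
    then show ?thesis by (simp add: m in_I_def) blast
  qed
  have all: "(\<forall>m. P m) \<longleftrightarrow> (\<forall>m. P (xyz m))" for P
  proof (intro iffI allI)
    fix m assume "\<forall>m. P (xyz m)"
    then show "P m" by (cases m rule: xyz_exhaust) simp
  qed simp
  show ?thesis
    unfolding ideal_I_def gens mem_monomial_ideal_iff by (subst all) (simp only: in_I)
qed

abbreviation outside :: "'k::field itself \<Rightarrow> nat \<Rightarrow> (nat \<times> nat \<times> nat) list" where
  "outside T d \<equiv> monomials_outside (ideal_I a b c \<alpha> \<beta> \<gamma> :: (3, 'k) pol set) d"

lemma set_outside: "set (outside T d) = {(i, j, k). i + j + k = d \<and> \<not> in_I (i, j, k)}"
proof -
  have "monomial3 m \<notin> (ideal_I a b c \<alpha> \<beta> \<gamma> :: (3, 'a) pol set) \<longleftrightarrow> \<not> in_I m" for m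
    by (cases m) (auto simp add: mem_ideal_I_iff monomial3_eq lookup_single when_def)
  moreover have "set [(i, j, d - i - j). i \<leftarrow> rev [0..<Suc d], j \<leftarrow> rev [0..<Suc (d - i)]]
      = {(i, j, k). i + j + k = d}"
    by (auto simp: image_iff less_Suc_eq_le simp del: upt_Suc)
  ultimately show ?thesis unfolding monomials_outside_def set_filter by auto
qed

lemma distinct_outside: "distinct (outside T d)"
proof -
  let ?f = "\<lambda>i. map (\<lambda>j. (i, j, d - i - j)) (rev [0..<Suc (d - i)])"
  have "distinct (concat (map ?f (rev [0..<Suc d])))"
  proof (rule distinct_concat)
    show "distinct (map ?f (rev [0..<Suc d]))"
      unfolding distinct_map
    proof
      show "inj_on ?f (set (rev [0..<Suc d]))"
      proof (rule inj_onI)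
        fix i i' assume "?f i = ?f i'"
        from arg_cong[OF this, of "\<lambda>l. fst (hd l)"] show "i = i'" by simp
      qed
    qed simp
    show "distinct ys" if "ys \<in> set (map ?f (rev [0..<Suc d]))" for ys
      using that by (auto simp: distinct_map inj_on_def simp del: upt_Suc)
    show "set ys \<inter> set zs = {}" if "ys \<in> set (map ?f (rev [0..<Suc d]))" "zs \<in> set (map ?f (rev [0..<Suc d]))" "ys \<noteq> zs" for ys zs
      using that by (auto simp del: upt_Suc)
  qed
  then show ?thesis unfolding monomials_outside_def by (intro distinct_filter)
qed

section \<open>Counting the monomials outside I\<close>

text \<open>
  The monomials \<open>x^i y^j z^k\<close> outside \<open>I\<close> with fixed \<open>i < a\<close> and \<open>j < b\<close> are those with
  \<open>k < height i j\<close>.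
\<close>

definition height :: "nat \<Rightarrow> nat \<Rightarrow> nat" where
  "height i j = (if \<alpha> \<le> i \<and> \<beta> \<le> j then \<gamma> else c)"

lemma card_outside:
  "card {(i, j, k). i + j + k = d \<and> \<not> in_I (i, j, k)}
    = (\<Sum>(i, j) \<in> {..<a} \<times> {..<b}. if i + j \<le> d \<and> d < i + j + height i j then 1 else 0)"
proof -
  let ?P = "{(i, j) \<in> {..<a} \<times> {..<b}. i + j \<le> d \<and> d < i + j + height i j}"
  have "{(i, j, k). i + j + k = d \<and> \<not> in_I (i, j, k)} = (\<lambda>(i, j). (i, j, d - i - j)) ` ?P"
    using exponents_less by (auto simp: in_I_def height_def image_iff split: if_splits)
  then have "card {(i, j, k). i + j + k = d \<and> \<not> in_I (i, j, k)} = card ?P"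
    by (simp add: card_image inj_on_def split_def prod_eq_iff)
  also have "?P = {x \<in> {..<a} \<times> {..<b}. case x of (i, j) \<Rightarrow> i + j \<le> d \<and> d < i + j + height i j}"
    by auto
  also have "card \<dots> = (\<Sum>x \<in> {..<a} \<times> {..<b}. if case x of (i, j) \<Rightarrow> i + j \<le> d \<and> d < i + j + height i j then 1 else 0)"
    by (simp add: sum.If_cases Int_def)
  finally show ?thesis by (simp add: split_def)
qed

text \<open>
  The columns that start in degree \<open>t - 1\<close>.
\<close>

lemma card_bottom: "card {(i, j) \<in> {..<a} \<times> {..<b}. i + j = t - 1} = C + M"
proof -
  have "{(i, j) \<in> {..<a} \<times> {..<b}. i + j = t - 1} = (\<lambda>i. (i, t - 1 - i)) ` {B..<a}"
    using t_eq exponents_less by (auto simp: image_iff)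
  moreover have "inj_on (\<lambda>i. (i, t - 1 - i)) {B..<a}" by (simp add: inj_on_def)
  moreover have "a - B = C + M" using t_eq by linarith
  ultimately show ?thesis by (simp add: card_image)
qed

text \<open>
  The columns that end in degree \<open>t - 2\<close>. The columns of height \<open>c\<close> among them have \<open>i + j = C - 1\<close>;
  all of these pairs occur, as \<open>C \<le> \<alpha> + \<beta>\<close>. Those of height \<open>\<gamma>\<close> have
  \<open>(i - \<alpha>) + (j - \<beta>) = M - 1\<close>; all of these occur because the bounds on \<open>A\<close> and \<open>B\<close> say that
  \<open>M \<le> a - \<alpha>\<close> and \<open>M \<le> b - \<beta>\<close>.
\<close>

lemma card_top: "card {(i, j) \<in> {..<a} \<times> {..<b}. i + j + height i j = t - 1} = C + M"
proof -
  let ?S1 = "(\<lambda>i. (i, C - 1 - i)) ` {..<C}" and ?S2 = "(\<lambda>i. (\<alpha> + i, \<beta> + (M - 1 - i))) ` {..<M}"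
  have M_le: "M + \<alpha> \<le> a" "M + \<beta> \<le> b" "C \<le> a" "C \<le> b" using t_eq side_le by linarith+
  have "{(i, j) \<in> {..<a} \<times> {..<b}. i + j + height i j = t - 1} = ?S1 \<union> ?S2"
  proof (intro equalityI subsetI)
    fix x assume "x \<in> {(i, j) \<in> {..<a} \<times> {..<b}. i + j + height i j = t - 1}"
    then obtain i j where x: "x = (i, j)" "i < a" "j < b" "i + j + height i j = t - 1" by auto
    show "x \<in> ?S1 \<union> ?S2"
    proof (cases "\<alpha> \<le> i \<and> \<beta> \<le> j")
      case True
      then have "i + j + \<gamma> + 1 = t" using x(4) t_ge_3 by (simp add: height_def)
      then have "(i - \<alpha>) + (j - \<beta>) + 1 = M" using True t_eq by linarith
      then have "x = (\<alpha> + (i - \<alpha>), \<beta> + (M - 1 - (i - \<alpha>)))" "i - \<alpha> < M" using True x(1) by auto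
      then show ?thesis by blast
    next
      case False
      then have "height i j = c" by (auto simp: height_def)
      then have "i + j + c + 1 = t" using x(4) t_ge_3 by simp
      then have "i + j + 1 = C" using t_eq by linarith
      then have "x = (i, C - 1 - i)" "i < C" using x(1) by auto
      then show ?thesis by blast
    qed
  next
    fix x assume "x \<in> ?S1 \<union> ?S2"
    then show "x \<in> {(i, j) \<in> {..<a} \<times> {..<b}. i + j + height i j = t - 1}"
    proof
      assume "x \<in> ?S1"
      then obtain i where i: "i < C" "x = (i, C - 1 - i)" by auto
      then have "height i (C - 1 - i) = c" using side_le by (auto simp: height_def)
      then show ?thesis using i M_le t_eq by auto
    next
      assume "x \<in> ?S2"
      then obtain i where i: "i < M" "x = (\<alpha> + i, \<beta> + (M - 1 - i))" by auto
      then have "height (\<alpha> + i) (\<beta> + (M - 1 - i)) = \<gamma>" by (auto simp: height_def)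
      then show ?thesis using i M_le t_eq by auto
    qed
  qed
  moreover have "?S1 \<inter> ?S2 = {}" using side_le by auto
  moreover have "card ?S1 = C" "card ?S2 = M" by (simp_all add: card_image inj_on_def)
  ultimately show ?thesis by (simp add: card_Un_disjoint)
qed

text \<open>
  Passing from degree \<open>t - 2\<close> to degree \<open>t - 1\<close>, as many columns start as end. A column of height
  zero is counted on both sides.
\<close>

lemma length_outside_eq: "length (outside (T :: 'k::field itself) (t - 2)) = length (outside T (t - 1))"
proof -
  let ?P = "{..<a} \<times> {..<b}"
  let ?f = "\<lambda>d (i, j). if i + j \<le> d \<and> d < i + j + height i j then 1 else 0 :: nat"
  have card: "card {x \<in> ?P. Q x} = (\<Sum>x \<in> ?P. if Q x then 1 else 0)" for Q
    by (simp add: sum.If_cases Int_def)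
  have sum1: "(\<Sum>x\<in>?P. case x of (i, j) \<Rightarrow> if i + j + height i j = t - 1 then 1 else 0) = C + M"
  proof -
    have "{x \<in> ?P. case x of (i, j) \<Rightarrow> i + j + height i j = t - 1} = {(i, j) \<in> ?P. i + j + height i j = t - 1}"
      by auto
    then show ?thesis
      using card[of "\<lambda>(i, j). i + j + height i j = t - 1"] card_top by (simp add: split_def)
  qed
  have sum2: "(\<Sum>x\<in>?P. case x of (i, j) \<Rightarrow> if i + j = t - 1 then 1 else 0) = C + M"
  proof -
    have "{x \<in> ?P. case x of (i, j) \<Rightarrow> i + j = t - 1} = {(i, j) \<in> ?P. i + j = t - 1}"
      by auto
    then show ?thesis
      using card[of "\<lambda>(i, j). i + j = t - 1"] card_bottom by (simp add: split_def)
  qed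
  have "(\<Sum>x\<in>?P. ?f (t - 1) x) + (\<Sum>x\<in>?P. case x of (i, j) \<Rightarrow> if i + j + height i j = t - 1 then 1 else 0)
      = (\<Sum>x\<in>?P. ?f (t - 2) x) + (\<Sum>x\<in>?P. case x of (i, j) \<Rightarrow> if i + j = t - 1 then 1 else 0)"
    unfolding sum.distrib[symmetric] using t_ge_3 by (intro sum.cong) auto
  then have "(\<Sum>x\<in>?P. ?f (t - 1) x) = (\<Sum>x\<in>?P. ?f (t - 2) x)" unfolding sum1 sum2 by simp
  then show ?thesis
    using distinct_card[OF distinct_outside[of "t - 2", where 'a='k]] distinct_card[OF distinct_outside[of "t - 1", where 'a='k]]
    unfolding set_outside card_outside by simp
qed

end

section \<open>The matrix Z with weights\<close>

lemma sum_nth_distinct: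
  assumes "distinct xs"
  shows "(\<Sum>l<length xs. F (xs ! l)) = (\<Sum>x\<in>set xs. F x)"
  using sum.reindex_bij_betw[OF bij_betw_nth[OF assms refl refl], of F] .

lemma of_int_eq_0_iff_cong: "(of_int x :: 'k::ring_1) = 0 \<longleftrightarrow> [x = 0] (mod int CHAR('k))"
  by (simp add: of_int_eq_0_iff_char_dvd cong_0_iff)

text \<open>
  The coefficient of the monomial \<open>n\<close> in the product of the monomial with exponents \<open>(i, j, k)\<close> and the
  linear form \<open>u x + v y + w z\<close>.
\<close>

fun weight :: "'b::comm_ring_1 \<Rightarrow> 'b \<Rightarrow> 'b \<Rightarrow> nat \<times> nat \<times> nat \<Rightarrow> nat \<times> nat \<times> nat \<Rightarrow> 'b" where
  "weight u v w (i, j, k) n = (if n = (i + 1, j, k) then u else if n = (i, j + 1, k) then v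
     else if n = (i, j, k + 1) then w else 0)"

context punctured_hexagon
begin

text \<open>
  The weights come from an arbitrary ring because formal weights are used below.
\<close>

definition weighted_Z :: "'k::field itself \<Rightarrow> 'b::comm_ring_1 \<Rightarrow> 'b \<Rightarrow> 'b \<Rightarrow> 'b mat" where
  "weighted_Z T u v w = mat (length (outside T (t - 1))) (length (outside T (t - 1)))
     (\<lambda>(r, l). weight u v w (outside T (t - 2) ! r) (outside T (t - 1) ! l))"

lemma weighted_Z_carrier [simp]: "weighted_Z T u v w \<in> carrier_mat (length (outside T (t - 1))) (length (outside T (t - 1)))"
  by (simp add: weighted_Z_def)

lemma Z_matrix_eq:
  "map_mat of_int (Z_matrix TYPE('k::field) a b c \<alpha> \<beta> \<gamma>) = weighted_Z TYPE('k) 1 1 (1 :: 'b::comm_ring_1)"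
proof (rule eq_matI)
  have s: "nat (hexagon_s a b c \<alpha> \<beta> \<gamma>) = t - 2" "t - 2 + 1 = t - 1" using t_ge_3 by (simp_all add: hexagon_s_eq)
  let ?ms = "outside TYPE('k) (t - 2)" and ?ns = "outside TYPE('k) (t - 1)"
  have Z: "Z_matrix TYPE('k) a b c \<alpha> \<beta> \<gamma> = mat (length ?ms) (length ?ns)
      (\<lambda>(i, j). if (monomial3 (?ms ! i) :: (3, 'k) pol) dvd monomial3 (?ns ! j) then 1 else 0)"
    unfolding Z_matrix_def Let_def s ..
  show "dim_row (map_mat of_int (Z_matrix TYPE('k) a b c \<alpha> \<beta> \<gamma>)) = dim_row (weighted_Z TYPE('k) 1 1 (1 :: 'b))"
    "dim_col (map_mat of_int (Z_matrix TYPE('k) a b c \<alpha> \<beta> \<gamma>)) = dim_col (weighted_Z TYPE('k) 1 1 (1 :: 'b))"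
    unfolding Z weighted_Z_def by (simp_all add: length_outside_eq)
  fix r l assume "r < dim_row (weighted_Z TYPE('k) 1 1 (1 :: 'b))" "l < dim_col (weighted_Z TYPE('k) 1 1 (1 :: 'b))"
  then have rl: "r < length ?ms" "l < length ?ns" "r < length ?ns" by (simp_all add: weighted_Z_def length_outside_eq)
  obtain i j k where m: "?ms ! r = (i, j, k)" by (cases "?ms ! r")
  obtain i' j' k' where n: "?ns ! l = (i', j', k')" by (cases "?ns ! l")
  have "i + j + k = t - 2" "i' + j' + k' = t - 1"
    using nth_mem[OF rl(1)] nth_mem[OF rl(2)] unfolding m n set_outside by auto
  then have "i' + j' + k' = i + j + k + 1" using t_ge_3 by linarith
  then have w: "(if i \<le> i' \<and> j \<le> j' \<and> k \<le> k' then 1 else 0) = (weight 1 1 1 (i, j, k) (i', j', k') :: 'b)"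
    by (auto simp: le_less)
  have "map_mat of_int (Z_matrix TYPE('k) a b c \<alpha> \<beta> \<gamma>) $$ (r, l)
      = (if (monomial3 (?ms ! r) :: (3, 'k) pol) dvd monomial3 (?ns ! l) then 1 else 0 :: 'b)"
    using rl unfolding Z by simp
  also have "\<dots> = weight 1 1 1 (?ms ! r) (?ns ! l)"
    unfolding m n monomial3_dvd_iff by (rule w)
  also have "\<dots> = weighted_Z TYPE('k) 1 1 (1 :: 'b) $$ (r, l)"
    using rl by (simp add: weighted_Z_def)
  finally show "map_mat of_int (Z_matrix TYPE('k) a b c \<alpha> \<beta> \<gamma>) $$ (r, l) = weighted_Z TYPE('k) 1 1 (1 :: 'b) $$ (r, l)" .
qed

text \<open>
  The values of a function on \<open>u x m + v y m + w z m\<close>, for monomials \<open>m\<close> of degree \<open>t - 2\<close>.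
\<close>

lemma weighted_Z_mult_index:
  assumes r: "r < length (outside T (t - 1))" and m: "outside T (t - 2) ! r = (i, j, k)"
    and L: "\<And>x. in_I x \<Longrightarrow> L x = 0"
  shows "(weighted_Z T u v w *\<^sub>v vec (length (outside T (t - 1))) (\<lambda>l. L (outside T (t - 1) ! l))) $ r
    = u * L (i + 1, j, k) + v * L (i, j + 1, k) + w * L (i, j, k + 1)"
proof -
  let ?ns = "outside T (t - 1)" and ?S = "{(i + 1, j, k), (i, j + 1, k), (i, j, k + 1)}"
  let ?F = "\<lambda>x. weight u v w (i, j, k) x * L x"
  have "(i, j, k) \<in> set (outside T (t - 2))" using r m nth_mem[of r "outside T (t - 2)"] by (simp add: length_outside_eq)
  then have deg: "i + j + k + 1 = t - 1" using t_ge_3 by (auto simp: set_outside)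
  have "(weighted_Z T u v w *\<^sub>v vec (length ?ns) (\<lambda>l. L (?ns ! l))) $ r = (\<Sum>l<length ?ns. ?F (?ns ! l))"
    using r m by (subst mult_mat_vec_index[OF weighted_Z_carrier]) (simp_all add: weighted_Z_def del: weight.simps)
  also have "\<dots> = (\<Sum>x\<in>set ?ns. ?F x)" by (rule sum_nth_distinct[OF distinct_outside])
  also have "\<dots> = (\<Sum>x\<in>set ?ns \<union> ?S. ?F x)"
  proof (rule sum.mono_neutral_left)
    show "\<forall>x \<in> (set ?ns \<union> ?S) - set ?ns. ?F x = 0"
    proof
      fix x assume "x \<in> (set ?ns \<union> ?S) - set ?ns"
      then have "x \<in> ?S" "x \<notin> set ?ns" by auto
      then have "in_I x" using deg by (auto simp: set_outside)
      then show "?F x = 0" using L by simp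
    qed
  qed auto
  also have "\<dots> = (\<Sum>x\<in>?S. ?F x)" by (rule sum.mono_neutral_right) auto
  finally show ?thesis by (simp add: add.assoc)
qed

text \<open>
  The coefficients of the product of \<open>u x + v y + w z\<close> and a form of degree \<open>t - 2\<close>. The divisors of
  a monomial outside \<open>I\<close> are outside \<open>I\<close>, so that no coefficient of the form is missing.
\<close>

lemma weighted_Z_transpose_mult_index:
  assumes l: "l < length (outside T (t - 1))" and n: "outside T (t - 1) ! l = (i, j, k)"
  shows "(transpose_mat (weighted_Z T u v w) *\<^sub>v vec (length (outside T (t - 1))) (\<lambda>r. p (outside T (t - 2) ! r))) $ l
    = (if 0 < i then u * p (i - 1, j, k) else 0) + (if 0 < j then v * p (i, j - 1, k) else 0)
      + (if 0 < k then w * p (i, j, k - 1) else 0)"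
proof -
  let ?ms = "outside T (t - 2)"
  let ?F = "\<lambda>x. weight u v w x (i, j, k) * p x"
  let ?Si = "if 0 < i then {(i - 1, j, k)} else {}" and ?Sj = "if 0 < j then {(i, j - 1, k)} else {}"
    and ?Sk = "if 0 < k then {(i, j, k - 1)} else {}"
  let ?S = "?Si \<union> ?Sj \<union> ?Sk"
  have mem: "i + j + k = t - 1" "\<not> in_I (i, j, k)" using nth_mem[OF l] unfolding n set_outside by auto
  have sub: "?S \<subseteq> set ?ms"
  proof
    fix x assume "x \<in> ?S"
    then obtain i' j' k' where x: "x = (i', j', k')" "i' \<le> i" "j' \<le> j" "k' \<le> k" "i' + j' + k' + 1 = i + j + k"
      by (auto split: if_splits)
    then have "\<not> in_I x" using mem(2) in_I_mono[of i' j' k' i j k] by auto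
    then show "x \<in> set ?ms" using x mem(1) by (auto simp: set_outside)
  qed
  have disj: "?Si \<inter> ?Sj = {}" "(?Si \<union> ?Sj) \<inter> ?Sk = {}" by auto
  have "(transpose_mat (weighted_Z T u v w) *\<^sub>v vec (length (outside T (t - 1))) (\<lambda>r. p (?ms ! r))) $ l
      = (\<Sum>r<length ?ms. ?F (?ms ! r))"
    using l n by (subst mult_mat_vec_index[OF transpose_carrier_mat[THEN iffD2, OF weighted_Z_carrier]])
      (simp_all add: weighted_Z_def length_outside_eq del: weight.simps)
  also have "\<dots> = (\<Sum>x\<in>set ?ms. ?F x)" by (rule sum_nth_distinct[OF distinct_outside])
  also have "\<dots> = (\<Sum>x\<in>?S. ?F x)"
  proof (rule sum.mono_neutral_right[OF _ sub])
    show "\<forall>x \<in> set ?ms - ?S. ?F x = 0" by (auto split: if_splits)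
  qed simp
  also have "\<dots> = (\<Sum>x\<in>?Si. ?F x) + (\<Sum>x\<in>?Sj. ?F x) + (\<Sum>x\<in>?Sk. ?F x)"
    using disj by (simp add: sum.union_disjoint)
  also have "(\<Sum>x\<in>?Si. ?F x) = (if 0 < i then u * p (i - 1, j, k) else 0)" by simp
  also have "(\<Sum>x\<in>?Sj. ?F x) = (if 0 < j then v * p (i, j - 1, k) else 0)" by simp
  also have "(\<Sum>x\<in>?Sk. ?F x) = (if 0 < k then w * p (i, j, k - 1) else 0)" by simp
  finally show ?thesis .
qed

section \<open>Functionals on the binary forms of degree t - 1\<close>

text \<open>
  The functional on the forms of degree \<open>t - 1\<close> with value \<open>\<mu> p\<close> at \<open>x^p y^(t - 1 - p)\<close>, extended by
  zero to the other degrees.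
\<close>

definition pairing :: "(nat \<Rightarrow> 'k) \<Rightarrow> (2, 'k::field) pol \<Rightarrow> 'k" where
  "pairing \<mu> g = (\<Sum>p<t. \<mu> p * lookup g (xy p (t - 1 - p)))"

definition annihilates :: "(nat \<Rightarrow> 'k::field) \<Rightarrow> bool" where
  "annihilates \<mu> \<longleftrightarrow> (\<forall>f \<in> ideal_J a b c \<alpha> \<beta> \<gamma>. pairing \<mu> f = 0)"

lemma pairing_add: "pairing \<mu> (f + g) = pairing \<mu> f + pairing \<mu> g"
  by (simp add: pairing_def lookup_add distrib_left sum.distrib)

lemma pairing_0 [simp]: "pairing \<mu> 0 = 0"
  by (simp add: pairing_def)

lemma pairing_sum: "pairing \<mu> (sum f S) = (\<Sum>i\<in>S. pairing \<mu> (f i))"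
  by (induction S rule: infinite_finite_induct) (simp_all add: pairing_add)

lemma pairing_const_mult: "pairing \<mu> (single 0 x * f) = x * pairing \<mu> f"
  by (simp add: pairing_def lookup_const_mult sum_distrib_left mult.left_commute)

lemma pairing_homogeneous_0: "f \<in> homogeneous d \<Longrightarrow> d \<noteq> int t - 1 \<Longrightarrow> pairing \<mu> f = 0"
  unfolding pairing_def by (rule sum.neutral) (auto simp: homogeneous2D)

lemma pairing_monomial:
  assumes "i + j + 1 = t"
  shows "pairing \<mu> (Xp ^ i * Yp ^ j) = \<mu> i"
proof -
  have "pairing \<mu> (Xp ^ i * Yp ^ j) = (\<Sum>p<t. if p = i then \<mu> i else 0)"
    unfolding pairing_def XY_single using assms by (intro sum.cong) (auto simp: lookup_single when_def)
  then show ?thesis using assms by simp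
qed

lemma ideal_J_eq: "ideal_J a b c \<alpha> \<beta> \<gamma> = ideal_gen (set gens)"
  by (simp add: ideal_J_def)

lemma XY_product_in_ideal:
  assumes "in_I (i, j, k)"
  shows "Xp ^ i * Yp ^ j * (Xp + Yp) ^ k \<in> (ideal_J a b c \<alpha> \<beta> \<gamma> :: (2, 'k::field) pol set)"
proof -
  have gens: "puncture \<in> ideal_gen (set (gens :: (2, 'k) pol list))" "Xp ^ a \<in> ideal_gen (set (gens :: (2, 'k) pol list))"
      "Yp ^ b \<in> ideal_gen (set (gens :: (2, 'k) pol list))" "(Xp + Yp) ^ c \<in> ideal_gen (set (gens :: (2, 'k) pol list))"
    using ideal_gen_superset[of "set (gens :: (2, 'k) pol list)"] unfolding gens_eq by auto
  consider "a \<le> i" | "b \<le> j" | "c \<le> k" | "\<alpha> \<le> i \<and> \<beta> \<le> j \<and> \<gamma> \<le> k" using assms by (auto simp: in_I_def)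
  then show ?thesis
  proof cases
    case 1
    have "Xp ^ i * Yp ^ j * (Xp + Yp) ^ k = Xp ^ (i - a) * Yp ^ j * (Xp + Yp) ^ k * (Xp ^ a :: (2, 'k) pol)"
      using power_add[of "Xp :: (2, 'k) pol" "i - a" a] 1 by (simp add: ac_simps)
    then show ?thesis unfolding ideal_J_eq using ideal_gen_mult[OF gens(2)] by metis
  next
    case 2
    have "Xp ^ i * Yp ^ j * (Xp + Yp) ^ k = Xp ^ i * Yp ^ (j - b) * (Xp + Yp) ^ k * (Yp ^ b :: (2, 'k) pol)"
      using power_add[of "Yp :: (2, 'k) pol" "j - b" b] 2 by (simp add: ac_simps)
    then show ?thesis unfolding ideal_J_eq using ideal_gen_mult[OF gens(3)] by metis
  next
    case 3
    have "Xp ^ i * Yp ^ j * (Xp + Yp) ^ k = Xp ^ i * Yp ^ j * (Xp + Yp) ^ (k - c) * ((Xp + Yp) ^ c :: (2, 'k) pol)"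
      using power_add[of "Xp + Yp :: (2, 'k) pol" "k - c" c] 3 by (simp add: mult.assoc)
    then show ?thesis unfolding ideal_J_eq using ideal_gen_mult[OF gens(4)] by metis
  next
    case 4
    have "Xp ^ i * Yp ^ j * (Xp + Yp) ^ k
        = Xp ^ (i - \<alpha>) * Yp ^ (j - \<beta>) * (Xp + Yp) ^ (k - \<gamma>) * (puncture :: (2, 'k) pol)"
      using power_add[of "Xp :: (2, 'k) pol" "i - \<alpha>" \<alpha>] power_add[of "Yp :: (2, 'k) pol" "j - \<beta>" \<beta>]
        power_add[of "Xp + Yp :: (2, 'k) pol" "k - \<gamma>" \<gamma>] 4 by (simp add: ac_simps)
    then show ?thesis unfolding ideal_J_eq using ideal_gen_mult[OF gens(1)] by metis
  qed
qed

text \<open>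
  By linearity it suffices to consider the multiples of the generators by monomials. These are
  homogeneous, and only degree \<open>t - 1\<close> matters.
\<close>

lemma annihilatesI:
  fixes \<mu> :: "nat \<Rightarrow> 'k::field"
  assumes "\<And>i j. i + j + (\<alpha> + \<beta> + \<gamma>) + 1 = t \<Longrightarrow> pairing \<mu> (Xp ^ i * Yp ^ j * puncture) = 0"
    and "\<And>i j. i + j + a + 1 = t \<Longrightarrow> pairing \<mu> (Xp ^ i * Yp ^ j * Xp ^ a) = 0"
    and "\<And>i j. i + j + b + 1 = t \<Longrightarrow> pairing \<mu> (Xp ^ i * Yp ^ j * Yp ^ b) = 0"
    and "\<And>i j. i + j + c + 1 = t \<Longrightarrow> pairing \<mu> (Xp ^ i * Yp ^ j * (Xp + Yp) ^ c) = 0"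
  shows "annihilates \<mu>"
proof -
  have mult: "pairing \<mu> (f * g) = 0"
    if g: "g \<in> homogeneous (int e)" and *: "\<And>i j. i + j + e + 1 = t \<Longrightarrow> pairing \<mu> (Xp ^ i * Yp ^ j * g) = 0" for f g e
  proof -
    have "pairing \<mu> (single m x * g) = 0" for m x
    proof -
      obtain i j where m: "m = xy i j" by (rule xy_exhaust)
      have "pairing \<mu> (Xp ^ i * Yp ^ j * g) = 0"
      proof (cases "i + j + e + 1 = t")
        case False
        have h: "Xp ^ i * Yp ^ j * g \<in> homogeneous (int (i + j) + int e)"
          using homogeneous_XY_product[of i j 0 "int (i + j)", where 'k='k] by (intro homogeneous_mult g) simp
        show ?thesis by (rule pairing_homogeneous_0[OF h]) (use False in linarith)
      qed (rule *)
      moreover have "single m x = single 0 x * (Xp ^ i * Yp ^ j)"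
        by (simp add: XY_single mult_single m)
      ultimately show ?thesis by (simp only: mult.assoc pairing_const_mult mult_zero_right)
    qed
    then have "pairing \<mu> ((\<Sum>m\<in>keys f. single m (lookup f m)) * g) = 0"
      by (simp only: sum_distrib_right pairing_sum sum.neutral_const)
    then show ?thesis unfolding poly_eq_sum_single[of f, symmetric] .
  qed
  have hom: "(puncture :: (2, 'k) pol) \<in> homogeneous (int (\<alpha> + \<beta> + \<gamma>))" "(Xp ^ a :: (2, 'k) pol) \<in> homogeneous (int a)"
    "(Yp ^ b :: (2, 'k) pol) \<in> homogeneous (int b)" "((Xp + Yp) ^ c :: (2, 'k) pol) \<in> homogeneous (int c)"
    using homogeneous_XY_product[of \<alpha> \<beta> \<gamma> "int (\<alpha> + \<beta> + \<gamma>)", where 'k='k]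
      homogeneous_XY_product[of 0 0 c "int c", where 'k='k] by (simp_all add: homogeneous_pvar_power)
  show ?thesis
    unfolding annihilates_def ideal_J_eq
  proof
    fix f :: "(2, 'k) pol" assume "f \<in> ideal_gen (set gens)"
    then obtain v where "v \<in> carrier_vec 4" and f: "(gen_row gens *\<^sub>v v) $ 0 = f"
      unfolding mem_ideal_gen_iff length_gens by blast
    show "pairing \<mu> f = 0"
      unfolding f[symmetric] gen_row_gens[OF \<open>v \<in> carrier_vec 4\<close>] pairing_add
      using mult[OF hom(1) assms(1)] mult[OF hom(2) assms(2)] mult[OF hom(3) assms(3)] mult[OF hom(4) assms(4)] by simp
  qed
qed

text \<open>
  For a functional that vanishes on the multiples of \<open>x^a\<close> and \<open>y^b\<close>, the products with N are its
  values on the row polynomials.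
\<close>

lemma pairing_row_poly:
  assumes i: "i < C + M" and \<mu>: "\<And>p. p < t \<Longrightarrow> p < B \<or> a \<le> p \<Longrightarrow> \<mu> p = 0"
  shows "pairing \<mu> (row_poly i) = (N_field *\<^sub>v vec (C + M) (\<lambda>j. \<mu> (a - 1 - j))) $ i"
proof -
  have bij: "bij_betw (\<lambda>j. a - 1 - j) {..<C + M} {B..<a}"
    by (rule bij_betw_byWitness[where f' = "\<lambda>p. a - 1 - p"]) (use t_eq in auto)
  have "pairing \<mu> (row_poly i) = (\<Sum>p\<in>{B..<a}. \<mu> p * lookup (row_poly i) (xy p (t - 1 - p)))"
    unfolding pairing_def using \<mu> t_eq by (intro sum.mono_neutral_right) auto
  also have "\<dots> = (\<Sum>j<C + M. \<mu> (a - 1 - j) * lookup (row_poly i) (xy (a - 1 - j) (t - 1 - (a - 1 - j))))"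
    by (rule sum.reindex_bij_betw[OF bij, symmetric])
  also have "\<dots> = (\<Sum>j<C + M. N_field $$ (i, j) * \<mu> (a - 1 - j))"
  proof (rule sum.cong[OF refl])
    fix j assume "j \<in> {..<C + M}"
    then have j: "j < C + M" by simp
    have "t - 1 - (a - 1 - j) = A + j" using j t_eq by linarith
    then show "\<mu> (a - 1 - j) * lookup (row_poly i) (xy (a - 1 - j) (t - 1 - (a - 1 - j))) = N_field $$ (i, j) * \<mu> (a - 1 - j)"
      unfolding N_field_entry[OF i j] by (simp only: mult.commute)
  qed
  also have "\<dots> = (N_field *\<^sub>v vec (C + M) (\<lambda>j. \<mu> (a - 1 - j))) $ i"
    by (subst mult_mat_vec_index[OF N_field_carrier vec_carrier i]) (intro sum.cong refl, simp)
  finally show ?thesis .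
qed

text \<open>
  A vector in the kernel of N is a functional that vanishes on the multiples of \<open>(x + y)^c\<close> and of the
  puncture; extended by zero to the monomials not belonging to columns, it vanishes on the multiples
  of \<open>x^a\<close> and \<open>y^b\<close>, too.
\<close>

lemma det_N_eq_0_iff: "det (N_field :: 'k::field mat) = 0 \<longleftrightarrow> (\<exists>\<mu> :: nat \<Rightarrow> 'k. annihilates \<mu> \<and> (\<exists>p<t. \<mu> p \<noteq> 0))"
proof
  assume "det (N_field :: 'k mat) = 0"
  then obtain v :: "'k vec" where v: "v \<in> carrier_vec (C + M)" "v \<noteq> 0\<^sub>v (C + M)" "N_field *\<^sub>v v = 0\<^sub>v (C + M)"
    unfolding det_0_iff_vec_prod_zero_field[OF N_field_carrier] by blast
  define \<mu> where "\<mu> = (\<lambda>p. if B \<le> p \<and> p < a then v $ (a - 1 - p) else 0)"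
  have a: "a = B + C + M" using t_eq by linarith
  have \<mu>_index: "\<mu> (a - 1 - j) = v $ j" if "j < C + M" for j
  proof -
    have "a - 1 - (a - 1 - j) = j" "B \<le> a - 1 - j" "a - 1 - j < a" using that a by linarith+
    then show ?thesis unfolding \<mu>_def by simp
  qed
  have vec: "vec (C + M) (\<lambda>j. \<mu> (a - 1 - j)) = v" using v(1) \<mu>_index by (intro eq_vecI) auto
  have \<mu>: "\<mu> p = 0" if "p < B \<or> a \<le> p" for p using that by (auto simp: \<mu>_def)
  have row: "pairing \<mu> (row_poly i) = 0" if "i < C + M" for i
  proof -
    have "pairing \<mu> (row_poly i) = (N_field *\<^sub>v vec (C + M) (\<lambda>j. \<mu> (a - 1 - j))) $ i"
      by (rule pairing_row_poly[OF that]) (rule \<mu>)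
    then show ?thesis unfolding vec v(3) using that by simp
  qed
  have "annihilates \<mu>"
  proof (rule annihilatesI)
    fix i j assume "i + j + (\<alpha> + \<beta> + \<gamma>) + 1 = t"
    then have "i = M - 1 - j" "j < M" using t_eq by linarith+
    then show "pairing \<mu> (Xp ^ i * Yp ^ j * puncture) = 0" using row[of "C + j"] by (simp add: row_poly_bottom)
  next
    fix i j assume "i + j + c + 1 = t"
    then have "i = C - 1 - j" "j < C" using t_eq by linarith+
    then show "pairing \<mu> (Xp ^ i * Yp ^ j * (Xp + Yp) ^ c) = 0" using row[of j] by (simp add: row_poly_top)
  next
    fix i j assume "i + j + a + 1 = t"
    then have "pairing \<mu> (Xp ^ (i + a) * Yp ^ j) = \<mu> (i + a)" by (intro pairing_monomial) simp
    then show "pairing \<mu> (Xp ^ i * Yp ^ j * Xp ^ a) = 0" by (simp add: \<mu> power_add ac_simps)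
  next
    fix i j assume ij: "i + j + b + 1 = t"
    then have "pairing \<mu> (Xp ^ i * Yp ^ (j + b)) = \<mu> i" by (intro pairing_monomial) simp
    moreover have "i < B" using ij t_eq by linarith
    ultimately show "pairing \<mu> (Xp ^ i * Yp ^ j * Yp ^ b) = 0" by (simp add: \<mu> power_add ac_simps)
  qed
  moreover have "\<exists>p<t. \<mu> p \<noteq> 0"
  proof -
    have "\<exists>j<C + M. v $ j \<noteq> 0" using v(1,2) by (auto simp: vec_eq_iff)
    then obtain j where "j < C + M" "\<mu> (a - 1 - j) \<noteq> 0" using \<mu>_index by metis
    moreover have "a - 1 - j < t" using t_eq exponents_less by linarith
    ultimately show ?thesis by blast
  qed
  ultimately show "\<exists>\<mu> :: nat \<Rightarrow> 'k. annihilates \<mu> \<and> (\<exists>p<t. \<mu> p \<noteq> 0)" by blast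
next
  assume "\<exists>\<mu> :: nat \<Rightarrow> 'k. annihilates \<mu> \<and> (\<exists>p<t. \<mu> p \<noteq> 0)"
  then obtain \<mu> :: "nat \<Rightarrow> 'k" and p0 where ann: "annihilates \<mu>" and p0: "p0 < t" "\<mu> p0 \<noteq> 0" by blast
  have \<mu>: "\<mu> p = 0" if p: "p < t" "p < B \<or> a \<le> p" for p
  proof -
    have "in_I (p, t - 1 - p, 0)" using p t_eq by (auto simp: in_I_def)
    from XY_product_in_ideal[OF this, where 'k='k] have "pairing \<mu> (Xp ^ p * Yp ^ (t - 1 - p)) = 0"
      using ann by (simp add: annihilates_def)
    then show ?thesis using pairing_monomial[of p "t - 1 - p" \<mu>] p by simp
  qed
  let ?v = "vec (C + M) (\<lambda>j. \<mu> (a - 1 - j))"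
  have "N_field *\<^sub>v ?v = 0\<^sub>v (C + M)"
  proof (rule eq_vecI)
    fix i assume "i < dim_vec (0\<^sub>v (C + M) :: 'k vec)"
    then have i: "i < C + M" by simp
    have "row_poly i \<in> (ideal_J a b c \<alpha> \<beta> \<gamma> :: (2, 'k) pol set)"
      unfolding row_poly_def by (auto intro!: XY_product_in_ideal simp: in_I_def)
    then have "pairing \<mu> (row_poly i) = 0" using ann by (simp add: annihilates_def)
    moreover have "pairing \<mu> (row_poly i) = (N_field *\<^sub>v ?v) $ i"
      by (rule pairing_row_poly[OF i]) (rule \<mu>)
    ultimately show "(N_field *\<^sub>v ?v) $ i = 0\<^sub>v (C + M) $ i" using i by (simp del: index_mult_mat_vec)
  qed (use N_field_carrier in simp)
  moreover have "?v \<noteq> 0\<^sub>v (C + M)"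
  proof
    assume 0: "?v = 0\<^sub>v (C + M)"
    have p0': "B \<le> p0" "p0 < a" using \<mu>[OF p0(1)] p0(2) by (meson not_less)+
    then have j: "a - 1 - p0 < C + M" "a - 1 - (a - 1 - p0) = p0" using t_eq by linarith+
    have "\<mu> p0 = ?v $ (a - 1 - p0)" using j by simp
    then show False unfolding 0 using p0(2) j by simp
  qed
  ultimately show "det (N_field :: 'k mat) = 0"
    unfolding det_0_iff_vec_prod_zero_field[OF N_field_carrier] using vec_carrier by blast
qed

lemma det_N_nonzero_if_filled:
  assumes "homogeneous (int t - 1) \<subseteq> (ideal_J a b c \<alpha> \<beta> \<gamma> :: (2, 'k::field) pol set)"
  shows "det (N_field :: 'k mat) \<noteq> 0"
proof
  assume "det (N_field :: 'k mat) = 0"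
  then obtain \<mu> :: "nat \<Rightarrow> 'k" and p where ann: "annihilates \<mu>" and p: "p < t" "\<mu> p \<noteq> 0"
    unfolding det_N_eq_0_iff by blast
  have "Xp ^ p * Yp ^ (t - 1 - p) \<in> (homogeneous (int t - 1) :: (2, 'k) pol set)"
    using homogeneous_XY_product[of p "t - 1 - p" 0 "int t - 1", where 'k='k] p(1) by simp
  then have "pairing \<mu> (Xp ^ p * Yp ^ (t - 1 - p)) = 0" using ann assms by (auto simp: annihilates_def)
  then show False using pairing_monomial[of p "t - 1 - p" \<mu>] p by simp
qed

text \<open>
  A functional \<open>\<mu>\<close> on binary forms corresponds to the function \<open>L\<close> on monomials in three variables
  whose value at \<open>x^i y^j z^k\<close> is the value of \<open>\<mu>\<close> at \<open>x^i y^j (- (x + y))^k\<close>. That \<open>L\<close> is in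
  the kernel of Z means that \<open>L\<close> vanishes on the multiples of \<open>x + y + z\<close>, and this relation
  determines \<open>L\<close> by induction on \<open>k\<close> from the monomials without \<open>z\<close>.
\<close>

lemma det_Z_eq_0_iff:
  "det (weighted_Z TYPE('k::field) 1 1 (1 :: 'k)) = 0 \<longleftrightarrow> (\<exists>\<mu> :: nat \<Rightarrow> 'k. annihilates \<mu> \<and> (\<exists>p<t. \<mu> p \<noteq> 0))"
proof
  let ?ns = "outside TYPE('k) (t - 1)" and ?ms = "outside TYPE('k) (t - 2)"
  assume "det (weighted_Z TYPE('k) 1 1 (1 :: 'k)) = 0"
  then obtain v :: "'k vec" where v: "v \<in> carrier_vec (length ?ns)" "v \<noteq> 0\<^sub>v (length ?ns)"
      "weighted_Z TYPE('k) 1 1 1 *\<^sub>v v = 0\<^sub>v (length ?ns)"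
    unfolding det_0_iff_vec_prod_zero_field[OF weighted_Z_carrier] by blast
  define idx where "idx = the_inv_into {..<length ?ns} ((!) ?ns)"
  have idx: "idx (?ns ! l) = l" if "l < length ?ns" for l
    unfolding idx_def using that bij_betw_nth[OF distinct_outside[of "t - 1", where 'a='k] refl refl]
    by (intro the_inv_into_f_f) (auto simp: bij_betw_def)
  define L where "L = (\<lambda>x. if x \<in> set ?ns then v $ idx x else 0)"
  have L_nth: "L (?ns ! l) = v $ l" if "l < length ?ns" for l
    using that idx by (simp add: L_def)
  have vec: "vec (length ?ns) (\<lambda>l. L (?ns ! l)) = v" using v(1) L_nth by (intro eq_vecI) auto
  have L_in_I: "L x = 0" if "in_I x" for x using that by (auto simp: L_def set_outside)
  have rel: "L (i + 1, j, k) + L (i, j + 1, k) + L (i, j, k + 1) = 0" if deg: "i + j + k = t - 2" for i j k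
  proof (cases "in_I (i, j, k)")
    case True
    then have "in_I (i + 1, j, k)" "in_I (i, j + 1, k)" "in_I (i, j, k + 1)" using in_I_mono[OF True] by auto
    then show ?thesis using L_in_I by simp
  next
    case False
    then have "(i, j, k) \<in> set ?ms" using deg by (auto simp: set_outside)
    then obtain r where r: "r < length ?ms" "?ms ! r = (i, j, k)" by (auto simp: in_set_conv_nth)
    then have r': "r < length ?ns" by (simp add: length_outside_eq)
    have "(weighted_Z TYPE('k) 1 1 1 *\<^sub>v vec (length ?ns) (\<lambda>l. L (?ns ! l))) $ r
        = 1 * L (i + 1, j, k) + 1 * L (i, j + 1, k) + 1 * L (i, j, k + 1)"
      by (rule weighted_Z_mult_index[OF r' r(2)]) (rule L_in_I)
    then show ?thesis unfolding vec v(3) using r' by simp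
  qed
  \<comment> \<open>\<open>L\<close> at the monomials without \<open>z\<close>\<close>
  define \<mu> where "\<mu> = (\<lambda>p. L (p, t - 1 - p, 0))"
  have L: "L (i, j, k) = (- 1) ^ k * pairing \<mu> (Xp ^ i * Yp ^ j * (Xp + Yp) ^ k)" if "i + j + k + 1 = t" for i j k
    using that
  proof (induction k arbitrary: i j)
    case 0
    then have "t - 1 - i = j" by simp
    then show ?case using pairing_monomial[of i j \<mu>] 0 by (simp add: \<mu>_def)
  next
    case (Suc k)
    have "L (i, j, k + 1) = - L (i + 1, j, k) - L (i, j + 1, k)"
      using rel[of i j k] Suc.prems by (simp add: algebra_simps eq_neg_iff_add_eq_0)
    also have "\<dots> = - ((- 1) ^ k * (pairing \<mu> (Xp ^ (i + 1) * Yp ^ j * (Xp + Yp) ^ k) + pairing \<mu> (Xp ^ i * Yp ^ (j + 1) * (Xp + Yp) ^ k)))"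
      using Suc.IH[of "i + 1" j] Suc.IH[of i "j + 1"] Suc.prems by (simp add: algebra_simps)
    also have "pairing \<mu> (Xp ^ (i + 1) * Yp ^ j * (Xp + Yp) ^ k) + pairing \<mu> (Xp ^ i * Yp ^ (j + 1) * (Xp + Yp) ^ k)
        = pairing \<mu> (Xp ^ i * Yp ^ j * (Xp + Yp) ^ Suc k)"
      unfolding pairing_add[symmetric] by (simp add: algebra_simps)
    finally show ?case by simp
  qed
  have pairing_in_I: "pairing \<mu> (Xp ^ i * Yp ^ j * (Xp + Yp) ^ k) = 0" if "i + j + k + 1 = t" "in_I (i, j, k)" for i j k
    using L[OF that(1)] L_in_I[OF that(2)] by simp
  have "annihilates \<mu>"
  proof (rule annihilatesI)
    fix i j assume "i + j + (\<alpha> + \<beta> + \<gamma>) + 1 = t"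
    then have "pairing \<mu> (Xp ^ (i + \<alpha>) * Yp ^ (j + \<beta>) * (Xp + Yp) ^ \<gamma>) = 0" by (intro pairing_in_I) (auto simp: in_I_def)
    then show "pairing \<mu> (Xp ^ i * Yp ^ j * puncture) = 0" by (simp add: power_add ac_simps)
  next
    fix i j assume "i + j + c + 1 = t"
    then show "pairing \<mu> (Xp ^ i * Yp ^ j * (Xp + Yp) ^ c) = 0" by (intro pairing_in_I) (auto simp: in_I_def)
  next
    fix i j assume "i + j + a + 1 = t"
    then have "pairing \<mu> (Xp ^ (i + a) * Yp ^ j * (Xp + Yp) ^ 0) = 0" by (intro pairing_in_I) (auto simp: in_I_def)
    then show "pairing \<mu> (Xp ^ i * Yp ^ j * Xp ^ a) = 0" by (simp add: power_add ac_simps)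
  next
    fix i j assume "i + j + b + 1 = t"
    then have "pairing \<mu> (Xp ^ i * Yp ^ (j + b) * (Xp + Yp) ^ 0) = 0" by (intro pairing_in_I) (auto simp: in_I_def)
    then show "pairing \<mu> (Xp ^ i * Yp ^ j * Yp ^ b) = 0" by (simp add: power_add ac_simps)
  qed
  moreover have "\<exists>p<t. \<mu> p \<noteq> 0"
  proof (rule ccontr)
    assume "\<not> (\<exists>p<t. \<mu> p \<noteq> 0)"
    then have pairing: "pairing \<mu> f = 0" for f by (simp add: pairing_def)
    have "v $ l = 0" if l: "l < length ?ns" for l
    proof -
      obtain i j k where n: "?ns ! l = (i, j, k)" by (cases "?ns ! l")
      have "i + j + k + 1 = t" using nth_mem[OF l] t_ge_3 unfolding n set_outside by auto
      then show ?thesis using L_nth[OF l] L pairing unfolding n by simp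
    qed
    then have "v = 0\<^sub>v (length ?ns)" using v(1) by (intro eq_vecI) auto
    then show False using v(2) by blast
  qed
  ultimately show "\<exists>\<mu> :: nat \<Rightarrow> 'k. annihilates \<mu> \<and> (\<exists>p<t. \<mu> p \<noteq> 0)" by blast
next
  let ?ns = "outside TYPE('k) (t - 1)" and ?ms = "outside TYPE('k) (t - 2)"
  assume "\<exists>\<mu> :: nat \<Rightarrow> 'k. annihilates \<mu> \<and> (\<exists>p<t. \<mu> p \<noteq> 0)"
  then obtain \<mu> :: "nat \<Rightarrow> 'k" and p where ann: "annihilates \<mu>" and p: "p < t" "\<mu> p \<noteq> 0" by blast
  define L where "L = (\<lambda>(i, j, k). (- 1) ^ k * pairing \<mu> (Xp ^ i * Yp ^ j * (Xp + Yp) ^ k))"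
  have L_in_I: "L x = 0" if "in_I x" for x
  proof -
    obtain i j k where x: "x = (i, j, k)" by (cases x)
    have "pairing \<mu> (Xp ^ i * Yp ^ j * (Xp + Yp) ^ k) = 0"
      using XY_product_in_ideal[of i j k, where 'k='k] ann that by (simp add: x annihilates_def)
    then show ?thesis by (simp add: L_def x)
  qed
  let ?v = "vec (length ?ns) (\<lambda>l. L (?ns ! l))"
  have "weighted_Z TYPE('k) 1 1 1 *\<^sub>v ?v = 0\<^sub>v (length ?ns)"
  proof (rule eq_vecI)
    fix r assume "r < dim_vec (0\<^sub>v (length ?ns) :: 'k vec)"
    then have r: "r < length ?ns" by simp
    obtain i j k where m: "?ms ! r = (i, j, k)" by (cases "?ms ! r")
    have "L (i + 1, j, k) + L (i, j + 1, k) = (- 1) ^ k *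
        (pairing \<mu> (Xp ^ (i + 1) * Yp ^ j * (Xp + Yp) ^ k) + pairing \<mu> (Xp ^ i * Yp ^ (j + 1) * (Xp + Yp) ^ k))"
      by (simp add: L_def algebra_simps)
    also have "pairing \<mu> (Xp ^ (i + 1) * Yp ^ j * (Xp + Yp) ^ k) + pairing \<mu> (Xp ^ i * Yp ^ (j + 1) * (Xp + Yp) ^ k)
        = pairing \<mu> (Xp ^ i * Yp ^ j * (Xp + Yp) ^ (k + 1))"
      unfolding pairing_add[symmetric] by (simp add: algebra_simps)
    also have "(- 1) ^ k * \<dots> = - L (i, j, k + 1)" by (simp add: L_def)
    finally have "L (i + 1, j, k) + L (i, j + 1, k) = - L (i, j, k + 1)" .
    moreover have "(weighted_Z TYPE('k) 1 1 1 *\<^sub>v ?v) $ r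
        = 1 * L (i + 1, j, k) + 1 * L (i, j + 1, k) + 1 * L (i, j, k + 1)"
      by (rule weighted_Z_mult_index[OF r m]) (rule L_in_I)
    ultimately show "(weighted_Z TYPE('k) 1 1 1 *\<^sub>v ?v) $ r = 0\<^sub>v (length ?ns) $ r"
      using r by (simp del: index_mult_mat_vec)
  qed (use weighted_Z_carrier in \<open>simp add: weighted_Z_def\<close>)
  moreover have "?v \<noteq> 0\<^sub>v (length ?ns)"
  proof
    assume 0: "?v = 0\<^sub>v (length ?ns)"
    have Lp: "L (p, t - 1 - p, 0) = \<mu> p" using pairing_monomial[of p "t - 1 - p" \<mu>] p by (simp add: L_def)
    then have "\<not> in_I (p, t - 1 - p, 0)" using L_in_I p(2) by auto
    then have "(p, t - 1 - p, 0) \<in> set ?ns" using p(1) by (auto simp: set_outside)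
    then obtain l where l: "l < length ?ns" "?ns ! l = (p, t - 1 - p, 0)" by (auto simp: in_set_conv_nth)
    have "?v $ l = \<mu> p" using l Lp by simp
    then show False unfolding 0 using l p(2) by simp
  qed
  ultimately show "det (weighted_Z TYPE('k) 1 1 (1 :: 'k)) = 0"
    unfolding det_0_iff_vec_prod_zero_field[OF weighted_Z_carrier] using vec_carrier by blast
qed

lemma det_Z_eq_0_iff_det_N: "det (weighted_Z TYPE('k::field) 1 1 (1 :: 'k)) = 0 \<longleftrightarrow> det (N_field :: 'k mat) = 0"
  unfolding det_Z_eq_0_iff det_N_eq_0_iff ..

end

section \<open>The weak Lefschetz property\<close>

text \<open>
  Multiplication by a linear form is additive on each component, so that it is injective if and only
  if its kernel is zero; and a coset is zero if and only if its representatives lie in \<open>I\<close>.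
\<close>

lemma weak_Lefschetz_quot_iff:
  fixes I :: "(3, 'k::field) pol set"
  assumes I: "I = ideal_gen G"
  shows "weak_Lefschetz (quot_ring I) (quot_component I) \<longleftrightarrow>
    (\<exists>f \<in> homogeneous 1. \<forall>d. (\<forall>g \<in> homogeneous d. f * g \<in> I \<longrightarrow> g \<in> I) \<or>
       (\<forall>h \<in> homogeneous (d + 1). \<exists>g \<in> homogeneous d. h - f * g \<in> I))"
proof -
  let ?R = "ring_of_type_algebra :: (3, 'k) pol ring"
  interpret R: ring ?R by (rule ring_from_type_algebra)
  have ideal: "ideal I ?R" unfolding I by (rule ideal_ideal_gen)
  interpret ideal I ?R by (rule ideal)
  have minus: "x \<ominus>\<^bsub>?R\<^esub> y = x - y" for x y
  proof -
    have "\<ominus>\<^bsub>?R\<^esub> y = - y" by (rule R.minus_equality) (simp_all add: ring_of_type_algebra_def)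
    then show ?thesis by (simp add: a_minus_def) (simp add: ring_of_type_algebra_def)
  qed
  have coset_eq: "I +>\<^bsub>?R\<^esub> x = I +>\<^bsub>?R\<^esub> y \<longleftrightarrow> x - y \<in> I" for x y
    using R.quotient_eq_iff_same_a_r_cos[OF ideal, of x y] unfolding minus by (simp add: ring_of_type_algebra_def)
  have mult: "(I +>\<^bsub>?R\<^esub> x) \<otimes>\<^bsub>quot_ring I\<^esub> (I +>\<^bsub>?R\<^esub> y) = I +>\<^bsub>?R\<^esub> (x * y)" for x y
    using rcoset_mult_add[of x y] by (simp add: quot_ring_def FactRing_def) (simp add: ring_of_type_algebra_def)
  have memI: "I +>\<^bsub>?R\<^esub> g \<in> quot_component I d" if "g \<in> homogeneous d" for g d
    unfolding quot_component_def using that by (rule imageI)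
  have memE: "\<exists>g \<in> homogeneous d. q = I +>\<^bsub>?R\<^esub> g" if "q \<in> quot_component I d" for q d
    using that unfolding quot_component_def by blast
  have inj: "inj_on (\<lambda>q. (I +>\<^bsub>?R\<^esub> f) \<otimes>\<^bsub>quot_ring I\<^esub> q) (quot_component I d)
      \<longleftrightarrow> (\<forall>g \<in> homogeneous d. f * g \<in> I \<longrightarrow> g \<in> I)" (is "?inj \<longleftrightarrow> ?ker") for f d
  proof
    assume inj: ?inj
    show ?ker
    proof (intro ballI impI)
      fix g assume g: "g \<in> homogeneous d" "f * g \<in> I"
      have eq: "(I +>\<^bsub>?R\<^esub> f) \<otimes>\<^bsub>quot_ring I\<^esub> (I +>\<^bsub>?R\<^esub> g) = (I +>\<^bsub>?R\<^esub> f) \<otimes>\<^bsub>quot_ring I\<^esub> (I +>\<^bsub>?R\<^esub> 0)"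
        unfolding mult coset_eq using g(2) by simp
      have "I +>\<^bsub>?R\<^esub> g \<in> quot_component I d" "I +>\<^bsub>?R\<^esub> 0 \<in> quot_component I d"
        by (intro memI g(1) homogeneous_0)+
      then have "I +>\<^bsub>?R\<^esub> g = I +>\<^bsub>?R\<^esub> 0"
        using eq by (rule inj_onD[OF inj, rotated])
      then show "g \<in> I" unfolding coset_eq by simp
    qed
  next
    assume ker: ?ker
    show ?inj
    proof (rule inj_onI)
      fix q q' assume "q \<in> quot_component I d" "q' \<in> quot_component I d"
        and eq: "(I +>\<^bsub>?R\<^esub> f) \<otimes>\<^bsub>quot_ring I\<^esub> q = (I +>\<^bsub>?R\<^esub> f) \<otimes>\<^bsub>quot_ring I\<^esub> q'"
      then obtain g g' where g: "q = I +>\<^bsub>?R\<^esub> g" "q' = I +>\<^bsub>?R\<^esub> g'" "g \<in> homogeneous d" "g' \<in> homogeneous d"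
        using memE by meson
      have "f * (g - g') \<in> I" using eq unfolding g(1,2) mult coset_eq by (simp add: right_diff_distrib)
      then have "g - g' \<in> I" using ker g(3,4) by blast
      then show "q = q'" unfolding g(1,2) coset_eq .
    qed
  qed
  have surj: "(\<lambda>q. (I +>\<^bsub>?R\<^esub> f) \<otimes>\<^bsub>quot_ring I\<^esub> q) ` quot_component I d = quot_component I (d + 1)
      \<longleftrightarrow> (\<forall>h \<in> homogeneous (d + 1). \<exists>g \<in> homogeneous d. h - f * g \<in> I)" (is "?surj \<longleftrightarrow> ?onto")
    if f: "f \<in> homogeneous 1" for f d
  proof
    assume surj: ?surj
    show ?onto
    proof
      fix h :: "(3, 'k) pol" assume "h \<in> homogeneous (d + 1)"
      then have "I +>\<^bsub>?R\<^esub> h \<in> quot_component I (d + 1)" by (rule memI)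
      then obtain q where q: "q \<in> quot_component I d" "I +>\<^bsub>?R\<^esub> h = (I +>\<^bsub>?R\<^esub> f) \<otimes>\<^bsub>quot_ring I\<^esub> q"
        unfolding surj[symmetric] by blast
      obtain g where "g \<in> homogeneous d" "q = I +>\<^bsub>?R\<^esub> g" using memE[OF q(1)] by blast
      with q(2) have "g \<in> homogeneous d" "I +>\<^bsub>?R\<^esub> h = (I +>\<^bsub>?R\<^esub> f) \<otimes>\<^bsub>quot_ring I\<^esub> (I +>\<^bsub>?R\<^esub> g)"
        by simp_all
      then show "\<exists>g \<in> homogeneous d. h - f * g \<in> I" unfolding mult coset_eq by blast
    qed
  next
    assume onto: ?onto
    show ?surj
    proof (intro equalityI subsetI)
      fix q assume "q \<in> (\<lambda>q. (I +>\<^bsub>?R\<^esub> f) \<otimes>\<^bsub>quot_ring I\<^esub> q) ` quot_component I d"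
      then obtain q' where q': "q' \<in> quot_component I d" "q = (I +>\<^bsub>?R\<^esub> f) \<otimes>\<^bsub>quot_ring I\<^esub> q'" by blast
      obtain g where g: "g \<in> homogeneous d" "q' = I +>\<^bsub>?R\<^esub> g" using memE[OF q'(1)] by blast
      have "f * g \<in> homogeneous (d + 1)" by (rule homogeneous_multI[OF f g(1)]) simp
      then show "q \<in> quot_component I (d + 1)" unfolding q'(2) g(2) mult by (rule memI)
    next
      fix q assume "q \<in> quot_component I (d + 1)"
      then obtain h where h: "h \<in> homogeneous (d + 1)" "q = I +>\<^bsub>?R\<^esub> h" using memE by blast
      then obtain g where g: "g \<in> homogeneous d" "h - f * g \<in> I" using onto by blast
      have "q = (I +>\<^bsub>?R\<^esub> f) \<otimes>\<^bsub>quot_ring I\<^esub> (I +>\<^bsub>?R\<^esub> g)"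
        unfolding h(2) mult coset_eq by (rule g(2))
      then show "q \<in> (\<lambda>q. (I +>\<^bsub>?R\<^esub> f) \<otimes>\<^bsub>quot_ring I\<^esub> q) ` quot_component I d"
        by (rule image_eqI) (rule memI[OF g(1)])
    qed
  qed
  have comp1: "(\<exists>l \<in> quot_component I 1. P l) \<longleftrightarrow> (\<exists>f \<in> homogeneous 1. P (I +>\<^bsub>?R\<^esub> f))" for P
    unfolding quot_component_def by blast
  show ?thesis
    unfolding weak_Lefschetz_def comp1 inj by (intro bex_cong refl) (simp only: surj)
qed

lemma lookup_pvar3_mult:
  "lookup (pvar 0 * f) (xyz (i, j, k)) = (if 0 < i then lookup f (xyz (i - 1, j, k)) else 0)"
  "lookup (pvar 1 * f) (xyz (i, j, k)) = (if 0 < j then lookup f (xyz (i, j - 1, k)) else 0)"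
  "lookup (pvar 2 * f) (xyz (i, j, k)) = (if 0 < k then lookup f (xyz (i, j, k - 1)) else 0)"
proof -
  have gen: "lookup (single (xyz (p, q, r)) 1 * f) (xyz (i, j, k))
      = (if p \<le> i \<and> q \<le> j \<and> r \<le> k then lookup f (xyz (i - p, j - q, k - r)) else 0)" for p q r
  proof (cases "p \<le> i \<and> q \<le> j \<and> r \<le> k")
    case True
    then show ?thesis
      using lookup_single_mult[of "xyz (p, q, r)" 1 f "xyz (i - p, j - q, k - r)"] by (simp add: xyz_add)
  next
    case False
    have "xyz (i, j, k) \<noteq> xyz (p, q, r) + n" for n
      using False by (cases n rule: xyz_exhaust) (auto simp: xyz_add)
    then have "lookup (single (xyz (p, q, r)) 1 * f) (xyz (i, j, k)) = 0"
      by (rule lookup_single_mult_eq_0)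
    then show ?thesis using False by auto
  qed
  have pv: "pvar 0 = single (xyz (1, 0, 0)) (1 :: 'a)" "pvar 1 = single (xyz (0, 1, 0)) (1 :: 'a)"
    "pvar 2 = single (xyz (0, 0, 1)) (1 :: 'a)" by (simp_all add: pvar_def xyz_def)
  show "lookup (pvar 0 * f) (xyz (i, j, k)) = (if 0 < i then lookup f (xyz (i - 1, j, k)) else 0)"
    "lookup (pvar 1 * f) (xyz (i, j, k)) = (if 0 < j then lookup f (xyz (i, j - 1, k)) else 0)"
    "lookup (pvar 2 * f) (xyz (i, j, k)) = (if 0 < k then lookup f (xyz (i, j, k - 1)) else 0)"
    unfolding pv gen by auto
qed

definition linear_form :: "'k \<Rightarrow> 'k \<Rightarrow> 'k \<Rightarrow> (3, 'k::field) pol" where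
  "linear_form u v w = single 0 u * pvar 0 + single 0 v * pvar 1 + single 0 w * pvar 2"

lemma homogeneous_const_pvar: "single 0 u * pvar x \<in> (homogeneous 1 :: ('v, 'k::comm_ring_1) pol set)"
  by (simp add: pvar_def mult_single homogeneous_single)

lemma linear_form_homogeneous: "linear_form u v w \<in> homogeneous 1"
  unfolding linear_form_def by (intro homogeneous_add homogeneous_const_pvar)

lemma lookup_linear_form_mult:
  "lookup (linear_form u v w * g) (xyz (i, j, k))
    = (if 0 < i then u * lookup g (xyz (i - 1, j, k)) else 0)
      + (if 0 < j then v * lookup g (xyz (i, j - 1, k)) else 0)
      + (if 0 < k then w * lookup g (xyz (i, j, k - 1)) else 0)"
  by (simp add: linear_form_def distrib_right mult.assoc lookup_add lookup_const_mult lookup_pvar3_mult)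

lemma homogeneous_1_linear_form:
  fixes f :: "(3, 'k::field) pol"
  assumes f: "f \<in> homogeneous 1"
  obtains u v w where "f = linear_form u v w"
proof -
  obtain p where p: "\<And>x. p x \<in> homogeneous 0" and eq: "f = (\<Sum>x\<in>UNIV. pvar x * p x)"
    using homogeneous_split[OF f] by auto
  define r where "r x = lookup (p x) 0" for x
  have pr: "p x = single 0 (r x)" for x
  proof (rule poly_mapping_eqI)
    fix m :: "3 \<Rightarrow>\<^sub>0 nat"
    have "m = 0" if "exp_degree m = 0"
      using that by (intro poly_mapping_eqI) (simp add: exp_degree_eq_sum)
    then show "lookup (p x) m = lookup (single 0 (r x)) m"
      unfolding r_def using homogeneousD[OF p, of x m] by (cases "lookup (p x) m = 0") (auto simp: lookup_single when_def)
  qed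
  have "f = linear_form (r 0) (r 1) (r 2)"
    unfolding eq sum_UNIV_3 pr linear_form_def by (simp only: mult.commute)
  then show ?thesis by (rule that)
qed

context punctured_hexagon
begin

abbreviation mono_ideal :: "(3, 'k::field) pol set" where "mono_ideal \<equiv> ideal_I a b c \<alpha> \<beta> \<gamma>"

lemma mono_ideal_mult: "f \<in> mono_ideal \<Longrightarrow> h * f \<in> mono_ideal"
  by (simp add: ideal_I_def ideal_gen_mult)

definition coords :: "(3, 'k::field) pol \<Rightarrow> 'k vec" where
  "coords g = vec (length (outside TYPE('k) (t - 1))) (\<lambda>r. lookup g (xyz (outside TYPE('k) (t - 2) ! r)))"

lemma mem_mono_ideal_homogeneous:
  fixes g :: "(3, 'k::field) pol"
  assumes g: "g \<in> homogeneous (int d)"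
  shows "g \<in> mono_ideal \<longleftrightarrow> (\<forall>l < length (outside TYPE('k) d). lookup g (xyz (outside TYPE('k) d ! l)) = 0)"
proof -
  have "g \<in> mono_ideal \<longleftrightarrow> (\<forall>x \<in> set (outside TYPE('k) d). lookup g (xyz x) = 0)"
  proof
    assume "g \<in> mono_ideal"
    then show "\<forall>x \<in> set (outside TYPE('k) d). lookup g (xyz x) = 0"
      unfolding mem_ideal_I_iff set_outside by blast
  next
    assume *: "\<forall>x \<in> set (outside TYPE('k) d). lookup g (xyz x) = 0"
    show "g \<in> mono_ideal"
      unfolding mem_ideal_I_iff
    proof (intro allI impI)
      fix m assume m: "lookup g (xyz m) \<noteq> 0"
      obtain i j k where mijk: "m = (i, j, k)" by (cases m)
      have "i + j + k = d" using homogeneousD[OF g m] unfolding mijk by simp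
      then show "in_I m" using * m unfolding mijk set_outside by blast
    qed
  qed
  then show ?thesis by (simp add: all_set_conv_all_nth)
qed

lemma weighted_Z_coords:
  fixes g :: "(3, 'k::field) pol"
  assumes l: "l < length (outside TYPE('k) (t - 1))"
  shows "(transpose_mat (weighted_Z TYPE('k) u v w) *\<^sub>v coords g) $ l
    = lookup (linear_form u v w * g) (xyz (outside TYPE('k) (t - 1) ! l))"
proof -
  obtain i j k where n: "outside TYPE('k) (t - 1) ! l = (i, j, k)" by (cases "outside TYPE('k) (t - 1) ! l")
  show ?thesis
    unfolding coords_def weighted_Z_transpose_mult_index[OF l n, where p = "\<lambda>x. lookup g (xyz x)"] n
      lookup_linear_form_mult ..
qed

lemma coords_surj:
  fixes p :: "'k::field vec"
  assumes p: "p \<in> carrier_vec (length (outside TYPE('k) (t - 1)))"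
  obtains g where "g \<in> homogeneous (int (t - 2))" "coords g = p"
proof
  let ?ms = "outside TYPE('k) (t - 2)"
  let ?g = "\<Sum>r<length ?ms. single (xyz (?ms ! r)) (p $ r)"
  show "?g \<in> homogeneous (int (t - 2))"
  proof (rule homogeneous_sum)
    fix r assume "r \<in> {..<length ?ms}"
    then have "?ms ! r \<in> set ?ms" by simp
    then have "exp_degree (xyz (?ms ! r)) = t - 2" unfolding set_outside by auto
    then show "single (xyz (?ms ! r)) (p $ r) \<in> homogeneous (int (t - 2))"
      by (intro homogeneous_single) simp
  qed
  have "lookup ?g (xyz (?ms ! r)) = p $ r" if r: "r < length ?ms" for r
  proof -
    have "lookup ?g (xyz (?ms ! r)) = (\<Sum>q<length ?ms. if q = r then p $ r else 0)"
      unfolding lookup_sum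
      by (rule sum.cong) (use r nth_eq_iff_index_eq[OF distinct_outside[of "t - 2", where 'a='k]] in \<open>auto simp: lookup_single when_def\<close>)
    then show ?thesis using r by simp
  qed
  then show "coords ?g = p" using p by (intro eq_vecI) (auto simp: coords_def length_outside_eq)
qed

text \<open>
  In the bases of monomials outside \<open>I\<close>, multiplication by the linear form is the transpose of the
  weighted Z, which is a square matrix.
\<close>

lemma multiplication_at_s:
  fixes u v w :: "'k::field"
  shows "(\<forall>g \<in> homogeneous (int t - 2). linear_form u v w * g \<in> mono_ideal \<longrightarrow> g \<in> mono_ideal) \<longleftrightarrow> det (weighted_Z TYPE('k) u v w) \<noteq> 0"
    and "(\<forall>h \<in> homogeneous (int t - 1). \<exists>g \<in> homogeneous (int t - 2). h - linear_form u v w * g \<in> mono_ideal)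
      \<longleftrightarrow> det (weighted_Z TYPE('k) u v w) \<noteq> 0"
proof -
  let ?n = "length (outside TYPE('k) (t - 1))" and ?ns = "outside TYPE('k) (t - 1)" and ?ms = "outside TYPE('k) (t - 2)"
  let ?Z = "weighted_Z TYPE('k) u v w" and ?l = "linear_form u v w"
  have d: "int t - 2 = int (t - 2)" "int t - 1 = int (t - 1)" and deg: "int (t - 1) = 1 + int (t - 2)"
    using t_ge_3 by linarith+
  have Zt: "transpose_mat ?Z \<in> carrier_mat ?n ?n" unfolding transpose_carrier_mat by (rule weighted_Z_carrier)
  have dt: "det (transpose_mat ?Z) = det ?Z" by (rule det_transpose[OF weighted_Z_carrier])
  have hom: "?l * g \<in> homogeneous (int (t - 1))" if "g \<in> homogeneous (int (t - 2))" for g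
    by (rule homogeneous_multI[OF linear_form_homogeneous that deg])
  have mem2: "g \<in> mono_ideal \<longleftrightarrow> coords g = 0\<^sub>v ?n" if "g \<in> homogeneous (int (t - 2))" for g :: "(3, 'k) pol"
    unfolding mem_mono_ideal_homogeneous[OF that] by (auto simp: coords_def vec_eq_iff length_outside_eq)
  have mem1: "?l * g \<in> mono_ideal \<longleftrightarrow> transpose_mat ?Z *\<^sub>v coords g = 0\<^sub>v ?n" if g: "g \<in> homogeneous (int (t - 2))" for g
  proof -
    have "?l * g \<in> mono_ideal \<longleftrightarrow> (\<forall>l<?n. (transpose_mat ?Z *\<^sub>v coords g) $ l = 0)"
      unfolding mem_mono_ideal_homogeneous[OF hom[OF g]] using weighted_Z_coords[of _ u v w g] by (simp del: index_mult_mat_vec)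
    also have "\<dots> \<longleftrightarrow> transpose_mat ?Z *\<^sub>v coords g = 0\<^sub>v ?n"
      using carrier_matD[OF Zt] by (auto simp: vec_eq_iff simp del: index_mult_mat_vec)
    finally show ?thesis .
  qed
  have coords_c: "coords g \<in> carrier_vec ?n" for g :: "(3, 'k) pol" by (simp add: coords_def)
  show "(\<forall>g \<in> homogeneous (int t - 2). ?l * g \<in> mono_ideal \<longrightarrow> g \<in> mono_ideal) \<longleftrightarrow> det ?Z \<noteq> 0" (is "?inj \<longleftrightarrow> _")
  proof
    assume inj: ?inj
    show "det ?Z \<noteq> 0"
    proof
      assume "det ?Z = 0"
      then obtain p where p: "p \<in> carrier_vec ?n" "p \<noteq> 0\<^sub>v ?n" "transpose_mat ?Z *\<^sub>v p = 0\<^sub>v ?n"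
        using det_0_iff_vec_prod_zero_field[OF Zt] dt by auto
      obtain g where g: "g \<in> homogeneous (int (t - 2))" "coords g = p" by (rule coords_surj[OF p(1)])
      then have "?l * g \<in> mono_ideal" using mem1[OF g(1)] p(3) by simp
      then have "g \<in> mono_ideal" using inj g(1) unfolding d(1) by blast
      then show False using mem2[OF g(1)] g(2) p(2) by simp
    qed
  next
    assume det: "det ?Z \<noteq> 0"
    show ?inj
    proof (intro ballI impI)
      fix g :: "(3, 'k) pol" assume g: "g \<in> homogeneous (int t - 2)" "?l * g \<in> mono_ideal"
      note g1 = g(1)[unfolded d(1)]
      have "transpose_mat ?Z *\<^sub>v coords g = 0\<^sub>v ?n" using mem1[OF g1] g(2) by blast
      then have "coords g = 0\<^sub>v ?n" using det_0_iff_vec_prod_zero_field[OF Zt] dt det coords_c[of g] by metis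
      then show "g \<in> mono_ideal" using mem2[OF g1] by blast
    qed
  qed
  show "(\<forall>h \<in> homogeneous (int t - 1). \<exists>g \<in> homogeneous (int t - 2). h - ?l * g \<in> mono_ideal) \<longleftrightarrow> det ?Z \<noteq> 0" (is "?onto \<longleftrightarrow> _")
  proof
    assume onto: ?onto
    show "det ?Z \<noteq> 0"
    proof
      assume "det ?Z = 0"
      then obtain q where q: "q \<in> carrier_vec ?n" "q \<noteq> 0\<^sub>v ?n" "?Z *\<^sub>v q = 0\<^sub>v ?n"
        using det_0_iff_vec_prod_zero_field[OF weighted_Z_carrier] by blast
      then obtain l where l: "l < ?n" "q $ l \<noteq> 0" by (auto simp: vec_eq_iff)
      let ?h = "single (xyz (?ns ! l)) 1 :: (3, 'k) pol"
      have "?ns ! l \<in> set ?ns" using l by simp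
      then have "exp_degree (xyz (?ns ! l)) = t - 1" unfolding set_outside by auto
      then have h: "?h \<in> homogeneous (int (t - 1))" by (intro homogeneous_single) simp
      then obtain g where g: "g \<in> homogeneous (int (t - 2))" "?h - ?l * g \<in> mono_ideal"
        using onto unfolding d(1,2) by blast
      have hg: "?h - ?l * g \<in> homogeneous (int (t - 1))" using h hom[OF g(1)] by blast
      have coeff: "(transpose_mat ?Z *\<^sub>v coords g) $ k = (if k = l then 1 else 0)" if k: "k < ?n" for k
      proof -
        have "lookup (?h - ?l * g) (xyz (?ns ! k)) = 0"
          using g(2) k unfolding mem_mono_ideal_homogeneous[OF hg] by blast
        then have "(transpose_mat ?Z *\<^sub>v coords g) $ k = lookup ?h (xyz (?ns ! k))"
          unfolding weighted_Z_coords[OF k] lookup_minus by simp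
        then show ?thesis
          using k l nth_eq_iff_index_eq[OF distinct_outside[of "t - 1", where 'a='k]] by (auto simp: lookup_single when_def)
      qed
      have "(?Z *\<^sub>v q) \<bullet> coords g = 0" unfolding q(3) using coords_c[of g] by simp
      moreover have "(transpose_mat ?Z *\<^sub>v coords g) \<bullet> q = coords g \<bullet> (?Z *\<^sub>v q)"
        by (rule transpose_vec_mult_scalar[OF weighted_Z_carrier q(1) coords_c])
      moreover have "coords g \<bullet> (?Z *\<^sub>v q) = (?Z *\<^sub>v q) \<bullet> coords g"
        using coords_c[of g] q(3) by (simp add: comm_scalar_prod[of _ ?n])
      moreover have "(transpose_mat ?Z *\<^sub>v coords g) \<bullet> q = (\<Sum>k<?n. (if k = l then 1 else 0) * q $ k)"
        unfolding scalar_prod_def carrier_vecD[OF q(1)] lessThan_atLeast0[symmetric]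
        by (rule sum.cong) (simp_all only: coeff lessThan_iff)
      moreover have "(\<Sum>k<?n. (if k = l then 1 else 0) * q $ k) = q $ l"
        using l(1) by (simp add: if_distrib[of "\<lambda>x. x * _"] cong: if_cong)
      ultimately show False using l(2) by simp
    qed
  next
    assume det: "det ?Z \<noteq> 0"
    then have "det (transpose_mat ?Z) \<noteq> 0" unfolding dt .
    from det_non_zero_imp_unit[OF Zt this, of "()"]
    obtain Z' where Z': "Z' \<in> carrier_mat ?n ?n" "transpose_mat ?Z * Z' = 1\<^sub>m ?n"
      unfolding Units_def ring_mat_def by auto
    show ?onto
    proof
      fix h :: "(3, 'k) pol" assume h: "h \<in> homogeneous (int t - 1)"
      let ?r = "vec ?n (\<lambda>l. lookup h (xyz (?ns ! l)))"
      obtain g where g: "g \<in> homogeneous (int (t - 2))" "coords g = Z' *\<^sub>v ?r"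
        by (rule coords_surj[OF mult_mat_vec_carrier[OF Z'(1) vec_carrier]])
      have Zr: "transpose_mat ?Z *\<^sub>v coords g = ?r"
        unfolding g(2) using assoc_mult_mat_vec[OF Zt Z'(1), of ?r] Z'(2) by simp
      have hg: "h - ?l * g \<in> homogeneous (int (t - 1))" using h[unfolded d(2)] hom[OF g(1)] by blast
      have "h - ?l * g \<in> mono_ideal"
        unfolding mem_mono_ideal_homogeneous[OF hg]
      proof (intro allI impI)
        fix l assume l: "l < ?n"
        show "lookup (h - ?l * g) (xyz (?ns ! l)) = 0"
          unfolding lookup_minus weighted_Z_coords[OF l, symmetric] Zr using l by simp
      qed
      then show "\<exists>g \<in> homogeneous (int t - 2). h - ?l * g \<in> mono_ideal" using g(1) unfolding d(1) by blast
    qed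
  qed
qed

text \<open>
  Substituting \<open>u x\<close>, \<open>v y\<close>, \<open>w z\<close> for the variables transforms \<open>x + y + z\<close> into the given form and
  multiplies each monomial by a monomial \<open>\<chi>\<close> in \<open>u\<close>, \<open>v\<close>, \<open>w\<close>. For non-zero weights this maps a
  kernel vector to a kernel vector. Weights may be zero, therefore the argument is carried out over
  \<open>K[T]\<close> with the non-zero weights \<open>u + T\<close>, \<open>v + T\<close>, \<open>w + T\<close>, and \<open>T\<close> is set to zero in the
  determinant.
\<close>

lemma det_weighted_Z_eq_0:
  assumes det: "det (weighted_Z TYPE('k::field) 1 1 (1 :: 'k)) = 0"
  shows "det (weighted_Z TYPE('k) u v w) = (0 :: 'k)"
proof -
  let ?n = "length (outside TYPE('k) (t - 1))" and ?ns = "outside TYPE('k) (t - 1)" and ?ms = "outside TYPE('k) (t - 2)"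
  define U V W :: "'k poly" where "U = [:u, 1:]" and "V = [:v, 1:]" and "W = [:w, 1:]"
  have nz: "U \<noteq> 0" "V \<noteq> 0" "W \<noteq> 0" by (simp_all add: U_def V_def W_def)
  define \<chi> where "\<chi> = (\<lambda>(i, j, k). U ^ i * V ^ j * W ^ k)"
  have \<chi>_nz: "\<chi> x \<noteq> 0" for x using nz by (cases x) (simp add: \<chi>_def)
  have scale: "\<chi> x * weight U V W x y = [:weight 1 1 1 x y:] * \<chi> y" for x y
    by (cases x; cases y) (auto simp: \<chi>_def ac_simps)
  have Zt: "transpose_mat (weighted_Z TYPE('k) 1 1 (1 :: 'k)) \<in> carrier_mat ?n ?n" unfolding transpose_carrier_mat by (rule weighted_Z_carrier)
  have "det (transpose_mat (weighted_Z TYPE('k) 1 1 (1 :: 'k))) = 0"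
    unfolding det_transpose[OF weighted_Z_carrier] by (rule det)
  then obtain p :: "'k vec" where p: "p \<in> carrier_vec ?n" "p \<noteq> 0\<^sub>v ?n" "transpose_mat (weighted_Z TYPE('k) 1 1 1) *\<^sub>v p = 0\<^sub>v ?n"
    unfolding det_0_iff_vec_prod_zero_field[OF Zt] by blast
  have p_sum: "(\<Sum>r<?n. weight 1 1 1 (?ms ! r) (?ns ! l) * p $ r) = 0" if l: "l < ?n" for l
  proof -
    have "(transpose_mat (weighted_Z TYPE('k) 1 1 1) *\<^sub>v p) $ l = (\<Sum>r<?n. weight 1 1 1 (?ms ! r) (?ns ! l) * p $ r)"
      unfolding mult_mat_vec_index[OF Zt p(1) l] using l by (intro sum.cong) (simp_all add: weighted_Z_def del: weight.simps)
    then show ?thesis unfolding p(3) using l by simp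
  qed
  let ?q = "vec ?n (\<lambda>r. [:p $ r:] * \<chi> (?ms ! r))"
  have Zt': "transpose_mat (weighted_Z TYPE('k) U V W) \<in> carrier_mat ?n ?n" unfolding transpose_carrier_mat by (rule weighted_Z_carrier)
  have "transpose_mat (weighted_Z TYPE('k) U V W) *\<^sub>v ?q = 0\<^sub>v ?n"
  proof (rule eq_vecI)
    fix l assume "l < dim_vec (0\<^sub>v ?n :: 'k poly vec)"
    then have l: "l < ?n" by simp
    have "(transpose_mat (weighted_Z TYPE('k) U V W) *\<^sub>v ?q) $ l
        = (\<Sum>r<?n. [:p $ r:] * (\<chi> (?ms ! r) * weight U V W (?ms ! r) (?ns ! l)))"
      unfolding mult_mat_vec_index[OF Zt' vec_carrier l] using l
      by (intro sum.cong) (simp_all add: weighted_Z_def ac_simps del: weight.simps mult_pCons_left mult_pCons_right)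
    also have "\<dots> = (\<Sum>r<?n. [:weight 1 1 1 (?ms ! r) (?ns ! l) * p $ r:] * \<chi> (?ns ! l))"
      unfolding scale by (intro sum.cong) (simp_all add: ac_simps del: weight.simps)
    also have "\<dots> = [:\<Sum>r<?n. weight 1 1 1 (?ms ! r) (?ns ! l) * p $ r:] * \<chi> (?ns ! l)"
      unfolding sum_distrib_right[symmetric] by (simp only: sum_to_poly)
    also have "\<dots> = 0" unfolding p_sum[OF l] by simp
    finally show "(transpose_mat (weighted_Z TYPE('k) U V W) *\<^sub>v ?q) $ l = 0\<^sub>v ?n $ l" using l by simp
  qed (use carrier_matD[OF Zt'] in simp)
  moreover have "?q \<noteq> 0\<^sub>v ?n"
  proof
    assume 0: "?q = 0\<^sub>v ?n"
    obtain r where r: "r < ?n" "p $ r \<noteq> 0" using p(1,2) by (auto simp: vec_eq_iff)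
    have "?q $ r = 0" unfolding 0 using r by simp
    then show False using r \<chi>_nz[of "?ms ! r"] by simp
  qed
  ultimately have "det (transpose_mat (weighted_Z TYPE('k) U V W)) = 0"
    unfolding det_0_iff_vec_prod_zero[OF Zt'] using vec_carrier by blast
  then have det0: "det (weighted_Z TYPE('k) U V W) = 0" unfolding det_transpose[OF weighted_Z_carrier] .
  interpret ev: comm_ring_hom "\<lambda>p :: 'k poly. poly p 0"
    by unfold_locales simp_all
  have w: "poly (weight U V W x y) 0 = weight u v w x y" for x y
    by (cases x) (simp add: U_def V_def W_def)
  have "map_mat (\<lambda>p. poly p 0) (weighted_Z TYPE('k) U V W) = weighted_Z TYPE('k) u v w"
    by (rule eq_matI) (simp_all add: weighted_Z_def w del: weight.simps)
  then show ?thesis using ev.hom_det[of "weighted_Z TYPE('k) U V W"] det0 by simp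
qed

text \<open>
  If all three multiples are in \<open>I\<close>, then, for example for \<open>i < \<alpha>\<close>, one has \<open>j = b - 1\<close>, \<open>k = c - 1\<close>
  and \<open>i \<ge> \<alpha> - 1\<close>, and \<open>\<alpha> + b + c = t + A + M + \<alpha> > t\<close>.
\<close>

lemma socle_degree:
  assumes "\<not> in_I (i, j, k)" "i + j + k < t - 2"
  shows "\<not> in_I (i + 1, j, k) \<or> \<not> in_I (i, j + 1, k) \<or> \<not> in_I (i, j, k + 1)"
proof (rule ccontr)
  assume "\<not> ?thesis"
  then have "in_I (i + 1, j, k)" "in_I (i, j + 1, k)" "in_I (i, j, k + 1)" by blast+
  then show False using assms t_eq exponents_less t_ge_3 unfolding in_I_def prod.case by linarith
qed

text \<open>
  If \<open>f g\<close> is zero in \<open>R/I\<close>, then so are the products of \<open>f\<close> with \<open>x g\<close>, \<open>y g\<close>, \<open>z g\<close>, hence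
  \<open>g\<close> is in the socle of \<open>R/I\<close>, which is zero in degree \<open>d\<close>.
\<close>

lemma injective_below:
  fixes f :: "(3, 'k::field) pol"
  assumes inj: "\<forall>g \<in> homogeneous (d + 1). f * g \<in> mono_ideal \<longrightarrow> g \<in> mono_ideal" and d: "d < int t - 2"
  shows "\<forall>g \<in> homogeneous d. f * g \<in> mono_ideal \<longrightarrow> g \<in> mono_ideal"
proof (intro ballI impI)
  fix g assume g: "g \<in> homogeneous d" "f * g \<in> mono_ideal"
  have mult: "pvar x * g \<in> mono_ideal" for x
  proof -
    have "pvar x * g \<in> homogeneous (d + 1)" by (rule homogeneous_multI[OF homogeneous_pvar g(1)]) simp
    moreover have "f * (pvar x * g) \<in> mono_ideal" using mono_ideal_mult[OF g(2), of "pvar x"] by (simp add: mult.left_commute)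
    ultimately show ?thesis using inj by blast
  qed
  show "g \<in> mono_ideal"
    unfolding mem_ideal_I_iff
  proof (intro allI impI)
    fix m assume m: "lookup g (xyz m) \<noteq> 0"
    obtain i j k where mijk: "m = (i, j, k)" by (cases m)
    have "int (i + j + k) = d" using homogeneousD[OF g(1) m] unfolding mijk by simp
    then have deg: "i + j + k < t - 2" using d by linarith
    have "in_I (i + 1, j, k)" "in_I (i, j + 1, k)" "in_I (i, j, k + 1)"
      using mult[of 0, unfolded mem_ideal_I_iff, rule_format, of "(i + 1, j, k)"]
        mult[of 1, unfolded mem_ideal_I_iff, rule_format, of "(i, j + 1, k)"]
        mult[of 2, unfolded mem_ideal_I_iff, rule_format, of "(i, j, k + 1)"] m
      unfolding mijk lookup_pvar3_mult by simp_all
    then show "in_I m" using socle_degree[OF _ deg] unfolding mijk by blast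
  qed
qed

text \<open>
  \<open>R/I\<close> is generated by its elements of degree one.
\<close>

lemma surjective_above:
  fixes f :: "(3, 'k::field) pol"
  assumes onto: "\<forall>h \<in> homogeneous (d + 1). \<exists>g \<in> homogeneous d. h - f * g \<in> mono_ideal" and d: "0 \<le> d"
  shows "\<forall>h \<in> homogeneous (d + 1 + 1). \<exists>g \<in> homogeneous (d + 1). h - f * g \<in> mono_ideal"
proof
  fix h :: "(3, 'k) pol" assume hh: "h \<in> homogeneous (d + 1 + 1)"
  have "1 \<le> d + 1 + 1" using d by simp
  from homogeneous_split[OF hh this, unfolded add_diff_cancel_right'] obtain p where
    p: "\<And>x. p x \<in> homogeneous (d + 1)" and h: "h = (\<Sum>x\<in>UNIV. pvar x * p x)"
    by blast
  have "\<forall>x. \<exists>g. g \<in> homogeneous d \<and> p x - f * g \<in> mono_ideal" using onto p by blast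
  then obtain q where q: "\<And>x. q x \<in> homogeneous d" "\<And>x. p x - f * q x \<in> mono_ideal"
    unfolding choice_iff by blast
  let ?g = "\<Sum>x\<in>UNIV. pvar x * q x"
  have "h - f * ?g = (\<Sum>x\<in>UNIV. pvar x * (p x - f * q x))"
    unfolding h by (simp add: sum_distrib_left sum_subtractf right_diff_distrib mult.left_commute)
  also have "\<dots> \<in> mono_ideal" unfolding ideal_I_def
    by (intro ideal_gen_sum ideal_gen_mult) (rule q(2)[unfolded ideal_I_def])
  finally have "h - f * ?g \<in> mono_ideal" .
  moreover have "?g \<in> homogeneous (d + 1)"
    by (intro homogeneous_sum homogeneous_multI[OF homogeneous_pvar q(1)]) simp
  ultimately show "\<exists>g \<in> homogeneous (d + 1). h - f * g \<in> mono_ideal" by blast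
qed

lemma weak_Lefschetz_iff_det:
  "weak_Lefschetz (quot_ring (mono_ideal :: (3, 'k::field) pol set)) (quot_component mono_ideal) \<longleftrightarrow> det (weighted_Z TYPE('k) 1 1 (1 :: 'k)) \<noteq> 0"
proof
  let ?inj = "\<lambda>f d. \<forall>g \<in> homogeneous d. f * g \<in> (mono_ideal :: (3, 'k) pol set) \<longrightarrow> g \<in> mono_ideal"
  let ?onto = "\<lambda>f d. \<forall>h \<in> homogeneous (d + 1). \<exists>g \<in> homogeneous d. h - f * g \<in> (mono_ideal :: (3, 'k) pol set)"
  note iff = weak_Lefschetz_quot_iff[OF ideal_I_def[of a b c \<alpha> \<beta> \<gamma>], where 'k='k]
  {
    assume "weak_Lefschetz (quot_ring (mono_ideal :: (3, 'k::field) pol set)) (quot_component mono_ideal)"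
    then obtain f :: "(3, 'k) pol" where f: "f \<in> homogeneous 1" "?inj f (int t - 2) \<or> ?onto f (int t - 2)"
      unfolding iff by blast
    obtain u v w where "f = linear_form u v w" using homogeneous_1_linear_form[OF f(1)] by blast
    then have "det (weighted_Z TYPE('k) u v w) \<noteq> 0"
      using f(2) multiplication_at_s[of u v w] by auto
    then show "det (weighted_Z TYPE('k) 1 1 (1 :: 'k)) \<noteq> 0" using det_weighted_Z_eq_0 by blast
  next
    assume det: "det (weighted_Z TYPE('k) 1 1 (1 :: 'k)) \<noteq> 0"
    let ?l = "linear_form 1 1 1 :: (3, 'k) pol"
    have inj: "?inj ?l (int t - 2)" using multiplication_at_s(1)[of "1 :: 'k" 1 1] det by blast
    have onto: "?onto ?l (int t - 2)" using multiplication_at_s(2)[of "1 :: 'k" 1 1] det by simp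
    have "?inj ?l d \<or> ?onto ?l d" for d
    proof (cases "d \<le> int t - 2")
      case True
      then have "?inj ?l d"
      proof (induction d rule: int_le_induct)
        case base
        show ?case by (rule inj)
      next
        case (step d)
        then show ?case using injective_below[of "d - 1" ?l] by simp
      qed
      then show ?thesis ..
    next
      case False
      then have "int t - 2 \<le> d" by simp
      then have "?onto ?l d"
      proof (induction d rule: int_ge_induct)
        case base
        show ?case by (rule onto)
      next
        case (step d)
        then show ?case using surjective_above[of d ?l] t_ge_3 by simp
      qed
      then show ?thesis ..
    qed
    then show "weak_Lefschetz (quot_ring (mono_ideal :: (3, 'k) pol set)) (quot_component mono_ideal)"
      unfolding iff using linear_form_homogeneous by blast
  }
qed

end

context punctured_hexagon
begin

section \<open>The equivalences\<close>

lemma filling_generators_if_det: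
  assumes det: "det (N_field :: 'k::field mat) \<noteq> 0"
  shows "filling_generators (gens :: (2, 'k) pol list) es t"
proof
  have hom: "\<forall>k<4. (gens :: (2, 'k) pol list) ! k \<in> homogeneous (es ! k)"
    unfolding all_less_4 nth_gens nth_es
    using homogeneous_XY_product[of \<alpha> \<beta> \<gamma> "int (\<alpha> + \<beta> + \<gamma>)", where 'k='k]
      homogeneous_XY_product[of 0 0 c "int c", where 'k='k] by (simp_all add: homogeneous_pvar_power)
  have deg: "\<forall>k<4. 0 \<le> es ! k \<and> es ! k \<le> int t"
    unfolding all_less_4 nth_es using t_eq by linarith
  show "length es = length (gens :: (2, 'k) pol list)" by (simp add: length_gens)
  show "0 < t" using t_ge_3 by simp
  show "gens ! k \<in> (homogeneous (es ! k) :: (2, 'k) pol set)" "0 \<le> es ! k" "es ! k \<le> int t"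
    if "k < length (gens :: (2, 'k) pol list)" for k
    using hom deg that unfolding length_gens by blast+
  show "\<exists>v \<in> free_component es (int t - 1). (gen_row gens *\<^sub>v v) $ 0 = g"
    if "g \<in> homogeneous (int t - 1)" for g :: "(2, 'k) pol"
    by (rule spanning_if_det[OF det that])
  show "v = 0\<^sub>v (length (gens :: (2, 'k) pol list))"
    if "v \<in> syz gens" "v \<in> free_component es (int t - 1)" for v :: "(2, 'k) pol vec"
    using no_syzygies_iff_det[where 'k='k] det that unfolding length_gens by blast
qed

text \<open>
  If three of \<open>A\<close>, \<open>B\<close>, \<open>C\<close>, \<open>M\<close> were zero, the fourth one would be \<open>t\<close>, and the corresponding
  generator a constant.
\<close>

lemma two_low_degrees: "2 \<le> card {k. k < 4 \<and> es ! k < int t}" (is "2 \<le> card ?S")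
proof -
  have two: "2 \<le> card ?S" if "k \<in> ?S" "l \<in> ?S" "k \<noteq> l" for k l
    using card_mono[of ?S "{k, l}"] that by simp
  have low: "0 < M \<Longrightarrow> 0 \<in> ?S" "0 < A \<Longrightarrow> 1 \<in> ?S" "0 < B \<Longrightarrow> 2 \<in> ?S" "0 < C \<Longrightarrow> 3 \<in> ?S"
    using t_eq by simp_all
  have "\<not> (A = 0 \<and> B = 0 \<and> C = 0)" "\<not> (A = 0 \<and> B = 0 \<and> M = 0)" "\<not> (A = 0 \<and> C = 0 \<and> M = 0)"
    "\<not> (B = 0 \<and> C = 0 \<and> M = 0)"
    using t_eq exponents_less at_most_one_zero by linarith+
  then consider "0 < M" "0 < A" | "0 < M" "0 < B" | "0 < M" "0 < C" | "0 < A" "0 < B" | "0 < A" "0 < C" | "0 < B" "0 < C"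
    by force
  then show ?thesis
  proof cases
    case 1 show ?thesis by (rule two[OF low(1)[OF 1(1)] low(2)[OF 1(2)]]) simp
  next
    case 2 show ?thesis by (rule two[OF low(1)[OF 2(1)] low(3)[OF 2(2)]]) simp
  next
    case 3 show ?thesis by (rule two[OF low(1)[OF 3(1)] low(4)[OF 3(2)]]) simp
  next
    case 4 show ?thesis by (rule two[OF low(2)[OF 4(1)] low(3)[OF 4(2)]]) simp
  next
    case 5 show ?thesis by (rule two[OF low(2)[OF 5(1)] low(4)[OF 5(2)]]) simp
  next
    case 6 show ?thesis by (rule two[OF low(3)[OF 6(1)] low(4)[OF 6(2)]]) simp
  qed
qed

text \<open>
  From left to right, \<open>J\<close> contains powers of \<open>x\<close> and \<open>y\<close>, thus all forms of large degree, and one can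
  descend to degree \<open>t - 1\<close>.
\<close>

lemma regularity_iff_det:
  "quot_has_regularity (ideal_J a b c \<alpha> \<beta> \<gamma> :: (2, 'k::field) pol set) (int t - 2) \<longleftrightarrow> det (N_field :: 'k mat) \<noteq> 0"
proof
  assume reg: "quot_has_regularity (ideal_J a b c \<alpha> \<beta> \<gamma> :: (2, 'k) pol set) (int t - 2)"
  have pows: "Xp ^ a \<in> ideal_gen (set (gens :: (2, 'k) pol list))" "Yp ^ b \<in> ideal_gen (set (gens :: (2, 'k) pol list))"
    using ideal_gen_superset[of "set (gens :: (2, 'k) pol list)"] unfolding gens_eq by auto
  have "homogeneous (int t - 1) \<subseteq> (ideal_J a b c \<alpha> \<beta> \<gamma> :: (2, 'k) pol set)"
  proof (rule regularity_imp_filled[OF reg, where N = "int (a + b)"])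
    show "homogeneous d \<subseteq> (ideal_J a b c \<alpha> \<beta> \<gamma> :: (2, 'k) pol set)" if "int (a + b) \<le> d" for d
      unfolding ideal_J_eq by (rule homogeneous_subset_of_powers[OF pows]) (use that in simp)
  qed simp
  then show "det (N_field :: 'k mat) \<noteq> 0" by (rule det_N_nonzero_if_filled)
next
  assume det: "det (N_field :: 'k mat) \<noteq> 0"
  interpret filling_generators "gens :: (2, 'k) pol list" es t by (rule filling_generators_if_det[OF det])
  have "\<forall>k<4. 1 \<le> es ! k"
    unfolding all_less_4 nth_es using exponents_less at_most_one_zero by linarith
  then show "quot_has_regularity (ideal_J a b c \<alpha> \<beta> \<gamma> :: (2, 'k) pol set) (int t - 2)"
    unfolding ideal_J_eq
    by (intro has_regularity_if_two_low) (simp_all only: length_gens two_low_degrees)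
qed

lemma splitting_type_iff_det:
  "generic_splitting_type TYPE('k::field) a b c \<alpha> \<beta> \<gamma> {#int t, int t, int t#} \<longleftrightarrow> det (N_field :: 'k mat) \<noteq> 0"
proof
  assume split: "generic_splitting_type TYPE('k) a b c \<alpha> \<beta> \<gamma> {#int t, int t, int t#}"
  have "v = 0\<^sub>v 4" if "v \<in> free_component es (int t - 1)" "v \<in> syz gens" for v :: "(2, 'k) pol vec"
    using splits_imp_no_syzygies[OF split[unfolded generic_splitting_type_def] _ that(2,1)] unfolding length_gens by auto
  then show "det (N_field :: 'k mat) \<noteq> 0" unfolding no_syzygies_iff_det[symmetric] by blast
next
  assume det: "det (N_field :: 'k mat) \<noteq> 0"
  interpret filling_generators "gens :: (2, 'k) pol list" es t by (rule filling_generators_if_det[OF det])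
  have "replicate_mset (length (gens :: (2, 'k) pol list) - 1) (int t) = {#int t, int t, int t#}"
    unfolding length_gens by (simp add: eval_nat_numeral)
  then show "generic_splitting_type TYPE('k) a b c \<alpha> \<beta> \<gamma> {#int t, int t, int t#}"
    using syz_splits unfolding generic_splitting_type_def by simp
qed

end

theorem theorem9p9:
  fixes a b c \<alpha> \<beta> \<gamma> :: nat
    and s A B C M :: int
    and I :: "(3, 'k::field) pol set"
    and J :: "(2, 'k) pol set"
  assumes K: "infinite (UNIV :: 'k set)"
    and range: "\<alpha> < a" "\<beta> < b" "\<gamma> < c"
    and zeros: "\<not> (\<alpha> = 0 \<and> \<beta> = 0)" "\<not> (\<alpha> = 0 \<and> \<gamma> = 0)" "\<not> (\<beta> = 0 \<and> \<gamma> = 0)"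
    and I: "I = ideal_I a b c \<alpha> \<beta> \<gamma>"
    and J: "J = ideal_J a b c \<alpha> \<beta> \<gamma>"
    and mod3: "[a + b + c + \<alpha> + \<beta> + \<gamma> = 0] (mod 3)"
    and s: "s = hexagon_s a b c \<alpha> \<beta> \<gamma>"
    and A: "A = s + 2 - int a"
    and B: "B = s + 2 - int b"
    and C: "C = s + 2 - int c"
    and M: "M = s + 2 - int (\<alpha> + \<beta> + \<gamma>)"
    and hexagon: "0 \<le> M" "0 \<le> A" "A \<le> int (\<beta> + \<gamma>)" "0 \<le> B" "B \<le> int (\<alpha> + \<gamma>)"
      "0 \<le> C" "C \<le> int (\<alpha> + \<beta>)"
  shows
    "(weak_Lefschetz (quot_ring I) (quot_component I) \<longleftrightarrow> quot_has_regularity J s) \<and>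
     (quot_has_regularity J s \<longleftrightarrow>
        \<not> [det (N_matrix a b c \<alpha> \<beta> \<gamma>) = 0] (mod int CHAR('k))) \<and>
     (\<not> [det (N_matrix a b c \<alpha> \<beta> \<gamma>) = 0] (mod int CHAR('k)) \<longleftrightarrow>
        \<not> [det (Z_matrix TYPE('k) a b c \<alpha> \<beta> \<gamma>) = 0] (mod int CHAR('k))) \<and>
     (CHAR('k) = 0 \<longrightarrow>
        (\<not> [det (Z_matrix TYPE('k) a b c \<alpha> \<beta> \<gamma>) = 0] (mod int CHAR('k)) \<longleftrightarrow>
         generic_splitting_type TYPE('k) a b c \<alpha> \<beta> \<gamma> {#s + 2, s + 2, s + 2#}))"
proof -
  have "(a + b + c + \<alpha> + \<beta> + \<gamma>) mod 3 = 0" using mod3 by (simp add: cong_def)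
  then obtain t where sum: "a + b + c + \<alpha> + \<beta> + \<gamma> = 3 * t" by (auto simp: mod_eq_0_iff_dvd)
  have s_t: "s = int t - 2" unfolding s hexagon_s_def sum by simp
  interpret punctured_hexagon a b c \<alpha> \<beta> \<gamma> "nat A" "nat B" "nat C" "nat M" t
  proof
    have nats: "int (nat A) = int t - int a" "int (nat B) = int t - int b" "int (nat C) = int t - int c"
      "int (nat M) = int t - int (\<alpha> + \<beta> + \<gamma>)"
      using hexagon A B C M s_t by simp_all
    show "t = a + nat A" "t = b + nat B" "t = c + nat C" "t = \<alpha> + \<beta> + \<gamma> + nat M" using nats by linarith+
    then show "t = nat A + nat B + nat C + nat M" using sum by linarith
    show "nat A \<le> \<beta> + \<gamma>" "nat B \<le> \<alpha> + \<gamma>" "nat C \<le> \<alpha> + \<beta>" using hexagon by linarith+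
  qed (use range zeros in auto)
  have detN: "det (map_mat of_int (N_matrix a b c \<alpha> \<beta> \<gamma>) :: 'k mat) = 0
      \<longleftrightarrow> [det (N_matrix a b c \<alpha> \<beta> \<gamma>) = 0] (mod int CHAR('k))"
    unfolding of_int_hom.hom_det by (rule of_int_eq_0_iff_cong)
  have detZ: "det (weighted_Z TYPE('k) 1 1 (1 :: 'k)) = 0 \<longleftrightarrow> [det (Z_matrix TYPE('k) a b c \<alpha> \<beta> \<gamma>) = 0] (mod int CHAR('k))"
    unfolding Z_matrix_eq[symmetric] of_int_hom.hom_det by (rule of_int_eq_0_iff_cong)
  have s2: "s + 2 = int t" using s_t by simp
  show ?thesis
    unfolding I J s2 unfolding s_t weak_Lefschetz_iff_det regularity_iff_det splitting_type_iff_det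
      detN[symmetric] detZ[symmetric] det_Z_eq_0_iff_det_N by blast
qed

end
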